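(* Let $b_j\in\mathbb{R}$, $\sigma_j>0$ and $\nu_j$ be a Lévy measure on $\mathbb{R}$, $j=1,2$. For all $t>0$ and $\varepsilon\in(0,1]$, $$\begin{aligned}\Big\|P_t^{(b_1,\sigma_1,\nu_1)}-P_t^{(b_2,\sigma_2,\nu_2)}\Big\|_{TV}&\le\frac{\sqrt{\frac{t}{2\pi}}\,\big|b_1(\varepsilon)-b_2(\varepsilon)\big|+\sqrt2\,\Big|\sqrt{\sigma_1^2+\bar\sigma_1^2(\varepsilon)}-\sqrt{\sigma_2^2+\bar\sigma_2^2(\varepsilon)}\Big|}{\sqrt{\sigma_1^2+\bar\sigma_1^2(\varepsilon)}\vee\sqrt{\sigma_2^2+\bar\sigma_2^2(\varepsilon)}}\\&\quad+\sum_{i=1}^2\sqrt{\frac{2}{\pi t\sigma_i^2}}\,\min\Big(2\sqrt{t\bar\sigma_i^2(\varepsilon)},\frac{\varepsilon}{2}\Big)\\&\quad+t\big|\lambda_1(\varepsilon)-\lambda_2(\varepsilon)\big|+t\big(\lambda_1(\varepsilon)\wedge\lambda_2(\varepsilon)\big)\Big\|\frac{\nu_1^\varepsilon}{\lambda_1(\varepsilon)}-\frac{\nu_2^\varepsilon}{\lambda_2(\varepsilon)}\Big\|_{TV}.\end{aligned}$$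
   Context: $P_t^{(b,\sigma,\nu)}$ is the law at time $t$ of a real Lévy process $X$ with characteristics $(b,\sigma^2,\nu)$, i.e. $\mathbb E[e^{iuX_t}]=\exp\big(t(iub-\frac{u^2\sigma^2}{2}+\int(e^{iux}-1-iux\mathbf 1_{|x|\le1})\nu(dx))\big)$. For $j=1,2$: $b_j(\varepsilon):=b_j-\int_{\varepsilon<|x|\le1}x\,\nu_j(dx)$, $\bar\sigma_j^2(\varepsilon):=\int_{|x|\le\varepsilon}x^2\nu_j(dx)$, $\nu_j^\varepsilon:=\nu_j(\,\cdot\,\cap\{|x|>\varepsilon\})$, $\lambda_j(\varepsilon):=\nu_j^\varepsilon(\mathbb{R})$. The last term is read as $0$ if $\lambda_1(\varepsilon)\wedge\lambda_2(\varepsilon)=0$. The total variation distance of probability measures is $\|\mu-\nu\|_{TV}=\sup_A|\mu(A)-\nu(A)|$, the supremum over measurable sets. $x\vee y$, $x\wedge y$ denote maximum and minimum. *)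

theory Defs
  imports "HOL-Probability.Probability"
begin

definition levy_measure :: "real measure \<Rightarrow> bool" where
  "levy_measure \<nu> \<longleftrightarrow>
     sets \<nu> = sets borel \<and> emeasure \<nu> {0} = 0 \<and>
     (\<integral>\<^sup>+ x. ennreal (min 1 (x\<^sup>2)) \<partial>\<nu>) < \<infinity>"

text \<open>
  Stochastic continuity is the only path regularity required; processes with
  right-continuous paths with left limits and stationary increments satisfy it.
  Only the times \<open>t \<ge> 0\<close> of the family \<open>X\<close> are relevant.
\<close>

locale levy_process = prob_space M
  for M :: "'a measure" and X :: "real \<Rightarrow> 'a \<Rightarrow> real" +
  assumes random_variable_X: "\<And>t. 0 \<le> t \<Longrightarrow> random_variable borel (X t)"
    and start: "AE \<omega> in M. X 0 \<omega> = 0"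
    and independent_increments:
      "\<And>(s :: nat \<Rightarrow> real) n. 0 \<le> s 0 \<Longrightarrow> mono s \<Longrightarrow>
         indep_vars (\<lambda>_. borel) (\<lambda>i \<omega>. X (s (Suc i)) \<omega> - X (s i) \<omega>) {..<n}"
    and stationary_increments:
      "\<And>s t. 0 \<le> s \<Longrightarrow> 0 \<le> t \<Longrightarrow>
         distr M borel (\<lambda>\<omega>. X (s + t) \<omega> - X s \<omega>) = distr M borel (\<lambda>\<omega>. X t \<omega> - X 0 \<omega>)"
    and stochastic_continuity:
      "\<And>t e. 0 \<le> t \<Longrightarrow> 0 < e \<Longrightarrow>
         ((\<lambda>s. prob {\<omega> \<in> space M. e < \<bar>X s \<omega> - X t \<omega>\<bar>}) \<longlongrightarrow> 0) (at t within {0..})"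

definition levy_exponent :: "real \<Rightarrow> real \<Rightarrow> real measure \<Rightarrow> real \<Rightarrow> complex" where
  "levy_exponent b v \<nu> u =
     \<i> * of_real (u * b) - of_real (u\<^sup>2 * v / 2)
     + (CLINT x|\<nu>. iexp (u * x) - 1 - \<i> * of_real (u * x * indicator {x. \<bar>x\<bar> \<le> 1} x))"

text \<open>The second characteristic \<open>v\<close> is the variance \<open>\<sigma>\<^sup>2\<close> of the Gaussian part.\<close>

definition has_characteristics ::
  "'a measure \<Rightarrow> (real \<Rightarrow> 'a \<Rightarrow> real) \<Rightarrow> real \<Rightarrow> real \<Rightarrow> real measure \<Rightarrow> bool" where
  "has_characteristics M X b v \<nu> \<longleftrightarrow>
     (\<forall>t\<ge>0. \<forall>u. char (distr M borel (X t)) u = exp (of_real t * levy_exponent b v \<nu> u))"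

definition tv_dist :: "real measure \<Rightarrow> real measure \<Rightarrow> real" where
  "tv_dist \<mu> \<nu> = (SUP A\<in>sets borel. \<bar>measure \<mu> A - measure \<nu> A\<bar>)"

definition trunc_drift :: "real \<Rightarrow> real measure \<Rightarrow> real \<Rightarrow> real" where
  "trunc_drift b \<nu> \<epsilon> = b - (LINT x:{x. \<epsilon> < \<bar>x\<bar> \<and> \<bar>x\<bar> \<le> 1}|\<nu>. x)"

definition small_jump_var :: "real measure \<Rightarrow> real \<Rightarrow> real" where
  "small_jump_var \<nu> \<epsilon> = (LINT x:{x. \<bar>x\<bar> \<le> \<epsilon>}|\<nu>. x\<^sup>2)"

definition big_jumps :: "real measure \<Rightarrow> real \<Rightarrow> real measure" where
  "big_jumps \<nu> \<epsilon> = density \<nu> (indicator {x. \<epsilon> < \<bar>x\<bar>})"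

lemma emeasure_big_jumps:
  assumes "sets \<nu> = sets borel" and "A \<in> sets borel"
  shows "emeasure (big_jumps \<nu> \<epsilon>) A = emeasure \<nu> (A \<inter> {x. \<epsilon> < \<bar>x\<bar>})"
proof -
  have "{x::real. \<epsilon> < \<bar>x\<bar>} \<in> sets borel" by measurable
  then show ?thesis
    using assms by (simp add: big_jumps_def emeasure_restricted Int_commute)
qed

definition jump_intensity :: "real measure \<Rightarrow> real \<Rightarrow> real" where
  "jump_intensity \<nu> \<epsilon> = measure (big_jumps \<nu> \<epsilon>) UNIV"

text \<open>The division yields the zero measure if the intensity vanishes.\<close>

definition jump_law :: "real measure \<Rightarrow> real \<Rightarrow> real measure" where
  "jump_law \<nu> \<epsilon> = scale_measure (ennreal (1 / jump_intensity \<nu> \<epsilon>)) (big_jumps \<nu> \<epsilon>)"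

end

theory Submission
  imports Defs
begin

text \<open>
  The law at time \<open>t\<close> is the weak limit of random walks with \<open>n\<close> independent steps, each composed of
  a Gaussian part, a centred small jump, and a large jump taken with probability \<open>t \<lambda>(\<epsilon>) / n\<close>. Total
  variation bounds that hold for all continuous test functions with values in \<open>[0, 1]\<close> pass to the
  limit, so it suffices to compare the walks; neither the Levy-Ito decomposition nor compound Poisson
  laws are needed. A single large-jump step changes the law by at most \<open>1 / n\<close> times the last two
  terms of the bound, and telescoping over the \<open>n\<close> steps gives these terms. The sum of the small jumps
  is replaced, step by step as in Lindeberg's proof of the central limit theorem, by a Gaussian variable
  of the same variance; the Gaussian part with variance \<open>t \<sigma>\<^sup>2\<close> has already smoothed the test function,
  and the \<open>L\<^sup>1\<close> norms of the derivatives of the Gaussian density control the Taylor remainders. It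
  remains to compare two Gaussian laws.
\<close>

subsection \<open>Averaging operators\<close>

text \<open>The alternative \<epsilon> / 2 in the minimum does not involve the variance v of the
  small jumps, and this shapes the Lindeberg argument. A third-order remainder at a fixed Gaussian
  scale s would give a multiple of \<epsilon> t v / s^3. After k replacements, however, the Gaussian
  has absorbed the variance k \<tau>, where \<tau> = t v / n, so the next one costs a multiple of
  \<epsilon> \<tau> / s_k^3 with s_k^2 = t \<sigma>^2 + k \<tau>. Up to its first term the sum of
  these stays below the integral of \<epsilon> d(s^2) / s^3, which is at most 2 \<epsilon> / (sqrt t
  \<sigma>) however large v is. The other alternative combines the second-order error r^2 = v /
  \<sigma>^2 with the trivial bound 1, since min(1, r^2) <= r. The small jumps may have infinite
  rate, so a step ignores those below a cut-off; the variance lost in this way and the displacement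
  that centres the step are errors that vanish in the limit. The large jumps act on the test
  function before the smoothing, so all regularity comes from the Gaussian density.\<close>

definition test_fun :: "(real \<Rightarrow> real) \<Rightarrow> bool" where
  "test_fun f \<longleftrightarrow> f \<in> borel_measurable borel \<and> (\<forall>x. 0 \<le> f x \<and> f x \<le> 1)"

text \<open>The transition operator of a random walk with step law \<mu>. Convolution of laws
  becomes composition of operators (\<open>avg_convolution\<close>), so an n-step walk becomes an
  n-th power.\<close>

definition avg :: "real measure \<Rightarrow> (real \<Rightarrow> real) \<Rightarrow> real \<Rightarrow> real" where
  "avg \<mu> f x = (LINT y|\<mu>. f (x + y))"

lemma test_funD:
  assumes "test_fun f"
  shows "f \<in> borel_measurable borel" "0 \<le> f x" "f x \<le> 1" "\<bar>f x\<bar> \<le> 1" "\<bar>f x - 1/2\<bar> \<le> 1/2"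
proof -
  have *: "0 \<le> f x" "f x \<le> 1" and "f \<in> borel_measurable borel" using assms by (auto simp: test_fun_def)
  then show "f \<in> borel_measurable borel" "0 \<le> f x" "f x \<le> 1" by auto
  show "\<bar>f x\<bar> \<le> 1" "\<bar>f x - 1/2\<bar> \<le> 1/2" using * unfolding abs_le_iff by (simp_all add: field_simps)
qed

lemma integrable_bounded_real:
  fixes f :: "'a \<Rightarrow> real"
  assumes "finite_measure M" "f \<in> borel_measurable M" "\<And>x. \<bar>f x\<bar> \<le> B"
  shows "integrable M f"
  using assms by (intro finite_measure.integrable_const_bound[of M f B]) auto

lemma test_fun_integrable:
  assumes "test_fun f" "finite_measure \<mu>" "sets \<mu> = sets borel"
  shows "integrable \<mu> (\<lambda>y. f (x + y))"
proof -
  have [measurable]: "f \<in> borel_measurable borel" by (rule test_funD[OF assms(1)])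
  have [measurable_cong]: "sets \<mu> = sets borel" by fact
  show ?thesis
    using assms by (intro integrable_bounded_real[where B=1]) (auto intro: test_funD)
qed

lemma avg_test_fun:
  assumes "test_fun f" "real_distribution \<mu>"
  shows "test_fun (avg \<mu> f)"
proof -
  interpret real_distribution \<mu> by fact
  have [measurable]: "f \<in> borel_measurable borel" by (rule test_funD[OF assms(1)])
  note I = test_fun_integrable[OF assms(1) finite_measure_axioms events_eq_borel]
  have "avg \<mu> f \<in> borel_measurable borel"
    unfolding avg_def[abs_def] by measurable
  moreover have "0 \<le> avg \<mu> f x" for x
    unfolding avg_def by (intro integral_nonneg_AE) (simp add: test_funD[OF assms(1)])
  moreover have "avg \<mu> f x \<le> 1" for x
    unfolding avg_def using I
    by (intro integral_le_const) (simp_all add: test_funD[OF assms(1)])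
  ultimately show ?thesis by (auto simp: test_fun_def)
qed

lemma avg_pow_test_fun:
  assumes "test_fun f" "real_distribution \<mu>"
  shows "test_fun ((avg \<mu> ^^ n) f)"
  by (induction n) (auto intro: avg_test_fun assms)

lemma test_fun_compl: "test_fun f \<Longrightarrow> test_fun (\<lambda>x. 1 - f x)"
  by (auto simp: test_fun_def)

lemma avg_contraction:
  assumes "test_fun f" "test_fun g" "real_distribution \<mu>" "\<And>x. \<bar>f x - g x\<bar> \<le> c"
  shows "\<bar>avg \<mu> f x - avg \<mu> g x\<bar> \<le> c"
proof -
  interpret real_distribution \<mu> by fact
  note I = test_fun_integrable[OF _ finite_measure_axioms events_eq_borel]
  have "\<bar>avg \<mu> f x - avg \<mu> g x\<bar> = \<bar>LINT y|\<mu>. f (x+y) - g (x+y)\<bar>"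
    unfolding avg_def using I[OF assms(1)] I[OF assms(2)] by simp
  also have "\<dots> \<le> (LINT y|\<mu>. \<bar>f (x+y) - g (x+y)\<bar>)" by (rule integral_abs_bound)
  also have "\<dots> \<le> c"
    using I[OF assms(1), of x] I[OF assms(2), of x] assms(4) by (intro integral_le_const) auto
  finally show ?thesis .
qed

lemma avg_pow_contraction:
  assumes "test_fun f" "test_fun g" "real_distribution \<mu>" "\<And>x. \<bar>f x - g x\<bar> \<le> c"
  shows "\<bar>(avg \<mu> ^^ n) f x - (avg \<mu> ^^ n) g x\<bar> \<le> c"
proof (induction n arbitrary: x)
  case (Suc n)
  show ?case
    using avg_contraction[OF avg_pow_test_fun[OF assms(1,3)] avg_pow_test_fun[OF assms(2,3)] assms(3) Suc]
    by simp
qed (simp add: assms)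

text \<open>Steps are exchanged from the inside outwards; the operators still to be applied are
  contractions and do not enlarge the errors made so far. The error \<open>e k\<close> may depend on
  k, so that later steps can profit from the larger Gaussian scale.\<close>

lemma avg_telescope:
  assumes \<mu>: "real_distribution \<mu>" and g: "\<And>k. test_fun (g k)"
    and step: "\<And>k x. k < n \<Longrightarrow> \<bar>avg \<mu> (g k) x - g (Suc k) x\<bar> \<le> e k"
  shows "\<bar>(avg \<mu> ^^ n) (g 0) x - g n x\<bar> \<le> (\<Sum>k<n. e k)"
  using step
proof (induction n arbitrary: x)
  case (Suc n)
  have IH: "\<bar>(avg \<mu> ^^ n) (g 0) y - g n y\<bar> \<le> (\<Sum>k<n. e k)" for y
    using Suc by simp
  have "\<bar>avg \<mu> ((avg \<mu> ^^ n) (g 0)) x - avg \<mu> (g n) x\<bar> \<le> (\<Sum>k<n. e k)"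
    by (rule avg_contraction[OF avg_pow_test_fun[OF g \<mu>] g \<mu> IH])
  moreover have "\<bar>avg \<mu> (g n) x - g (Suc n) x\<bar> \<le> e n"
    using Suc by simp
  ultimately show ?case by simp
qed simp

lemma avg_pow_diff:
  assumes \<mu>: "real_distribution \<mu>" and \<nu>: "real_distribution \<nu>" and f: "test_fun f"
    and step: "\<And>g x. test_fun g \<Longrightarrow> \<bar>avg \<mu> g x - avg \<nu> g x\<bar> \<le> c"
  shows "\<bar>(avg \<mu> ^^ n) f x - (avg \<nu> ^^ n) f x\<bar> \<le> real n * c"
  using avg_telescope[OF \<mu>, of "\<lambda>k. (avg \<nu> ^^ k) f" n "\<lambda>_. c" x] avg_pow_test_fun[OF f \<nu>] step
  by simp

subsection \<open>Convolution\<close>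

lemma real_distribution_convolution:
  assumes "real_distribution \<mu>" "real_distribution \<nu>"
  shows "real_distribution (\<mu> \<star> \<nu>)"
proof -
  interpret \<mu>: real_distribution \<mu> by fact
  interpret \<nu>: real_distribution \<nu> by fact
  interpret pair_prob_space \<mu> \<nu> ..
  have "prob_space (\<mu> \<star> \<nu>)"
    unfolding convolution_def by (intro prob_space_distr) auto
  then show ?thesis
    by (auto simp: real_distribution_def real_distribution_axioms_def)
qed

lemma integral_convolution:
  fixes f :: "real \<Rightarrow> 'b::{banach, second_countable_topology}"
  assumes "real_distribution \<mu>" "real_distribution \<nu>"
    and [measurable]: "f \<in> borel_measurable borel" and B: "\<And>x. norm (f x) \<le> B"
  shows "integral\<^sup>L (\<mu> \<star> \<nu>) f = (LINT x|\<mu>. LINT y|\<nu>. f (x + y))"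
proof -
  interpret \<mu>: real_distribution \<mu> by fact
  interpret \<nu>: real_distribution \<nu> by fact
  interpret pair_prob_space \<mu> \<nu> ..
  have "integral\<^sup>L (\<mu> \<star> \<nu>) f = (LINT p|(\<mu> \<Otimes>\<^sub>M \<nu>). f (fst p + snd p))"
    unfolding convolution_def by (subst integral_distr) (auto simp: case_prod_beta)
  also have "\<dots> = (LINT x|\<mu>. LINT y|\<nu>. f (x + y))"
    using B by (subst integral_fst'[symmetric]) (auto intro!: integrable_const_bound[of _ B])
  finally show ?thesis .
qed

lemma avg_convolution:
  assumes "real_distribution \<mu>" "real_distribution \<nu>" "test_fun f"
  shows "avg (\<mu> \<star> \<nu>) f = avg \<mu> (avg \<nu> f)"
proof
  fix x
  have [measurable]: "f \<in> borel_measurable borel" by (rule test_funD[OF assms(3)])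
  show "avg (\<mu> \<star> \<nu>) f x = avg \<mu> (avg \<nu> f) x"
    unfolding avg_def
    by (subst integral_convolution[OF assms(1,2), of _ 1]) (auto simp: test_funD[OF assms(3)] add.assoc)
qed

lemma char_convolution:
  assumes "real_distribution \<mu>" "real_distribution \<nu>"
  shows "char (\<mu> \<star> \<nu>) u = char \<mu> u * char \<nu> u"
proof -
  have "char (\<mu> \<star> \<nu>) u = (CLINT x|\<mu>. CLINT y|\<nu>. iexp (u * (x + y)))"
    unfolding char_def by (rule integral_convolution[OF assms, of _ 1]) auto
  also have "\<dots> = (CLINT x|\<mu>. CLINT y|\<nu>. iexp (u * x) * iexp (u * y))"
    by (simp add: distrib_left exp_add)
  finally show ?thesis unfolding char_def by simp
qed

text \<open>The seed \<nu> lets walks be nested without appeal to associativity or commutativity of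
  convolution: averaging gives the n-th power of \<open>avg \<mu>\<close> applied to
  \<open>avg \<nu> f\<close>.\<close>

fun conv_pow :: "real measure \<Rightarrow> nat \<Rightarrow> real measure \<Rightarrow> real measure" where
  "conv_pow \<mu> 0 \<nu> = \<nu>"
| "conv_pow \<mu> (Suc n) \<nu> = (\<mu> \<star> conv_pow \<mu> n \<nu>)"

lemma real_distribution_conv_pow:
  "real_distribution \<mu> \<Longrightarrow> real_distribution \<nu> \<Longrightarrow> real_distribution (conv_pow \<mu> n \<nu>)"
  by (induction n) (auto intro: real_distribution_convolution)

lemma char_conv_pow:
  assumes "real_distribution \<mu>" "real_distribution \<nu>"
  shows "char (conv_pow \<mu> n \<nu>) u = char \<mu> u ^ n * char \<nu> u"
  by (induction n) (simp_all add: char_convolution real_distribution_conv_pow assms)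

lemma avg_conv_pow:
  assumes "real_distribution \<mu>" "real_distribution \<nu>" "test_fun f"
  shows "avg (conv_pow \<mu> n \<nu>) f = (avg \<mu> ^^ n) (avg \<nu> f)"
  by (induction n) (simp_all add: avg_convolution real_distribution_conv_pow assms)

lemma real_distribution_return: "real_distribution (return borel x)"
  by (simp add: real_distribution_def real_distribution_axioms_def prob_space_return)

lemma avg_return: "test_fun f \<Longrightarrow> avg (return borel a) f x = f (x + a)"
  unfolding avg_def by (subst integral_return) (auto dest: test_funD(1))

lemma char_return: "char (return borel a) u = iexp (u * a)"
  unfolding char_def by (subst integral_return) auto

subsection \<open>Total variation distance via test functions\<close>

text \<open>The indicator of K is the pointwise limit of the continuous functions max(0, 1 - n
  dist(x, K)); that they vanish eventually outside K is where closedness enters.\<close>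

lemma tv_le_closed:
  fixes \<mu> \<nu> :: "real measure"
  assumes "real_distribution \<mu>" "real_distribution \<nu>"
    and le: "\<And>h. test_fun h \<Longrightarrow> continuous_on UNIV h \<Longrightarrow> \<bar>integral\<^sup>L \<mu> h - integral\<^sup>L \<nu> h\<bar> \<le> C"
    and K: "closed K"
  shows "\<bar>measure \<mu> K - measure \<nu> K\<bar> \<le> C"
proof (cases "K = {}")
  \<comment> \<open>\<open>infdist x {}\<close> is 0 by convention, so the functions used in the
    other case would be constantly 1. Here the test function 0 yields 0 <= C.\<close>
  case True
  have "\<bar>integral\<^sup>L \<mu> (\<lambda>_. 0) - integral\<^sup>L \<nu> (\<lambda>_. 0)\<bar> \<le> C" by (rule le) (auto simp: test_fun_def)
  with True show ?thesis by simp
next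
  case False
  define h where "h n x = max 0 (1 - real n * infdist x K)" for n x
  have h: "test_fun (h n)" "continuous_on UNIV (h n)" for n
  proof -
    show "continuous_on UNIV (h n)" unfolding h_def by (intro continuous_intros)
    then show "test_fun (h n)"
      by (auto simp: test_fun_def h_def infdist_nonneg intro: borel_measurable_continuous_onI)
  qed
  have lim: "(\<lambda>n. h n x) \<longlonglongrightarrow> indicator K x" for x
  proof (cases "x \<in> K")
    case True then show ?thesis by (simp add: h_def)
  next
    case False
    then have p: "infdist x K > 0"
      using K \<open>K \<noteq> {}\<close> infdist_nonneg[of x K] in_closed_iff_infdist_zero by (metis less_le)
    obtain N :: nat where N: "1 / infdist x K < real N" using reals_Archimedean2 by blast
    have "h n x = 0" if "n \<ge> N" for n
    proof -
      have "1 / infdist x K < real n" using N that by linarith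
      then show ?thesis using p by (auto simp: h_def field_simps max_def)
    qed
    then have "eventually (\<lambda>n. h n x = 0) sequentially" by (auto simp: eventually_sequentially)
    then show ?thesis using False by (simp add: tendsto_eventually)
  qed
  have conv: "(\<lambda>n. integral\<^sup>L \<rho> (h n)) \<longlonglongrightarrow> measure \<rho> K" if "real_distribution \<rho>" for \<rho>
  proof -
    interpret real_distribution \<rho> by fact
    have [measurable]: "K \<in> sets borel" using K by auto
    have [measurable]: "h n \<in> borel_measurable borel" for n using h(1) test_funD by blast
    have "(\<lambda>n. integral\<^sup>L \<rho> (h n)) \<longlonglongrightarrow> integral\<^sup>L \<rho> (indicator K :: real \<Rightarrow> real)"
      by (rule integral_dominated_convergence[where w="\<lambda>_. 1"])
         (use lim test_funD(4)[OF h(1)] in auto)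
    then show ?thesis by simp
  qed
  have "(\<lambda>n. \<bar>integral\<^sup>L \<mu> (h n) - integral\<^sup>L \<nu> (h n)\<bar>) \<longlonglongrightarrow> \<bar>measure \<mu> K - measure \<nu> K\<bar>"
    by (intro tendsto_intros conv assms)
  then show ?thesis
    by (rule tendsto_upperbound) (use le h in auto)
qed

text \<open>Inner regularity leads from closed sets to Borel sets. It is enough to approximate A
  from inside for P, since Q K <= Q A; exchanging the two laws gives the other sign.\<close>

lemma tv_dist_le:
  fixes \<mu> \<nu> :: "real measure"
  assumes \<mu>: "real_distribution \<mu>" and \<nu>: "real_distribution \<nu>"
    and le: "\<And>h. test_fun h \<Longrightarrow> continuous_on UNIV h \<Longrightarrow> \<bar>integral\<^sup>L \<mu> h - integral\<^sup>L \<nu> h\<bar> \<le> C"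
  shows "tv_dist \<mu> \<nu> \<le> C"
proof -
  have *: "measure P A - measure Q A \<le> C" if PQ: "real_distribution P" "real_distribution Q"
    and cl: "\<And>K. closed K \<Longrightarrow> \<bar>measure P K - measure Q K\<bar> \<le> C" and A: "A \<in> sets borel" for P Q A
  proof (rule field_le_epsilon)
    fix e :: real assume e: "e > 0"
    interpret P: real_distribution P by fact
    interpret Q: real_distribution Q by fact
    have "emeasure P A = (SUP K \<in> {K. K \<subseteq> A \<and> compact K}. emeasure P K)"
      by (rule inner_regular) (use A in auto)
    moreover have "ennreal (measure P A - e) < emeasure P A" if "measure P A \<ge> e"
      using e that by (simp add: P.emeasure_eq_measure ennreal_less_iff)
    ultimately have "\<exists>K. K \<subseteq> A \<and> compact K \<and> measure P A - e \<le> measure P K"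
    \<comment> \<open>\<open>ennreal\<close> truncates negative numbers to 0, so the strict
      inequality may fail when P A < e; then the empty set serves as K.\<close>
    proof (cases "measure P A \<ge> e")
      case True
      then have "ennreal (measure P A - e) < (SUP K \<in> {K. K \<subseteq> A \<and> compact K}. emeasure P K)"
        using \<open>emeasure P A = _\<close> \<open>_ \<Longrightarrow> ennreal (measure P A - e) < emeasure P A\<close> by simp
      then obtain K where "K \<subseteq> A" "compact K" "ennreal (measure P A - e) < emeasure P K"
        by (auto simp: less_SUP_iff)
      then show ?thesis
        using True by (auto simp: P.emeasure_eq_measure ennreal_less_iff intro!: exI[of _ K])
    qed (auto intro!: exI[of _ "{}"])
    then obtain K where K: "K \<subseteq> A" "compact K" "measure P A - e \<le> measure P K" by blast
    have "measure Q K \<le> measure Q A" using K A by (intro Q.finite_measure_mono) auto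
    with cl[OF compact_imp_closed[OF K(2)]] K(3) show "measure P A - measure Q A \<le> C + e"
      by linarith
  qed
  note cl = tv_le_closed[OF assms]
  have "\<bar>measure \<mu> A - measure \<nu> A\<bar> \<le> C" if "A \<in> sets borel" for A
    using *[OF \<mu> \<nu> cl that] *[OF \<nu> \<mu> _ that] cl by (auto simp: abs_le_iff)
  then show ?thesis unfolding tv_dist_def by (intro cSUP_least) auto
qed

lemma tv_dist_ge:
  assumes "real_distribution \<mu>" "real_distribution \<nu>" "A \<in> sets borel"
  shows "\<bar>measure \<mu> A - measure \<nu> A\<bar> \<le> tv_dist \<mu> \<nu>"
  unfolding tv_dist_def
proof (rule cSUP_upper)
  interpret \<mu>: real_distribution \<mu> by fact
  interpret \<nu>: real_distribution \<nu> by fact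
  have "\<bar>measure \<mu> A - measure \<nu> A\<bar> \<le> 1" for A
    using \<mu>.prob_le_1[of A] \<nu>.prob_le_1[of A] measure_nonneg[of \<mu> A] measure_nonneg[of \<nu> A] by linarith
  then show "bdd_above ((\<lambda>A. \<bar>measure \<mu> A - measure \<nu> A\<bar>) ` sets borel)"
    by (intro bdd_aboveI2[where M=1]) auto
qed fact

text \<open>Layer cake: a test function is the mean of the indicators of its superlevel sets.\<close>

lemma integral_layer_cake:
  assumes "real_distribution \<mu>" "test_fun f"
  shows "integral\<^sup>L \<mu> f = (LINT s|lborel. indicator {0..1} s * measure \<mu> {x. s < f x})"
    and "integrable lborel (\<lambda>s. indicator {0..1} s * measure \<mu> {x. s < f x})"
proof -
  interpret real_distribution \<mu> by fact
  have [measurable]: "f \<in> borel_measurable borel" by (rule test_funD[OF assms(2)])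
  interpret pair_sigma_finite \<mu> lborel ..
  have int: "integrable (\<mu> \<Otimes>\<^sub>M lborel) (\<lambda>(x, s). indicator {0..1} s * indicator {s. s < f x} s :: real)"
  proof (subst integrable_iff_bounded, safe)
    have "(\<integral>\<^sup>+p. ennreal (norm ((\<lambda>(x, s). indicator {0..1} s * indicator {s. s < f x} s :: real) p)) \<partial>(\<mu> \<Otimes>\<^sub>M lborel))
      \<le> (\<integral>\<^sup>+p. indicator (space \<mu> \<times> {0..1::real}) p \<partial>(\<mu> \<Otimes>\<^sub>M lborel))"
      by (intro nn_integral_mono) (auto simp: indicator_def)
    also have "\<dots> = emeasure \<mu> UNIV * emeasure lborel {0..1::real}"
      by (subst nn_integral_indicator) (auto simp: lborel.emeasure_pair_measure_Times)
    also have "\<dots> = 1" using emeasure_space_1 by simp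
    finally show "(\<integral>\<^sup>+p. ennreal (norm ((\<lambda>(x, s). indicator {0..1} s * indicator {s. s < f x} s :: real) p)) \<partial>(\<mu> \<Otimes>\<^sub>M lborel)) < \<infinity>"
      by (auto simp: le_less_trans)
  qed (simp add: indicator_def[abs_def] split_def)
  have eq1: "(LINT s|lborel. indicator {0..1} s * indicator {s. s < f x} s :: real) = f x" for x
  proof -
    have "(LINT s|lborel. indicator {0..1} s * indicator {s. s < f x} s :: real) = (LINT s|lborel. indicator {0..<f x} s)"
      using test_funD(2,3)[OF assms(2), of x]
      by (intro Bochner_Integration.integral_cong) (auto split: split_indicator)
    then show ?thesis using test_funD(2)[OF assms(2), of x] by simp
  qed
  have eq2: "(LINT x|\<mu>. indicator {0..1} s * indicator {s. s < f x} s :: real) = indicator {0..1} s * measure \<mu> {x. s < f x}" for s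
  proof -
    have "(LINT x|\<mu>. indicator {s. s < f x} s :: real) = (LINT x|\<mu>. indicator {x. s < f x} x)"
      by (intro Bochner_Integration.integral_cong) (auto split: split_indicator)
    then show ?thesis by simp
  qed
  show "integral\<^sup>L \<mu> f = (LINT s|lborel. indicator {0..1} s * measure \<mu> {x. s < f x})"
    using Fubini_integral[OF int] unfolding eq1 eq2 by (rule sym)
  show "integrable lborel (\<lambda>s. indicator {0..1} s * measure \<mu> {x. s < f x})"
    using integrable_snd[OF int] unfolding eq2 .
qed

text \<open>The levels of a function with values in [0, 1] fill an interval of length 1, so no
  factor 2 appears.\<close>

lemma tv_dist_test_fun:
  assumes \<mu>: "real_distribution \<mu>" and \<nu>: "real_distribution \<nu>" and f: "test_fun f"
  shows "\<bar>integral\<^sup>L \<mu> f - integral\<^sup>L \<nu> f\<bar> \<le> tv_dist \<mu> \<nu>"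
proof -
  let ?F = "\<lambda>\<mu> s. indicator {0..1} s * measure \<mu> {x. s < f x} :: real"
  have [measurable]: "f \<in> borel_measurable borel" by (rule test_funD[OF f])
  note I = integral_layer_cake(2)[OF \<mu> f] integral_layer_cake(2)[OF \<nu> f]
  have "\<bar>integral\<^sup>L \<mu> f - integral\<^sup>L \<nu> f\<bar> = \<bar>LINT s|lborel. ?F \<mu> s - ?F \<nu> s\<bar>"
    using integral_layer_cake(1)[OF \<mu> f] integral_layer_cake(1)[OF \<nu> f] I by simp
  also have "\<dots> \<le> (LINT s|lborel. \<bar>?F \<mu> s - ?F \<nu> s\<bar>)" by (rule integral_abs_bound)
  also have "\<dots> \<le> (LINT s|lborel. indicator {0..1::real} s * tv_dist \<mu> \<nu>)"
  proof (rule Bochner_Integration.integral_mono)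
    fix s :: real
    have "\<bar>measure \<mu> {x. s < f x} - measure \<nu> {x. s < f x}\<bar> \<le> tv_dist \<mu> \<nu>"
      by (rule tv_dist_ge[OF \<mu> \<nu>]) measurable
    then show "\<bar>?F \<mu> s - ?F \<nu> s\<bar> \<le> indicator {0..1} s * tv_dist \<mu> \<nu>"
      by (auto split: split_indicator)
  qed (use I in auto)
  also have "\<dots> = tv_dist \<mu> \<nu>" by simp
  finally show ?thesis .
qed

subsection \<open>Rare jumps\<close>

text \<open>One step of a random walk that makes a jump drawn from the sub-probability measure
  \<open>\<kappa>\<close>, and with the remaining probability moves to \<open>a\<close>.\<close>

definition jump_step :: "real measure \<Rightarrow> real \<Rightarrow> real measure" where
  "jump_step \<kappa> a = count_space UNIV \<bind>
     (\<lambda>b. if b then \<kappa> else density (return borel a) (\<lambda>_. ennreal (1 - measure \<kappa> UNIV)))"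

locale jump_kernel = finite_measure \<kappa> for \<kappa> :: "real measure" +
  assumes sets_\<kappa> [simp, measurable_cong]: "sets \<kappa> = sets borel"
    and mass_le_1: "measure \<kappa> UNIV \<le> 1"
begin

lemma space_\<kappa> [simp]: "space \<kappa> = UNIV"
  using sets_eq_imp_space_eq[OF sets_\<kappa>] by simp

text \<open>Binding over the counting measure on the two booleans adds two sub-probability measures;
  the weights are such that the sum has mass 1.\<close>

definition kern :: "real \<Rightarrow> bool \<Rightarrow> real measure" where
  "kern a b = (if b then \<kappa> else density (return borel a) (\<lambda>_. ennreal (1 - measure \<kappa> UNIV)))"

lemma jump_step_kern: "jump_step \<kappa> a = count_space UNIV \<bind> kern a"
  by (simp add: jump_step_def kern_def[abs_def])

lemma emeasure_kern_le: "emeasure (kern a b) (space (kern a b)) \<le> 1"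
  using mass_le_1 by (auto simp: kern_def emeasure_density emeasure_eq_measure)

lemma kern_measurable: "kern a \<in> count_space UNIV \<rightarrow>\<^sub>M subprob_algebra borel"
proof -
  have "subprob_space (kern a b)" "sets (kern a b) = sets borel" for b
    by (rule subprob_spaceI, rule emeasure_kern_le) (auto simp: kern_def)
  then show ?thesis by (auto simp: space_subprob_algebra)
qed

lemma real_distribution_jump_step: "real_distribution (jump_step \<kappa> a)"
proof -
  have s: "sets (jump_step \<kappa> a) = sets borel"
    unfolding jump_step_kern by (rule sets_bind[where N=borel]) (auto simp: kern_def)
  have "emeasure (jump_step \<kappa> a) UNIV = (\<integral>\<^sup>+b. emeasure (kern a b) UNIV \<partial>count_space UNIV)"
    unfolding jump_step_kern by (rule emeasure_bind[OF _ kern_measurable]) auto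
  also have "\<dots> = 1"
    using mass_le_1 by (simp add: nn_integral_count_space_finite UNIV_bool kern_def emeasure_density
        emeasure_eq_measure flip: ennreal_plus)
  finally show ?thesis
    using s sets_eq_imp_space_eq[OF s]
    by (auto simp: real_distribution_def real_distribution_axioms_def intro!: prob_spaceI)
qed

lemma integral_jump_step_real:
  fixes f :: "real \<Rightarrow> real"
  assumes [measurable]: "f \<in> borel_measurable borel" and "\<And>x. \<bar>f x\<bar> \<le> B"
  shows "integral\<^sup>L (jump_step \<kappa> a) f = (1 - measure \<kappa> UNIV) * f a + integral\<^sup>L \<kappa> f"
proof -
  have "integral\<^sup>L (jump_step \<kappa> a) f = (LINT b|count_space UNIV. integral\<^sup>L (kern a b) f)"
    unfolding jump_step_kern
    by (rule integral_bind[OF _ _ kern_measurable, where B=B and B'=1])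
       (use assms emeasure_kern_le in \<open>auto intro: finite_measure_count_space\<close>)
  also have "\<dots> = (1 - measure \<kappa> UNIV) * f a + integral\<^sup>L \<kappa> f"
    using mass_le_1
    by (simp add: lebesgue_integral_count_space_finite UNIV_bool kern_def integral_density integral_return)
  finally show ?thesis .
qed

lemma integral_jump_step_complex:
  fixes f :: "real \<Rightarrow> complex"
  assumes [measurable]: "f \<in> borel_measurable borel" and B: "\<And>x. norm (f x) \<le> B"
  shows "integral\<^sup>L (jump_step \<kappa> a) f = (1 - measure \<kappa> UNIV) * f a + integral\<^sup>L \<kappa> f"
proof -
  interpret J: real_distribution "jump_step \<kappa> a" by (rule real_distribution_jump_step)
  have i: "integrable (jump_step \<kappa> a) f" "integrable \<kappa> f"
    using B by (auto intro!: J.integrable_const_bound[where B=B] integrable_const_bound[where B=B])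
  have "\<bar>Re (f x)\<bar> \<le> B" "\<bar>Im (f x)\<bar> \<le> B" for x
    using abs_Re_le_cmod[of "f x"] abs_Im_le_cmod[of "f x"] B[of x] by linarith+
  then have "(LINT x|jump_step \<kappa> a. Re (f x)) = (1 - measure \<kappa> UNIV) * Re (f a) + (LINT x|\<kappa>. Re (f x))"
    "(LINT x|jump_step \<kappa> a. Im (f x)) = (1 - measure \<kappa> UNIV) * Im (f a) + (LINT x|\<kappa>. Im (f x))"
    by (intro integral_jump_step_real[where B=B]; simp)+
  with i show ?thesis by (simp add: complex_eq_iff)
qed

lemma avg_jump_step:
  assumes "test_fun f"
  shows "avg (jump_step \<kappa> a) f x = (1 - measure \<kappa> UNIV) * f (x + a) + (LINT y|\<kappa>. f (x + y))"
proof -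
  have [measurable]: "f \<in> borel_measurable borel" by (rule test_funD[OF assms])
  show ?thesis unfolding avg_def
    by (rule integral_jump_step_real[where B=1]) (auto simp: test_funD[OF assms])
qed

text \<open>Stated for the difference to 1, because n times this difference is what converges to the
  exponent in \<open>power_tendsto_exp\<close>.\<close>

lemma char_jump_step:
  "char (jump_step \<kappa> a) u - 1 =
     (1 - measure \<kappa> UNIV) * (iexp (u * a) - 1) + (CLINT x|\<kappa>. iexp (u * x) - 1)"
proof -
  have "integrable \<kappa> (\<lambda>x. iexp (u * x))"
    by (auto intro!: integrable_const_bound[where B=1])
  then have "(CLINT x|\<kappa>. iexp (u * x) - 1) = (CLINT x|\<kappa>. iexp (u * x)) - measure \<kappa> UNIV"
    by (simp add: scaleR_conv_of_real)
  moreover have "char (jump_step \<kappa> a) u = (1 - measure \<kappa> UNIV) * iexp (u * a) + (CLINT x|\<kappa>. iexp (u * x))"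
    unfolding char_def by (rule integral_jump_step_complex[where B=1]) auto
  ultimately show ?thesis by (simp add: algebra_simps)
qed

end

subsection \<open>Levy measures\<close>

text \<open>With c = t / n this is the jump kernel of one step of the walk, with c = 1 /
  \<lambda>(\<epsilon>) the normalised law of the large jumps.\<close>

definition scaled_restr :: "real \<Rightarrow> real set \<Rightarrow> real measure \<Rightarrow> real measure" where
  "scaled_restr c B \<nu> = density \<nu> (\<lambda>x. ennreal (c * indicator B x))"

lemma sets_scaled_restr [simp, measurable_cong]: "sets (scaled_restr c B \<nu>) = sets \<nu>"
  by (simp add: scaled_restr_def)

lemma integral_scaled_restr:
  fixes f :: "real \<Rightarrow> 'b::{banach, second_countable_topology}"
  assumes [measurable_cong]: "sets \<nu> = sets borel" and [measurable]: "B \<in> sets borel" "f \<in> borel_measurable borel"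
    and "c \<ge> 0"
  shows "integral\<^sup>L (scaled_restr c B \<nu>) f = c *\<^sub>R (LINT x:B|\<nu>. f x)"
  unfolding scaled_restr_def set_lebesgue_integral_def using assms
  by (subst integral_density) (auto simp flip: scaleR_scaleR)

lemma emeasure_scaled_restr:
  assumes s: "sets \<nu> = sets borel" and [measurable]: "B \<in> sets borel" and c: "c \<ge> 0"
  shows "emeasure (scaled_restr c B \<nu>) UNIV = ennreal c * emeasure \<nu> B"
proof -
  have [measurable_cong]: "sets \<nu> = sets borel" by (rule s)
  have "emeasure (scaled_restr c B \<nu>) UNIV = (\<integral>\<^sup>+x. ennreal (c * indicator B x) \<partial>\<nu>)"
    unfolding scaled_restr_def using sets_eq_imp_space_eq[OF s]
    by (subst emeasure_density) auto
  also have "\<dots> = (\<integral>\<^sup>+x. ennreal c * indicator B x \<partial>\<nu>)"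
    using c by (intro nn_integral_cong) (auto split: split_indicator)
  also have "\<dots> = ennreal c * emeasure \<nu> B"
    using s by (subst nn_integral_cmult_indicator) auto
  finally show ?thesis .
qed

lemma jump_kernel_scaled_restr:
  assumes s: "sets \<nu> = sets borel" and B: "B \<in> sets borel" and c: "c \<ge> 0"
    and fin: "emeasure \<nu> B < \<infinity>" and le: "c * measure \<nu> B \<le> 1"
  shows "jump_kernel (scaled_restr c B \<nu>)" "measure (scaled_restr c B \<nu>) UNIV = c * measure \<nu> B"
proof -
  note e = emeasure_scaled_restr[OF s B c]
  show m: "measure (scaled_restr c B \<nu>) UNIV = c * measure \<nu> B"
    unfolding measure_def e using c by (simp add: enn2real_mult)
  have "space (scaled_restr c B \<nu>) = UNIV"
    using sets_eq_imp_space_eq[OF s] by (simp add: scaled_restr_def)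
  then have "finite_measure (scaled_restr c B \<nu>)"
    using e fin by (intro finite_measureI) (auto simp: ennreal_mult_eq_top_iff less_top[symmetric])
  then show "jump_kernel (scaled_restr c B \<nu>)"
    using m le s by (simp add: jump_kernel_def jump_kernel_axioms_def)
qed

locale levy =
  fixes \<nu> :: "real measure"
  assumes levy: "levy_measure \<nu>"
begin

lemma sets_\<nu> [simp, measurable_cong]: "sets \<nu> = sets borel"
  using levy by (simp add: levy_measure_def)

lemma space_\<nu> [simp]: "space \<nu> = UNIV"
  using sets_eq_imp_space_eq[OF sets_\<nu>] by simp

lemma integrable_min: "integrable \<nu> (\<lambda>x. min 1 (x\<^sup>2))"
  using levy by (intro integrableI_nonneg) (auto simp: levy_measure_def)

lemma integrable_le_min:
  fixes f :: "real \<Rightarrow> 'b::{banach, second_countable_topology}"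
  assumes [measurable]: "f \<in> borel_measurable borel" and "\<And>x. norm (f x) \<le> c * min 1 (x\<^sup>2)"
  shows "integrable \<nu> f"
proof (rule Bochner_Integration.integrable_bound)
  show "integrable \<nu> (\<lambda>x. c * min 1 (x\<^sup>2))" using integrable_min by simp
  show "AE x in \<nu>. norm (f x) \<le> norm (c * min 1 (x\<^sup>2))"
    using assms(2) by (auto intro!: order_trans[OF _ abs_ge_self])
qed simp

text \<open>Outside the \<delta>-neighbourhood of 0 the function min(1, x^2) is at least \<delta>^2,
  so it dominates a multiple of every bounded function.\<close>

lemma integrable_indicator_away:
  fixes f :: "real \<Rightarrow> 'b::{banach, second_countable_topology}"
  assumes [measurable]: "B \<in> sets borel" "f \<in> borel_measurable borel"
    and \<delta>: "0 < \<delta>" "\<delta> \<le> 1" and B: "\<And>x. x \<in> B \<Longrightarrow> \<delta> < \<bar>x\<bar>" and f: "\<And>x. x \<in> B \<Longrightarrow> norm (f x) \<le> K"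
  shows "set_integrable \<nu> B f"
  unfolding set_integrable_def
proof (rule integrable_le_min)
  fix x
  show "norm (indicat_real B x *\<^sub>R f x) \<le> (\<bar>K\<bar> / \<delta>\<^sup>2) * min 1 (x\<^sup>2)"
  proof (cases "x \<in> B")
    case True
    have "\<delta>\<^sup>2 \<le> x\<^sup>2" using B[OF True] \<delta> by (simp add: abs_le_square_iff[symmetric])
    moreover have "\<delta>\<^sup>2 \<le> 1" using \<delta> by (simp add: power_le_one)
    ultimately have "1 \<le> min 1 (x\<^sup>2) / \<delta>\<^sup>2" using \<delta> by (simp add: field_simps)
    then have "\<bar>K\<bar> * 1 \<le> \<bar>K\<bar> * (min 1 (x\<^sup>2) / \<delta>\<^sup>2)" by (intro mult_left_mono) auto
    then show ?thesis using f[OF True] True by simp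
  qed simp
qed simp

lemma finite_away:
  assumes [measurable]: "B \<in> sets borel" and \<delta>: "0 < \<delta>" "\<delta> \<le> 1" "\<And>x. x \<in> B \<Longrightarrow> \<delta> < \<bar>x\<bar>"
  shows "emeasure \<nu> B < \<infinity>"
  using integrable_indicator_away[OF assms(1) _ \<delta>, of "\<lambda>_. 1::real" 1]
  by (simp add: set_integrable_def integrable_indicator_iff)

text \<open>The counterpart near 0, where \<nu> may be infinite: second-order Taylor remainders are
  integrable, first-order ones need not be.\<close>

lemma integrable_sq:
  fixes f :: "real \<Rightarrow> 'b::{banach, second_countable_topology}"
  assumes [measurable]: "B \<in> sets borel" "f \<in> borel_measurable borel"
    and B: "\<And>x. x \<in> B \<Longrightarrow> \<bar>x\<bar> \<le> 1" and f: "\<And>x. x \<in> B \<Longrightarrow> norm (f x) \<le> K * x\<^sup>2"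
  shows "set_integrable \<nu> B f"
  unfolding set_integrable_def
proof (rule integrable_le_min)
  fix x :: real
  have "\<bar>x\<bar>\<le>1 \<Longrightarrow> x\<^sup>2 \<le> 1" by (simp add: abs_square_le_1)
  then have "x \<in> B \<Longrightarrow> norm (f x) \<le> K * min 1 (x\<^sup>2)" using B f by (simp add: min_absorb2)
  moreover have "K * x\<^sup>2 \<le> \<bar>K\<bar> * x\<^sup>2" "K * 1 \<le> \<bar>K\<bar> * 1" by (intro mult_right_mono; simp)+
  ultimately show "norm (indicat_real B x *\<^sub>R f x) \<le> \<bar>K\<bar> * min 1 (x\<^sup>2)"
    by (cases "x \<in> B") (auto simp: min_def split: if_splits)
qed simp

end

subsection \<open>Large jumps\<close>

context levy
begin

context
  fixes \<epsilon> :: real assumes \<epsilon>: "0 < \<epsilon>" "\<epsilon> \<le> 1"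
begin

lemma finite_big: "emeasure \<nu> {x. \<epsilon> < \<bar>x\<bar>} < \<infinity>"
  using \<epsilon> by (intro finite_away[of _ \<epsilon>]) auto

lemma jump_intensity_eq: "jump_intensity \<nu> \<epsilon> = measure \<nu> {x. \<epsilon> < \<bar>x\<bar>}"
  unfolding jump_intensity_def measure_def by (simp add: emeasure_big_jumps)

lemma jump_intensity_nonneg: "0 \<le> jump_intensity \<nu> \<epsilon>"
  by (simp add: jump_intensity_eq)

lemma jump_law_density:
  "jump_law \<nu> \<epsilon> = scaled_restr (1 / jump_intensity \<nu> \<epsilon>) {x. \<epsilon> < \<bar>x\<bar>} \<nu>"
proof (rule measure_eqI)
  show "sets (jump_law \<nu> \<epsilon>) = sets (scaled_restr (1 / jump_intensity \<nu> \<epsilon>) {x. \<epsilon> < \<bar>x\<bar>} \<nu>)"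
    by (simp add: jump_law_def big_jumps_def)
  fix A assume "A \<in> sets (jump_law \<nu> \<epsilon>)"
  then have [measurable]: "A \<in> sets borel" by (simp add: jump_law_def big_jumps_def)
  have "emeasure (scaled_restr (1 / jump_intensity \<nu> \<epsilon>) {x. \<epsilon> < \<bar>x\<bar>} \<nu>) A =
      (\<integral>\<^sup>+x. ennreal (1 / jump_intensity \<nu> \<epsilon>) * indicator (A \<inter> {x. \<epsilon> < \<bar>x\<bar>}) x \<partial>\<nu>)"
    unfolding scaled_restr_def by (subst emeasure_density) (auto intro!: nn_integral_cong split: split_indicator)
  also have "\<dots> = ennreal (1 / jump_intensity \<nu> \<epsilon>) * emeasure \<nu> (A \<inter> {x. \<epsilon> < \<bar>x\<bar>})"
    by (subst nn_integral_cmult_indicator) auto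
  finally show "emeasure (jump_law \<nu> \<epsilon>) A = emeasure (scaled_restr (1 / jump_intensity \<nu> \<epsilon>) {x. \<epsilon> < \<bar>x\<bar>} \<nu>) A"
    by (simp add: jump_law_def emeasure_big_jumps)
qed

lemma real_distribution_jump_law:
  assumes "jump_intensity \<nu> \<epsilon> \<noteq> 0"
  shows "real_distribution (jump_law \<nu> \<epsilon>)"
proof -
  have "0 < jump_intensity \<nu> \<epsilon>" using assms jump_intensity_nonneg by simp
  then have "emeasure (jump_law \<nu> \<epsilon>) UNIV = 1"
    using finite_big unfolding jump_law_density
    by (subst emeasure_scaled_restr)
       (auto simp: jump_intensity_eq emeasure_eq_ennreal_measure less_top simp flip: ennreal_mult)
  moreover have "sets (jump_law \<nu> \<epsilon>) = sets borel" by (simp add: jump_law_density)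
  ultimately show ?thesis using sets_eq_imp_space_eq[of "jump_law \<nu> \<epsilon>" borel]
    by (auto simp: real_distribution_def real_distribution_axioms_def intro!: prob_spaceI)
qed

context
  fixes c :: real
  assumes c: "0 \<le> c" "c * jump_intensity \<nu> \<epsilon> \<le> 1"
begin

lemma jump_kernel_big: "jump_kernel (scaled_restr c {x. \<epsilon> < \<bar>x\<bar>} \<nu>)"
  and mass_big: "measure (scaled_restr c {x. \<epsilon> < \<bar>x\<bar>} \<nu>) UNIV = c * jump_intensity \<nu> \<epsilon>"
  using jump_kernel_scaled_restr[of \<nu> "{x. \<epsilon> < \<bar>x\<bar>}" c] c finite_big
  by (simp_all add: jump_intensity_eq)

text \<open>The step is a mixture: stay put with weight 1 - c L, jump by the normalised law with
  weight c L. If L = 0, \<open>jump_law\<close> is the zero measure and not a probability, hence the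
  separate clause.\<close>

lemma avg_big_jump_step:
  assumes f: "test_fun f"
  defines "Q \<equiv> jump_step (scaled_restr c {x. \<epsilon> < \<bar>x\<bar>} \<nu>) 0" and "L \<equiv> jump_intensity \<nu> \<epsilon>"
  shows "L \<noteq> 0 \<Longrightarrow> avg Q f x = f x + c * L * (avg (jump_law \<nu> \<epsilon>) f x - f x)"
    and "L = 0 \<Longrightarrow> avg Q f x = f x"
proof -
  interpret jump_kernel "scaled_restr c {x. \<epsilon> < \<bar>x\<bar>} \<nu>" by (rule jump_kernel_big)
  have [measurable]: "f \<in> borel_measurable borel" by (rule test_funD[OF f])
  let ?I = "LINT y:{x. \<epsilon> < \<bar>x\<bar>}|\<nu>. f (x + y)"
  have Q: "avg Q f x = (1 - c * L) * f x + c * ?I"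
    unfolding Q_def L_def using avg_jump_step[OF f, of 0 x] c
    by (simp add: mass_big integral_scaled_restr)
  show "avg Q f x = f x + c * L * (avg (jump_law \<nu> \<epsilon>) f x - f x)" if "L \<noteq> 0"
  proof -
    have "avg (jump_law \<nu> \<epsilon>) f x = ?I / L"
      unfolding avg_def jump_law_density using jump_intensity_nonneg
      by (subst integral_scaled_restr) (auto simp: L_def)
    then show ?thesis using Q that by (simp add: field_simps)
  qed
  show "avg Q f x = f x" if "L = 0"
  proof -
    have "emeasure \<nu> {x. \<epsilon> < \<bar>x\<bar>} = 0"
      using that finite_big by (auto simp: L_def jump_intensity_eq measure_def enn2real_eq_0_iff)
    then have "AE y in \<nu>. y \<notin> {x. \<epsilon> < \<bar>x\<bar>}" by (intro AE_not_in) auto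
    then have "AE y in \<nu>. indicator {x. \<epsilon> < \<bar>x\<bar>} y *\<^sub>R f (x + y) = 0"
      by eventually_elim simp
    then have "?I = 0" unfolding set_lebesgue_integral_def by (rule integral_eq_zero_AE)
    with Q that show ?thesis by simp
  qed
qed

end
end
end

definition jump_dist :: "real measure \<Rightarrow> real measure \<Rightarrow> real \<Rightarrow> real" where
  "jump_dist \<nu>1 \<nu>2 \<epsilon> = \<bar>jump_intensity \<nu>1 \<epsilon> - jump_intensity \<nu>2 \<epsilon>\<bar>
    + (if min (jump_intensity \<nu>1 \<epsilon>) (jump_intensity \<nu>2 \<epsilon>) = 0 then 0
       else min (jump_intensity \<nu>1 \<epsilon>) (jump_intensity \<nu>2 \<epsilon>)
         * tv_dist (jump_law \<nu>1 \<epsilon>) (jump_law \<nu>2 \<epsilon>))"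

lemma tv_dist_commute: "tv_dist \<mu> \<nu> = tv_dist \<nu> \<mu>"
  by (simp add: tv_dist_def abs_minus_commute)

lemma jump_dist_commute: "jump_dist \<nu>1 \<nu>2 \<epsilon> = jump_dist \<nu>2 \<nu>1 \<epsilon>"
  by (simp add: jump_dist_def tv_dist_commute[of "jump_law \<nu>1 \<epsilon>"] abs_minus_commute min.commute)

text \<open>Let F1, F2 be the means of f after a jump by the two normalised laws. For intensities a
  <= b the difference is c (b - a) (f - F2) + c a (F1 - F2). The first summand is at most c (b - a)
  because f and F2 lie in [0, 1], the second is bounded by the total variation distance of the jump
  laws.\<close>

lemma avg_big_jump_diff:
  assumes "levy_measure \<nu>1" "levy_measure \<nu>2" and \<epsilon>: "0 < \<epsilon>" "\<epsilon> \<le> 1" and c: "0 \<le> c"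
    "c * jump_intensity \<nu>1 \<epsilon> \<le> 1" "c * jump_intensity \<nu>2 \<epsilon> \<le> 1" and f: "test_fun f"
  shows "\<bar>avg (jump_step (scaled_restr c {x. \<epsilon> < \<bar>x\<bar>} \<nu>1) 0) f x
        - avg (jump_step (scaled_restr c {x. \<epsilon> < \<bar>x\<bar>} \<nu>2) 0) f x\<bar> \<le> c * jump_dist \<nu>1 \<nu>2 \<epsilon>"
  using assms(1,2) c(2,3)
proof (induction "jump_intensity \<nu>1 \<epsilon>" "jump_intensity \<nu>2 \<epsilon>" arbitrary: \<nu>1 \<nu>2 rule: linorder_wlog)
  case (le \<nu>1 \<nu>2)
  interpret n1: levy \<nu>1 using le by unfold_locales
  interpret n2: levy \<nu>2 using le by unfold_locales
  let ?a = "jump_intensity \<nu>1 \<epsilon>" and ?b = "jump_intensity \<nu>2 \<epsilon>"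
  let ?Q = "\<lambda>\<nu>. jump_step (scaled_restr c {x. \<epsilon> < \<bar>x\<bar>} \<nu>) 0"
  let ?F1 = "avg (jump_law \<nu>1 \<epsilon>) f x" and ?F2 = "avg (jump_law \<nu>2 \<epsilon>) f x"
  note 1 = n1.avg_big_jump_step[OF \<epsilon> c(1) le(4) f, of x]
  note 2 = n2.avg_big_jump_step[OF \<epsilon> c(1) le(5) f, of x]
  have a0: "0 \<le> ?a" by (rule n1.jump_intensity_nonneg[OF \<epsilon>])
  have f01: "0 \<le> f x" "f x \<le> 1" by (simp_all add: test_funD[OF f])
  show ?case
  proof (cases "?b = 0")
    case True
    then have "?a = 0" using a0 le(1) by simp
    with True 1 2 show ?thesis by (simp add: jump_dist_def)
  next
    case b: False
    have J2: "real_distribution (jump_law \<nu>2 \<epsilon>)" by (rule n2.real_distribution_jump_law[OF \<epsilon> b])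
    have F2: "0 \<le> ?F2" "?F2 \<le> 1" using avg_test_fun[OF f J2] by (simp_all add: test_funD)
    have d: "\<bar>c * (?b - ?a) * (f x - ?F2)\<bar> \<le> c * (?b - ?a)"
      using f01 F2 c(1) le(1) by (subst abs_mult) (auto intro!: mult_left_le)
    show ?thesis
    proof (cases "?a = 0")
      case True
      have "avg (?Q \<nu>1) f x - avg (?Q \<nu>2) f x = c * (?b - ?a) * (f x - ?F2)"
        using 1(2)[OF True] 2(1)[OF b] True by (simp add: algebra_simps)
      with d True a0 le(1) show ?thesis by (simp add: jump_dist_def)
    next
      case a: False
      have J1: "real_distribution (jump_law \<nu>1 \<epsilon>)" by (rule n1.real_distribution_jump_law[OF \<epsilon> a])
      have [measurable]: "f \<in> borel_measurable borel" by (rule test_funD[OF f])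
      have "test_fun (\<lambda>y. f (x + y))"
        by (auto simp: test_fun_def test_funD[OF f])
      then have F: "\<bar>?F1 - ?F2\<bar> \<le> tv_dist (jump_law \<nu>1 \<epsilon>) (jump_law \<nu>2 \<epsilon>)"
        unfolding avg_def by (rule tv_dist_test_fun[OF J1 J2])
      have "avg (?Q \<nu>1) f x - avg (?Q \<nu>2) f x = c * (?b - ?a) * (f x - ?F2) + c * ?a * (?F1 - ?F2)"
        using 1(1)[OF a] 2(1)[OF b] by (simp add: algebra_simps)
      moreover have "\<bar>c * ?a * (?F1 - ?F2)\<bar> \<le> c * ?a * tv_dist (jump_law \<nu>1 \<epsilon>) (jump_law \<nu>2 \<epsilon>)"
        using c(1) a0 F by (subst abs_mult) (auto intro!: mult_left_mono)
      ultimately have "\<bar>avg (?Q \<nu>1) f x - avg (?Q \<nu>2) f x\<bar>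
          \<le> c * (?b - ?a) + c * ?a * tv_dist (jump_law \<nu>1 \<epsilon>) (jump_law \<nu>2 \<epsilon>)"
        using d by linarith
      then show ?thesis using a le(1) by (simp add: jump_dist_def min_absorb1 algebra_simps)
    qed
  qed
next
  case (sym \<nu>1 \<nu>2)
  then show ?case using jump_dist_commute abs_minus_commute by metis
qed

subsection \<open>Gaussian smoothing\<close>

text \<open>As an image of the standard normal law it makes sense for s = 0 as well, a case that
  arises as s = sqrt \<tau> when the small jumps have variance 0.\<close>

definition gauss :: "real \<Rightarrow> real \<Rightarrow> real measure" where
  "gauss m s = distr std_normal_distribution borel (\<lambda>z. m + s * z)"

lemma real_distribution_gauss: "real_distribution (gauss m s)"
proof -
  interpret real_distribution std_normal_distribution by (rule real_dist_normal_dist)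
  show ?thesis unfolding gauss_def by (rule real_distribution_distr) simp
qed

lemma integral_gauss:
  fixes f :: "real \<Rightarrow> 'b::{banach, second_countable_topology}"
  assumes [measurable]: "f \<in> borel_measurable borel"
  shows "integral\<^sup>L (gauss m s) f = (LINT z|lborel. std_normal_density z *\<^sub>R f (m + s * z))"
  unfolding gauss_def by (subst integral_distr) (auto simp: integral_density)

lemma avg_gauss:
  assumes "test_fun f"
  shows "avg (gauss m s) f x = (LINT z|lborel. std_normal_density z * f (x + m + s * z))"
proof -
  have [measurable]: "f \<in> borel_measurable borel" by (rule test_funD[OF assms])
  show ?thesis unfolding avg_def by (subst integral_gauss) (auto simp: add.assoc)
qed

lemma char_gauss: "char (gauss m s) u = exp (\<i> * of_real (u * m) - of_real (u\<^sup>2 * s\<^sup>2 / 2))"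
proof -
  have "char (gauss m s) u = (CLINT z|std_normal_distribution. iexp (u * m) * iexp ((u * s) * z))"
    unfolding char_def gauss_def by (subst integral_distr) (auto simp: algebra_simps exp_add)
  also have "\<dots> = iexp (u * m) * char std_normal_distribution (u * s)"
    unfolding char_def by simp
  also have "\<dots> = exp (\<i> * of_real (u * m)) * exp (- of_real (u\<^sup>2 * s\<^sup>2 / 2))"
  proof -
    have "- ((u * s)\<^sup>2) / 2 = - (u\<^sup>2 * s\<^sup>2 / 2)" by (simp add: power_mult_distrib)
    then show ?thesis by (simp only: char_std_normal_distribution of_real_minus[symmetric] exp_of_real)
  qed
  finally show ?thesis by (simp only: exp_add[symmetric] diff_conv_add_uminus)
qed

lemma gauss_convolution: "gauss m a \<star> gauss m' b = gauss (m + m') (sqrt (a\<^sup>2 + b\<^sup>2))"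
proof (rule Levy_uniqueness)
  show "char (gauss m a \<star> gauss m' b) = char (gauss (m + m') (sqrt (a\<^sup>2 + b\<^sup>2)))"
  proof
    fix u
    have "\<i> * of_real (u * m) - of_real (u\<^sup>2 * a\<^sup>2 / 2) + (\<i> * of_real (u * m') - of_real (u\<^sup>2 * b\<^sup>2 / 2))
        = \<i> * of_real (u * (m + m')) - complex_of_real (u\<^sup>2 * (sqrt (a\<^sup>2 + b\<^sup>2))\<^sup>2 / 2)"
      by (simp add: complex_eq_iff add_divide_distrib distrib_left)
    then show "char (gauss m a \<star> gauss m' b) u = char (gauss (m + m') (sqrt (a\<^sup>2 + b\<^sup>2))) u"
      unfolding char_convolution[OF real_distribution_gauss real_distribution_gauss] char_gauss exp_add[symmetric]
      by (rule arg_cong)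
  qed
  show "real_distribution (gauss m a \<star> gauss m' b)"
    by (rule real_distribution_convolution[OF real_distribution_gauss real_distribution_gauss])
qed (rule real_distribution_gauss)

lemma avg_gauss_gauss:
  assumes "test_fun f"
  shows "avg (gauss m a) (avg (gauss m' b) f) = avg (gauss (m + m') (sqrt (a\<^sup>2 + b\<^sup>2))) f"
  by (subst avg_convolution[symmetric, OF real_distribution_gauss real_distribution_gauss assms]) (simp only: gauss_convolution)

text \<open>Taylor's formula with integral remainder, integrated over y. By Tonelli and translation
  invariance the L1 norm of \<open>d n\<close> factors out. Applied to the normal density, it puts
  the derivatives on the density, so that the test function needs none.\<close>

lemma L1_taylor:
  fixes d :: "nat \<Rightarrow> real \<Rightarrow> real"
  assumes n: "n > 0" and C: "0 \<le> C"
    and deriv: "\<And>k x. k < n \<Longrightarrow> (d k has_real_derivative d (Suc k) x) (at x)"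
    and cont: "continuous_on UNIV (d n)"
    and bound: "(\<integral>\<^sup>+y. ennreal \<bar>d n y\<bar> \<partial>lborel) \<le> ennreal C"
  shows "(\<integral>\<^sup>+y. ennreal \<bar>d 0 (y + v) - (\<Sum>k<n. v ^ k / fact k * d k y)\<bar> \<partial>lborel)
    \<le> ennreal (C * \<bar>v\<bar> ^ n / fact n)"
proof -
  \<comment> \<open>The absolute weight of the remainder; its integral over [0, 1] is |v|^n /
    n!.\<close>
  define K where "K w = (1 - w) ^ (n - 1) / fact (n - 1) * \<bar>v\<bar> ^ n" for w :: real
  have [measurable]: "d n \<in> borel_measurable borel"
    using cont by (rule borel_measurable_continuous_onI)
  have [measurable]: "K \<in> borel_measurable borel" unfolding K_def by measurable
  have pt: "ennreal \<bar>d 0 (y + v) - (\<Sum>k<n. v ^ k / fact k * d k y)\<bar>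
      \<le> (\<integral>\<^sup>+w. ennreal (indicator {0..1} w * K w * \<bar>d n (y + w * v)\<bar>) \<partial>lborel)" for y
  proof -
    define i where "i w = ((1 - w) ^ (n - 1) / fact (n - 1)) *\<^sub>R (v ^ n * d n (y + w * v))" for w
    have D: "((\<lambda>w. v ^ k * d k (y + w * v)) has_vector_derivative v ^ Suc k * d (Suc k) (y + t * v)) (at t within {0..1})"
      if "k < n" for k t
    proof -
      have "((\<lambda>w. d k (y + w * v)) has_real_derivative d (Suc k) (y + t * v) * v) (at t)"
        by (rule DERIV_chain2[OF deriv[OF that]]) (auto intro!: derivative_eq_intros)
      from has_field_derivative_at_within[OF DERIV_cmult[OF this, of "v ^ k"]]
      show ?thesis by (simp add: has_real_derivative_iff_has_vector_derivative mult_ac)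
    qed
    have "(i has_integral (d 0 (y + v) - (\<Sum>k<n. ((1 - 0) ^ k / fact k) *\<^sub>R (v ^ k * d k (y + 0 * v))))) {0..1}"
      unfolding i_def
      using Taylor_has_integral[where Df="\<lambda>k w. v ^ k * d k (y + w * v)" and f="\<lambda>w. v ^ 0 * d 0 (y + w * v)"
          and a=0 and b=1, OF n refl D] by simp
    then have hi: "(i has_integral (d 0 (y + v) - (\<Sum>k<n. v ^ k / fact k * d k y))) {0..1}"
      by simp
    have ci: "continuous_on {0..1} i"
      unfolding i_def by (intro continuous_intros continuous_on_compose2[OF cont]) auto
    have "integrable lborel (\<lambda>w. indicator {0..1} w *\<^sub>R i w)"
      by (rule borel_integrable_compact[OF _ ci]) simp
    then have si: "set_integrable lborel {0..1} i" by (simp add: set_integrable_def)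
    have "d 0 (y + v) - (\<Sum>k<n. v ^ k / fact k * d k y) = (LINT w:{0..1}|lborel. i w)"
      using set_borel_integral_eq_integral(2)[OF si] integral_unique[OF hi] by simp
    then have "ennreal \<bar>d 0 (y + v) - (\<Sum>k<n. v ^ k / fact k * d k y)\<bar>
        \<le> (\<integral>\<^sup>+w. ennreal (norm (indicator {0..1} w *\<^sub>R i w)) \<partial>lborel)"
      using integral_norm_bound_ennreal[OF si[unfolded set_integrable_def]]
      by (simp add: set_lebesgue_integral_def)
    also have "\<dots> = (\<integral>\<^sup>+w. ennreal (indicator {0..1} w * K w * \<bar>d n (y + w * v)\<bar>) \<partial>lborel)"
      by (intro nn_integral_cong)
         (auto simp: i_def K_def abs_mult power_abs split: split_indicator)
    finally show ?thesis .
  qed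
  have "(\<integral>\<^sup>+y. ennreal \<bar>d 0 (y + v) - (\<Sum>k<n. v ^ k / fact k * d k y)\<bar> \<partial>lborel)
      \<le> (\<integral>\<^sup>+y. \<integral>\<^sup>+w. ennreal (indicator {0..1} w * K w * \<bar>d n (y + w * v)\<bar>) \<partial>lborel \<partial>lborel)"
    by (intro nn_integral_mono pt)
  also have "\<dots> = (\<integral>\<^sup>+w. \<integral>\<^sup>+y. ennreal (indicator {0..1} w * K w * \<bar>d n (y + w * v)\<bar>) \<partial>lborel \<partial>lborel)"
    by (rule lborel_pair.Fubini') measurable
  also have "\<dots> \<le> (\<integral>\<^sup>+w. ennreal (indicator {0..1} w * K w) * ennreal C \<partial>lborel)"
  proof (rule nn_integral_mono)
    fix w :: real
    have K0: "0 \<le> indicator {0..1} w * K w" by (auto simp: K_def split: split_indicator)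
    have "(\<integral>\<^sup>+y. ennreal \<bar>d n (y + w * v)\<bar> \<partial>lborel) = (\<integral>\<^sup>+y. ennreal \<bar>d n y\<bar> \<partial>lborel)"
      using nn_integral_real_affine[of "\<lambda>y. ennreal \<bar>d n y\<bar>" 1 "w * v"] by (simp add: add.commute)
    then have "(\<integral>\<^sup>+y. ennreal (indicator {0..1} w * K w * \<bar>d n (y + w * v)\<bar>) \<partial>lborel)
        = ennreal (indicator {0..1} w * K w) * (\<integral>\<^sup>+y. ennreal \<bar>d n y\<bar> \<partial>lborel)"
      using K0 by (simp add: ennreal_mult nn_integral_cmult)
    then show "(\<integral>\<^sup>+y. ennreal (indicator {0..1} w * K w * \<bar>d n (y + w * v)\<bar>) \<partial>lborel)
        \<le> ennreal (indicator {0..1} w * K w) * ennreal C"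
      using bound by (simp add: mult_left_mono)
  qed
  also have "\<dots> = (\<integral>\<^sup>+w. ennreal (K w) * indicator {0..1} w \<partial>lborel) * ennreal C"
    by (subst nn_integral_multc) (auto intro!: nn_integral_cong arg_cong2[where f="(*)"] split: split_indicator)
  also have "(\<integral>\<^sup>+w. ennreal (K w) * indicator {0..1} w \<partial>lborel) = ennreal (\<bar>v\<bar> ^ n / fact n)"
  proof -
    obtain k where k: "n = Suc k" using n by (cases n) auto
    have "(\<integral>\<^sup>+w. ennreal (K w) * indicator {0..1} w \<partial>lborel)
        = ennreal ((- (\<bar>v\<bar> ^ n) / fact n) * (1 - 1) ^ n - (- (\<bar>v\<bar> ^ n) / fact n) * (1 - 0) ^ n)"
    proof (rule nn_integral_FTC_Icc[where F="\<lambda>w. (- (\<bar>v\<bar> ^ n) / fact n) * (1 - w) ^ n"])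
      fix w :: real assume w: "w \<in> {0..1}"
      have "((\<lambda>w. (1 - w) ^ n) has_real_derivative - (real n * (1 - w) ^ (n - 1))) (at w)"
        by (auto intro!: derivative_eq_intros)
      from DERIV_cmult[OF this, of "- (\<bar>v\<bar> ^ n) / fact n"]
      show "((\<lambda>w. (- (\<bar>v\<bar> ^ n) / fact n) * (1 - w) ^ n) has_real_derivative K w) (at w)"
        by (rule DERIV_cong) (simp add: K_def k fact_Suc del: of_nat_Suc power_Suc)
      show "0 \<le> K w" using w by (auto simp: K_def)
    qed auto
    then show ?thesis using n by (simp add: zero_power)
  qed
  also have "ennreal (\<bar>v\<bar> ^ n / fact n) * ennreal C = ennreal (C * \<bar>v\<bar> ^ n / fact n)"
    using C by (simp add: ennreal_mult'[symmetric] mult.commute)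
  finally show ?thesis .
qed

text \<open>The k-th derivative of the standard normal density for k <= 3: the list holds (-1)^k
  times the Hermite polynomials.\<close>

definition nderiv :: "nat \<Rightarrow> real \<Rightarrow> real" where
  "nderiv k z = [1, - z, z\<^sup>2 - 1, 3 * z - z ^ 3] ! k * std_normal_density z"

lemma nderiv_simps [simp]:
  "nderiv 0 z = std_normal_density z"
  "nderiv (Suc 0) z = - z * std_normal_density z"
  "nderiv 2 z = (z\<^sup>2 - 1) * std_normal_density z"
  "nderiv (Suc (Suc 0)) z = (z\<^sup>2 - 1) * std_normal_density z"
  "nderiv 3 z = (3 * z - z ^ 3) * std_normal_density z"
  "nderiv (Suc (Suc (Suc 0))) z = (3 * z - z ^ 3) * std_normal_density z"
  by (simp_all add: nderiv_def numeral_2_eq_2 numeral_3_eq_3)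

lemma deriv_std_normal_density:
  "(std_normal_density has_real_derivative - z * std_normal_density z) (at z)"
proof -
  have "((\<lambda>z. c * exp (- z\<^sup>2 / 2)) has_real_derivative - z * (c * exp (- z\<^sup>2 / 2))) (at z)" for c
    by (auto intro!: derivative_eq_intros)
  then show ?thesis unfolding std_normal_density_def[abs_def] .
qed

lemma nderiv_deriv: "k < 3 \<Longrightarrow> (nderiv k has_real_derivative nderiv (Suc k) z) (at z)"
proof -
  assume "k < 3"
  then consider "k = 0" | "k = Suc 0" | "k = Suc (Suc 0)" by linarith
  then show ?thesis
  proof cases
    case 1 then show ?thesis using deriv_std_normal_density by (simp add: nderiv_def[abs_def])
  next
    case 2 then show ?thesis
      by (simp add: nderiv_simps[abs_def])
         (auto intro!: derivative_eq_intros deriv_std_normal_density simp: power2_eq_square algebra_simps)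
  next
    case 3 then show ?thesis
      by (simp add: nderiv_simps[abs_def])
         (auto intro!: derivative_eq_intros deriv_std_normal_density simp: power2_eq_square power3_eq_cube algebra_simps)
  qed
qed

lemma nderiv_cont: "k \<le> 3 \<Longrightarrow> continuous_on UNIV (nderiv k)"
proof -
  assume "k \<le> 3"
  then consider "k = 0" | "k = Suc 0" | "k = Suc (Suc 0)" | "k = Suc (Suc (Suc 0))" by linarith
  then show ?thesis
    by cases (simp_all add: nderiv_simps[abs_def] std_normal_density_def, (intro continuous_intros; simp)+)
qed

lemma nn_integral_le_moment:
  assumes "integrable lborel f" "\<And>x. \<bar>g x\<bar> \<le> f x" "integral\<^sup>L lborel f = (C::real)"
  shows "(\<integral>\<^sup>+x. ennreal \<bar>g x\<bar> \<partial>lborel) \<le> ennreal C"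
proof -
  have "0 \<le> f x" for x using assms(2)[of x] abs_ge_zero order_trans by blast
  then have "(\<integral>\<^sup>+x. ennreal (f x) \<partial>lborel) = ennreal C"
    using assms by (subst nn_integral_eq_integral) auto
  moreover have "(\<integral>\<^sup>+x. ennreal \<bar>g x\<bar> \<partial>lborel) \<le> (\<integral>\<^sup>+x. ennreal (f x) \<partial>lborel)"
    by (intro nn_integral_mono ennreal_leI assms)
  ultimately show ?thesis by simp
qed

text \<open>The first two entries are exact L1 norms, the last two only upper bounds. The last one
  is chosen so that \<open>nbound 3\<close> / (2 * 3!) = 1 / (2 sqrt (2 pi)), which leads exactly to
  the term \<epsilon> / 2 of the bound.\<close>

definition nbound :: "nat \<Rightarrow> real" where
  "nbound k = [1, sqrt (2 / pi), 2, 3 * sqrt (2 / pi)] ! k"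

lemma nderiv_L1:
  assumes "k \<le> 3"
  shows "(\<integral>\<^sup>+z. ennreal \<bar>nderiv k z\<bar> \<partial>lborel) \<le> ennreal (nbound k)"
proof -
  let ?p = "std_normal_density"
  note I = integrable_std_normal_moment_abs integrable_std_normal_moment
  note O = integral_std_normal_moment_abs_odd[of 0, simplified] integral_std_normal_moment_abs_odd[of 1, simplified]
    integral_std_normal_moment_abs_odd[of 2, simplified]
  note E = integral_std_normal_moment_even[of 1, simplified]
  consider "k = 0" | "k = Suc 0" | "k = Suc (Suc 0)" | "k = Suc (Suc (Suc 0))" using assms by linarith
  then show ?thesis
  proof cases
    case 1
    show ?thesis unfolding 1 by (rule nn_integral_le_moment[of ?p]) (auto simp: nbound_def)
  next
    case 2
    show ?thesis unfolding 2
      using I(1)[of 1] O(1)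
      by (intro nn_integral_le_moment[of "\<lambda>z. ?p z * \<bar>z\<bar>"]) (auto simp: nbound_def abs_mult)
  next
    case 3
    have "\<bar>(z\<^sup>2 - 1) * ?p z\<bar> \<le> ?p z * z\<^sup>2 + ?p z" for z
    proof -
      have "\<bar>z\<^sup>2 - 1\<bar> * ?p z \<le> (z\<^sup>2 + 1) * ?p z"
        by (intro mult_right_mono) (auto simp: abs_le_iff)
      also have "\<bar>z\<^sup>2 - 1\<bar> * ?p z = \<bar>(z\<^sup>2 - 1) * ?p z\<bar>"
        by (simp only: abs_mult abs_of_nonneg[OF normal_density_nonneg])
      finally show ?thesis by (simp only: distrib_left distrib_right mult.commute[of _ "?p z"] mult_1_right)
    qed
    then show ?thesis unfolding 3
      using I(2)[of 2] E
      by (intro nn_integral_le_moment[of "\<lambda>z. ?p z * z\<^sup>2 + ?p z"]) (auto simp: nbound_def)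
  next
    case 4
    \<comment> \<open>From 2 |w| <= w^2 + 1 with w = z^2 - 3. The absolute moments of orders 5, 3, 1
      are 8, 2, 1 times sqrt (2 / pi), so ?f integrates to 8/2 - 3 * 2 + 5 = 3 times sqrt (2 /
      pi).\<close>
    let ?f = "\<lambda>z. 1/2 * (?p z * \<bar>z\<bar> ^ 5) - 3 * (?p z * \<bar>z\<bar> ^ 3) + 5 * (?p z * \<bar>z\<bar>)"
    have "\<bar>(3 * z - z ^ 3) * ?p z\<bar> \<le> ?f z" for z
    proof -
      have "2 * \<bar>z\<^sup>2 - 3\<bar> \<le> \<bar>z\<^sup>2 - 3\<bar>\<^sup>2 + 1"
        using zero_le_power2[of "\<bar>z\<^sup>2 - 3\<bar> - 1"] by (simp add: power2_diff)
      then have "\<bar>z\<^sup>2 - 3\<bar> \<le> (z ^ 4 - 6 * z\<^sup>2 + 10) / 2" by (simp add: power2_diff)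
      then have "\<bar>z\<bar> * \<bar>z\<^sup>2 - 3\<bar> * ?p z \<le> \<bar>z\<bar> * ((z ^ 4 - 6 * z\<^sup>2 + 10) / 2) * ?p z"
        by (intro mult_right_mono mult_left_mono) auto
      also have "\<dots> = ?f z"
      proof -
        have "\<bar>z\<bar> ^ 5 = \<bar>z\<bar> * z ^ 4" "\<bar>z\<bar> ^ 3 = \<bar>z\<bar> * z\<^sup>2"
          using power_Suc[of "\<bar>z\<bar>" 4] power_Suc[of "\<bar>z\<bar>" 2] by simp_all
        then show ?thesis by (simp only:) (simp add: algebra_simps add_divide_distrib diff_divide_distrib)
      qed
      also have "\<bar>z\<bar> * \<bar>z\<^sup>2 - 3\<bar> * ?p z = \<bar>(3 * z - z ^ 3) * ?p z\<bar>"
      proof -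
        have "3 * z - z ^ 3 = - (z * (z\<^sup>2 - 3))" by (simp add: algebra_simps power2_eq_square power3_eq_cube)
        then show ?thesis by (simp only: abs_mult abs_minus_cancel) simp
      qed
      finally show ?thesis .
    qed
    moreover have "integrable lborel ?f" using I(1)[of 5] I(1)[of 3] I(1)[of 1] by auto
    moreover have "integral\<^sup>L lborel ?f = 3 * sqrt (2 / pi)"
      using I(1)[of 5] I(1)[of 3] I(1)[of 1] O by (simp add: fact_numeral)
    ultimately show ?thesis unfolding 4
      by (intro nn_integral_le_moment[of ?f]) (auto simp: nbound_def)
  qed
qed

lemma nderiv_measurable: "k \<le> 3 \<Longrightarrow> nderiv k \<in> borel_measurable borel"
  by (rule borel_measurable_continuous_onI[OF nderiv_cont])

lemma nderiv_integrable: "k \<le> 3 \<Longrightarrow> integrable lborel (nderiv k)"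
  using nderiv_L1[of k] nderiv_measurable[of k]
  by (intro integrableI_bounded) (auto simp: order_le_less_trans)

text \<open>Up to the factor (-1 / s)^k this is the k-th derivative at x of the smoothed function
  \<open>avg (gauss m s) f\<close>, less 1/2 if k = 0.\<close>

definition gcoef :: "(real \<Rightarrow> real) \<Rightarrow> real \<Rightarrow> real \<Rightarrow> real \<Rightarrow> nat \<Rightarrow> real" where
  "gcoef f m s x k = (LINT y|lborel. (f (x + m + s * y) - 1/2) * nderiv k y)"

lemma centered_integral_bound:
  assumes f: "test_fun f" and p: "integrable lborel p" and C: "0 \<le> C"
    "(\<integral>\<^sup>+y. ennreal \<bar>p y\<bar> \<partial>lborel) \<le> ennreal C"
  shows "integrable lborel (\<lambda>y. (f (a + s * y) - 1/2) * p y)"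
    and "\<bar>LINT y|lborel. (f (a + s * y) - 1/2) * p y\<bar> \<le> C / 2"
proof -
  have [measurable]: "f \<in> borel_measurable borel" by (rule test_funD[OF f])
  have [measurable]: "p \<in> borel_measurable borel" using p by auto
  have le: "\<bar>(f (a + s * y) - 1/2) * p y\<bar> \<le> 1/2 * \<bar>p y\<bar>" for y
    unfolding abs_mult by (intro mult_right_mono test_funD(5)[OF f]) simp
  show I: "integrable lborel (\<lambda>y. (f (a + s * y) - 1/2) * p y)"
    by (rule Bochner_Integration.integrable_bound[where f="\<lambda>y. 1/2 * \<bar>p y\<bar>"]) (use p le in auto)
  have "ennreal (LINT y|lborel. \<bar>p y\<bar>) \<le> ennreal C"
    using C p by (subst nn_integral_eq_integral[symmetric]) auto
  then have pC: "(LINT y|lborel. \<bar>p y\<bar>) \<le> C" using C by simp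
  have "\<bar>LINT y|lborel. (f (a + s * y) - 1/2) * p y\<bar> \<le> (LINT y|lborel. \<bar>(f (a + s * y) - 1/2) * p y\<bar>)"
    by (rule integral_abs_bound)
  also have "\<dots> \<le> (LINT y|lborel. 1/2 * \<bar>p y\<bar>)"
    by (rule Bochner_Integration.integral_mono) (use I p le in auto)
  also have "\<dots> \<le> C / 2" using pC by simp
  finally show "\<bar>LINT y|lborel. (f (a + s * y) - 1/2) * p y\<bar> \<le> C / 2" .
qed

lemma nbound_nonneg: "k \<le> 3 \<Longrightarrow> 0 \<le> nbound k"
proof -
  assume "k \<le> 3"
  then consider "k = 0" | "k = Suc 0" | "k = Suc (Suc 0)" | "k = Suc (Suc (Suc 0))" by linarith
  then show ?thesis by cases (simp_all add: nbound_def)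
qed

text \<open>Centring \<open>f\<close> at \<open>1/2\<close> halves all constants.\<close>

lemma gauss_taylor:
  assumes f: "test_fun f" and s: "s > 0" and n: "0 < n" "n \<le> 3"
  shows "\<bar>avg (gauss m s) f (x + u) - 1/2 - (\<Sum>k<n. (- u / s) ^ k / fact k * gcoef f m s x k)\<bar>
    \<le> nbound n / 2 * (\<bar>u\<bar> / s) ^ n / fact n"
proof -
  have [measurable]: "f \<in> borel_measurable borel" by (rule test_funD[OF f])
  let ?p = "std_normal_density"
  \<comment> \<open>Substituting z = y + v turns the shift of the argument by u into a shift of the
    density by v.\<close>
  define v where "v = - u / s"
  define F where "F y = f (x + m + s * y) - 1/2" for y
  define R where "R y = nderiv 0 (y + v) - (\<Sum>k<n. v ^ k / fact k * nderiv k y)" for y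
  have p_int: "integrable lborel ?p" by simp
  have p_shift: "integrable lborel (\<lambda>y. ?p (y + v))"
    using lborel_integrable_real_affine[OF p_int, of 1 v] by (simp add: add.commute)
  have Rint: "integrable lborel R"
    unfolding R_def using n p_shift
    by (auto intro!: Bochner_Integration.integrable_diff Bochner_Integration.integrable_sum
        Bochner_Integration.integrable_mult_right nderiv_integrable)
  have RL1: "(\<integral>\<^sup>+y. ennreal \<bar>R y\<bar> \<partial>lborel) \<le> ennreal (nbound n * \<bar>v\<bar> ^ n / fact n)"
    unfolding R_def using n
    by (intro L1_taylor nderiv_deriv nderiv_cont nderiv_L1 nbound_nonneg) auto
  have "avg (gauss m s) f (x + u) - 1/2 = (LINT z|lborel. (f (x + u + m + s * z) - 1/2) * ?p z)"
  proof -
    have "integrable lborel (\<lambda>z. ?p z * f (x + u + m + s * z))"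
      by (rule Bochner_Integration.integrable_bound[OF p_int])
         (auto simp: abs_mult intro!: mult_left_le test_funD[OF f])
    then show ?thesis
      unfolding avg_gauss[OF f] by (simp add: left_diff_distrib mult.commute[of "f _"])
  qed
  also have "\<dots> = (LINT y|lborel. F y * ?p (y + v))"
  proof -
    have key: "x + u + m + s * (v + 1 * y) = x + m + s * y" for y
      using s by (simp add: v_def field_simps)
    show ?thesis
      by (subst lborel_integral_real_affine[of 1 _ v])
         (simp_all only: F_def key, simp_all add: add.commute[of v])
  qed
  finally have 1: "avg (gauss m s) f (x + u) - 1/2 = (LINT y|lborel. F y * ?p (y + v))" .
  have iF: "integrable lborel (\<lambda>y. F y * p y)" if "integrable lborel p" for p
    unfolding F_def
    by (rule centered_integral_bound(1)[OF f that, of "LINT y|lborel. \<bar>p y\<bar>"])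
       (use that in \<open>auto simp: nn_integral_eq_integral\<close>)
  have "(LINT y|lborel. F y * R y) = (LINT y|lborel. F y * ?p (y + v) - (\<Sum>k<n. v ^ k / fact k * (F y * nderiv k y)))"
    by (simp add: R_def right_diff_distrib sum_distrib_left mult.left_commute)
  also have "\<dots> = (LINT y|lborel. F y * ?p (y + v)) - (\<Sum>k<n. v ^ k / fact k * (LINT y|lborel. F y * nderiv k y))"
  proof -
    have i: "integrable lborel (\<lambda>y. v ^ k / fact k * (F y * nderiv k y))" if "k \<in> {..<n}" for k
      using n that by (intro Bochner_Integration.integrable_mult_right iF nderiv_integrable) auto
    show ?thesis
      by (subst Bochner_Integration.integral_diff[OF iF[OF p_shift] Bochner_Integration.integrable_sum[OF i]], assumption)
         (simp only: Bochner_Integration.integral_sum[OF i] integral_mult_right_zero)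
  qed
  finally have "avg (gauss m s) f (x + u) - 1/2 - (\<Sum>k<n. v ^ k / fact k * gcoef f m s x k) = (LINT y|lborel. F y * R y)"
    by (simp add: 1 gcoef_def F_def)
  also have "\<bar>\<dots>\<bar> \<le> (nbound n * \<bar>v\<bar> ^ n / fact n) / 2"
    unfolding F_def using nbound_nonneg[OF n(2)] by (intro centered_integral_bound(2)[OF f Rint _ RL1]) simp
  finally show ?thesis using s by (simp add: v_def abs_div)
qed

lemma gcoef_bound: "test_fun f \<Longrightarrow> k \<le> 3 \<Longrightarrow> \<bar>gcoef f m s x k\<bar> \<le> nbound k / 2"
  unfolding gcoef_def
  by (rule centered_integral_bound(2)[OF _ nderiv_integrable nbound_nonneg nderiv_L1])

lemma gcoef_0:
  assumes f: "test_fun f" and s: "s > 0"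
  shows "gcoef f m s x 0 = avg (gauss m s) f x - 1/2"
  using gauss_taylor[OF f s, of 1 m x 0] by (simp add: nbound_def)

lemma sqrt_2_pi: "sqrt (2 / pi) / 2 = 1 / sqrt (2 * pi)"
  by (simp add: real_sqrt_divide real_sqrt_mult field_simps)

text \<open>The expansion of order one; half of E|Z| = sqrt (2 / pi) is 1 / sqrt (2 pi), the origin
  of the constant in the drift term of the bound.\<close>

lemma gauss_lipschitz:
  assumes f: "test_fun f" and s: "s > 0"
  shows "\<bar>avg (gauss m s) f (x + u) - avg (gauss m s) f x\<bar> \<le> \<bar>u\<bar> / (s * sqrt (2 * pi))"
proof -
  have "\<bar>avg (gauss m s) f (x + u) - avg (gauss m s) f x\<bar> \<le> sqrt (2 / pi) / 2 * (\<bar>u\<bar> / s)"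
    using gauss_taylor[OF f s, of 1 m x u] gcoef_0[OF f s] by (simp add: nbound_def)
  then show ?thesis unfolding sqrt_2_pi by (simp add: field_simps)
qed

text \<open>Here a and b are the first two derivatives of the smoothed function at x. Both orders
  are kept: the second is worth more when the small-jump variance is low, the third when \<epsilon>
  is small.\<close>

lemma gauss_taylor_23:
  assumes f: "test_fun f" and s: "s > 0"
  obtains a b where
    "\<And>u. \<bar>avg (gauss m s) f (x + u) - avg (gauss m s) f x - u * a\<bar> \<le> u\<^sup>2 / (2 * s\<^sup>2)"
    "\<And>u. \<bar>avg (gauss m s) f (x + u) - avg (gauss m s) f x - u * a - u\<^sup>2 / 2 * b\<bar>
       \<le> \<bar>u\<bar> ^ 3 / (2 * sqrt (2 * pi) * s ^ 3)"
    "\<bar>b\<bar> \<le> 1 / s\<^sup>2"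
proof
  let ?c = "gcoef f m s x"
  let ?a = "- ?c 1 / s" and ?b = "?c 2 / s\<^sup>2"
  fix u
  have sum2: "(\<Sum>k<2. (- u / s) ^ k / fact k * ?c k) = ?c 0 + u * ?a"
    by (simp add: numeral_2_eq_2)
  have sum3: "(\<Sum>k<3. (- u / s) ^ k / fact k * ?c k) = ?c 0 + u * ?a + u\<^sup>2 / 2 * ?b"
    by (simp add: numeral_3_eq_3 numeral_2_eq_2)
  show "\<bar>avg (gauss m s) f (x + u) - avg (gauss m s) f x - u * ?a\<bar> \<le> u\<^sup>2 / (2 * s\<^sup>2)"
    using gauss_taylor[OF f s, of 2 m x u] unfolding sum2
    by (simp add: nbound_def gcoef_0[OF f s] power_divide)
  show "\<bar>avg (gauss m s) f (x + u) - avg (gauss m s) f x - u * ?a - u\<^sup>2 / 2 * ?b\<bar>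
       \<le> \<bar>u\<bar> ^ 3 / (2 * sqrt (2 * pi) * s ^ 3)"
  proof -
    have "\<bar>avg (gauss m s) f (x + u) - avg (gauss m s) f x - u * ?a - u\<^sup>2 / 2 * ?b\<bar>
        \<le> nbound 3 / 2 * (\<bar>u\<bar> / s) ^ 3 / fact 3"
      using gauss_taylor[OF f s, of 3 m x u] unfolding sum3 gcoef_0[OF f s]
      by (simp add: algebra_simps)
    also have "nbound 3 = 3 * sqrt (2 / pi)" by (simp add: nbound_def)
    also have "3 * sqrt (2 / pi) / 2 * (\<bar>u\<bar> / s) ^ 3 / fact 3 = (sqrt (2 / pi) / 2) * (1/2) * (\<bar>u\<bar> / s) ^ 3" by (simp add: fact_numeral)
    also have "\<dots> = \<bar>u\<bar> ^ 3 / (2 * sqrt (2 * pi) * s ^ 3)" unfolding sqrt_2_pi by (simp add: power_divide)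
    finally show ?thesis .
  qed
  show "\<bar>?b\<bar> \<le> 1 / s\<^sup>2"
    using gcoef_bound[OF f, of 2 m s x] s by (simp add: nbound_def divide_right_mono)
qed

section \<open>Comparison of two Gaussian laws\<close>

lemma gauss_shift:
  assumes f: "test_fun f" and s: "s > 0"
  shows "\<bar>avg (gauss m1 s) f x - avg (gauss m2 s) f x\<bar> \<le> \<bar>m1 - m2\<bar> / (s * sqrt (2 * pi))"
proof -
  have "avg (gauss m1 s) f x = avg (gauss m2 s) f (x + (m1 - m2))"
    unfolding avg_gauss[OF f] by (simp add: algebra_simps)
  then show ?thesis using gauss_lipschitz[OF f s] by simp
qed

text \<open>For \<open>s1 \<le> s2\<close> the density of scale \<open>s2\<close> is at least \<open>s1 / s2\<close> times the density of scale \<open>s1\<close>.\<close>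

lemma gauss_scale_ge:
  assumes f: "test_fun f" and s: "0 < s1" "s1 \<le> s2"
  shows "s1 / s2 * avg (gauss m s1) f x \<le> avg (gauss m s2) f x"
proof -
  have [measurable]: "f \<in> borel_measurable borel" by (rule test_funD[OF f])
  let ?p = "std_normal_density" and ?r = "s1 / s2"
  have r: "0 < ?r" "?r \<le> 1" using s by auto
  have int: "integrable lborel (\<lambda>z. ?p z * f (x + m + a * z))" for a
    by (rule Bochner_Integration.integrable_bound[of _ ?p])
       (auto simp: abs_mult intro!: mult_left_le test_funD[OF f])
  have p_le: "?p y \<le> ?p (?r * y)" for y
  proof -
    have "?r\<^sup>2 * y\<^sup>2 \<le> 1 * y\<^sup>2" using r by (intro mult_right_mono power_le_one) auto
    then show ?thesis unfolding std_normal_density_def by (intro mult_left_mono) (auto simp: power_mult_distrib power_divide)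
  qed
  have eq: "avg (gauss m s2) f x = ?r * (LINT y|lborel. ?p (?r * y) * f (x + m + s1 * y))"
    unfolding avg_gauss[OF f]
    using lborel_integral_real_affine[of ?r "\<lambda>z. ?p z * f (x + m + s2 * z)" 0] r s by (simp add: field_simps)
  have "integrable lborel (\<lambda>y. ?p (?r * y) * f (x + m + s1 * y))"
    using lborel_integrable_real_affine[OF int[of s2], of ?r 0] r s by (simp add: field_simps)
  then have "(LINT y|lborel. ?p y * f (x + m + s1 * y)) \<le> (LINT y|lborel. ?p (?r * y) * f (x + m + s1 * y))"
    using int by (intro Bochner_Integration.integral_mono mult_right_mono p_le test_funD[OF f])
  then show ?thesis
    unfolding eq unfolding avg_gauss[OF f] using r by (intro mult_left_mono) auto
qed

lemma avg_compl:
  assumes "test_fun f" "real_distribution \<mu>"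
  shows "avg \<mu> (\<lambda>y. 1 - f y) x = 1 - avg \<mu> f x"
proof -
  interpret real_distribution \<mu> by fact
  show ?thesis unfolding avg_def
    using test_fun_integrable[OF assms(1) finite_measure_axioms events_eq_borel] prob_space by simp
qed

text \<open>The comparison of densities, applied to f and to 1 - f, bounds the change in both
  directions: each of the two means lies in [0, 1] and loses at most the fraction 1 - s1 /
  s2.\<close>

lemma gauss_scale:
  assumes f: "test_fun f" and s: "0 < s1" "s1 \<le> s2"
  shows "\<bar>avg (gauss m s1) f x - avg (gauss m s2) f x\<bar> \<le> (s2 - s1) / s2"
proof -
  let ?g1 = "avg (gauss m s1) f x" and ?g2 = "avg (gauss m s2) f x"
  have g1: "0 \<le> ?g1" "?g1 \<le> 1"
    using avg_test_fun[OF f real_distribution_gauss] by (simp_all add: test_funD)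
  have 1: "s1 / s2 * ?g1 \<le> ?g2" by (rule gauss_scale_ge[OF f s])
  have 2: "s1 / s2 * (1 - ?g1) \<le> 1 - ?g2"
    using gauss_scale_ge[OF test_fun_compl[OF f] s, of m x]
    by (simp add: avg_compl[OF f real_distribution_gauss])
  have r: "0 \<le> 1 - s1 / s2" using s by auto
  have "(1 - s1 / s2) * ?g1 \<le> (1 - s1 / s2) * 1" "(1 - s1 / s2) * (1 - ?g1) \<le> (1 - s1 / s2) * 1"
    using g1 r by (intro mult_left_mono; simp)+
  with 1 2 have "\<bar>?g1 - ?g2\<bar> \<le> 1 - s1 / s2" by (simp add: abs_le_iff algebra_simps)
  then show ?thesis using s by (simp add: diff_divide_distrib)
qed

text \<open>The scale is changed first and the mean is moved at the larger scale, where a shift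
  costs least; hence the maximum in the denominator.\<close>

lemma gauss_dist:
  assumes f: "test_fun f" and s: "0 < s1" "0 < s2"
  shows "\<bar>avg (gauss m1 s1) f x - avg (gauss m2 s2) f x\<bar>
    \<le> (\<bar>m1 - m2\<bar> / sqrt (2 * pi) + \<bar>s1 - s2\<bar>) / max s1 s2"
proof -
  have *: "\<bar>avg (gauss m1 s1) f x - avg (gauss m2 s2) f x\<bar>
      \<le> (\<bar>m1 - m2\<bar> / sqrt (2 * pi) + \<bar>s1 - s2\<bar>) / s2" if "0 < s1" "s1 \<le> s2" for m1 m2 s1 s2
  proof -
    have "\<bar>avg (gauss m1 s1) f x - avg (gauss m1 s2) f x\<bar> \<le> \<bar>s1 - s2\<bar> / s2"
      using gauss_scale[OF f that] that by simp
    moreover have "\<bar>avg (gauss m1 s2) f x - avg (gauss m2 s2) f x\<bar> \<le> \<bar>m1 - m2\<bar> / sqrt (2 * pi) / s2"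
      using gauss_shift[OF f, of s2 m1 x m2] that by (simp add: mult.commute)
    ultimately show ?thesis by (simp add: add_divide_distrib)
  qed
  show ?thesis
  proof (cases "s1 \<le> s2")
    case True then show ?thesis using *[of s1 s2] s by (simp add: max_absorb2)
  next
    case False then show ?thesis using *[of s2 s1 m2 m1] s by (simp add: max_absorb1 abs_minus_commute)
  qed
qed

subsection \<open>Small jumps: Lindeberg replacement\<close>

definition mid_jumps :: "real \<Rightarrow> real \<Rightarrow> real set" where
  "mid_jumps \<delta> \<epsilon> = {x. \<delta> < \<bar>x\<bar> \<and> \<bar>x\<bar> \<le> \<epsilon>}"

lemma mid_jumps_borel [measurable]: "mid_jumps \<delta> \<epsilon> \<in> sets borel"
  unfolding mid_jumps_def by measurable

text \<open>The atom sits where it makes the step centred.\<close>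

definition small_step :: "real measure \<Rightarrow> real \<Rightarrow> real \<Rightarrow> real \<Rightarrow> real measure" where
  "small_step \<nu> c \<delta> \<epsilon> = jump_step (scaled_restr c (mid_jumps \<delta> \<epsilon>) \<nu>)
     (- c * (LINT x:mid_jumps \<delta> \<epsilon>|\<nu>. x) / (1 - c * measure \<nu> (mid_jumps \<delta> \<epsilon>)))"

section \<open>One step of the small-jump walk\<close>

context levy
begin

lemma sq_integrable: "\<epsilon> \<le> 1 \<Longrightarrow> set_integrable \<nu> {x. \<bar>x\<bar> \<le> \<epsilon>} (\<lambda>x. x\<^sup>2)"
  by (rule integrable_sq[where K=1]) auto

lemma small_jump_var_nonneg: "0 \<le> small_jump_var \<nu> \<epsilon>"
  unfolding small_jump_var_def set_lebesgue_integral_def by (intro integral_nonneg_AE) auto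

context
  fixes c \<delta> \<epsilon> :: real
  assumes \<delta>: "0 < \<delta>" "\<delta> \<le> \<epsilon>" "\<epsilon> \<le> 1" and c: "0 \<le> c"
    and small: "c * small_jump_var \<nu> \<epsilon> \<le> \<delta>\<^sup>2 / 2"
begin

abbreviation (input) "B \<equiv> mid_jumps \<delta> \<epsilon>"
abbreviation (input) "sv \<equiv> small_jump_var \<nu> \<epsilon>"
abbreviation (input) "\<kappa> \<equiv> scaled_restr c B \<nu>"

lemma B_bounds: "x \<in> B \<Longrightarrow> \<delta> < \<bar>x\<bar>" "x \<in> B \<Longrightarrow> \<bar>x\<bar> \<le> \<epsilon>"
  by (auto simp: mid_jumps_def)

lemma set_integrable_B:
  fixes f :: "real \<Rightarrow> 'b::{banach, second_countable_topology}"
  assumes "f \<in> borel_measurable borel" and "\<And>x. x \<in> B \<Longrightarrow> norm (f x) \<le> K"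
  shows "set_integrable \<nu> B f"
  by (rule integrable_indicator_away[of _ _ \<delta> K]) (use assms \<delta> B_bounds in auto)

lemma B_sq_integrable: "set_integrable \<nu> B (\<lambda>x. x\<^sup>2)"
  by (rule set_integrable_subset[OF sq_integrable[OF \<delta>(3)]]) (auto simp: mid_jumps_def)

lemma B_sq: "(LINT x:B|\<nu>. x\<^sup>2) = sv - small_jump_var \<nu> \<delta>"
proof -
  have "sv = (LINT x:{x. \<bar>x\<bar> \<le> \<delta>} \<union> B|\<nu>. x\<^sup>2)"
    unfolding small_jump_var_def using \<delta> by (intro arg_cong2[where f="\<lambda>A. set_lebesgue_integral \<nu> A"])
      (auto simp: mid_jumps_def)
  also have "\<dots> = small_jump_var \<nu> \<delta> + (LINT x:B|\<nu>. x\<^sup>2)"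
    unfolding small_jump_var_def using \<delta>
    by (intro set_integral_Un sq_integrable B_sq_integrable) (auto simp: mid_jumps_def)
  finally show ?thesis by simp
qed

lemma B_sq_le: "(LINT x:B|\<nu>. x\<^sup>2) \<le> sv"
  using B_sq small_jump_var_nonneg[of \<delta>] by simp

text \<open>Chebyshev's inequality for the jumps larger than \<delta>.\<close>

lemma B_mass: "\<delta>\<^sup>2 * measure \<nu> B \<le> sv" and B_fin: "emeasure \<nu> B < \<infinity>"
proof -
  show fin: "emeasure \<nu> B < \<infinity>" using \<delta> B_bounds by (intro finite_away[of _ \<delta>]) auto
  have i: "set_integrable \<nu> B (\<lambda>_. \<delta>\<^sup>2)" by (rule set_integrable_B[of _ "\<delta>\<^sup>2"]) auto
  have "\<delta>\<^sup>2 * measure \<nu> B = (LINT x:B|\<nu>. \<delta>\<^sup>2)"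
    unfolding set_lebesgue_integral_def using fin by simp
  also have "\<dots> \<le> (LINT x:B|\<nu>. x\<^sup>2)"
  proof (rule set_integral_mono[OF i B_sq_integrable])
    fix x assume "x \<in> B"
    then show "\<delta>\<^sup>2 \<le> x\<^sup>2" using B_bounds(1)[of x] \<delta> by (simp add: abs_le_square_iff[symmetric])
  qed
  finally show "\<delta>\<^sup>2 * measure \<nu> B \<le> sv" using B_sq_le by simp
qed

text \<open>This is what the assumption \<open>small\<close> is for: the atom keeps at least half of
  the mass, so the denominator in its position is at least 1/2.\<close>

lemma p_half: "c * measure \<nu> B \<le> 1/2"
proof -
  have "\<delta>\<^sup>2 * (c * measure \<nu> B) \<le> c * sv" using mult_left_mono[OF B_mass c] by (simp add: algebra_simps)
  then have "\<delta>\<^sup>2 * (c * measure \<nu> B) \<le> \<delta>\<^sup>2 * (1/2)" using small by simp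
  then show ?thesis using \<delta> by (subst (asm) mult_le_cancel_left_pos) auto
qed

lemma jump_kernel_small: "jump_kernel \<kappa>"
  and mass_small: "measure \<kappa> UNIV = c * measure \<nu> B"
  using jump_kernel_scaled_restr[of \<nu> B c] c B_fin p_half by auto

lemma real_distribution_small_step: "real_distribution (small_step \<nu> c \<delta> \<epsilon>)"
  unfolding small_step_def by (rule jump_kernel.real_distribution_jump_step[OF jump_kernel_small])

definition m1 :: real where "m1 = (LINT x:B|\<nu>. x)"
definition atom :: real where "atom = - c * m1 / (1 - c * measure \<nu> B)"

lemma small_step_atom: "small_step \<nu> c \<delta> \<epsilon> = jump_step \<kappa> atom"
  by (simp add: small_step_def atom_def m1_def)

lemma centred: "(1 - c * measure \<nu> B) * atom + c * m1 = 0"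
  using p_half by (simp add: atom_def)

text \<open>On B one has |x| <= x^2 / \<delta>, so the first moment is at most sv / \<delta>, and
  the atom that compensates it lies within 2 c sv / \<delta> of 0. The square is of second order in
  c and therefore negligible when summed over about 1 / c steps.\<close>

lemma atom_sq: "atom\<^sup>2 \<le> 4 * (c * sv)\<^sup>2 / \<delta>\<^sup>2"
proof -
  have i: "set_integrable \<nu> B (\<lambda>x. x)" by (rule set_integrable_B[of _ \<epsilon>]) (use B_bounds in auto)
  have "\<delta> * \<bar>m1\<bar> \<le> \<delta> * (LINT x:B|\<nu>. \<bar>x\<bar>)"
    unfolding m1_def using \<delta> set_integral_norm_bound[OF i] by (intro mult_left_mono) auto
  also have "\<dots> = (LINT x:B|\<nu>. \<delta> * \<bar>x\<bar>)" by simp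
  also have "\<dots> \<le> (LINT x:B|\<nu>. x\<^sup>2)"
  proof (rule set_integral_mono[OF _ B_sq_integrable])
    show "set_integrable \<nu> B (\<lambda>x. \<delta> * \<bar>x\<bar>)" using set_integrable_abs[OF i] by simp
    fix x assume x: "x \<in> B"
    have "\<delta> * \<bar>x\<bar> \<le> \<bar>x\<bar> * \<bar>x\<bar>" using B_bounds(1)[OF x] by (intro mult_right_mono) auto
    then show "\<delta> * \<bar>x\<bar> \<le> x\<^sup>2" by (simp add: power2_eq_square)
  qed
  also have "\<dots> \<le> sv" by (rule B_sq_le)
  finally have "\<bar>m1\<bar> \<le> sv / \<delta>" using \<delta> by (simp add: field_simps)
  then have "c * \<bar>m1\<bar> \<le> c * (sv / \<delta>)" using c by (rule mult_left_mono)
  moreover have "\<bar>atom\<bar> \<le> 2 * (c * \<bar>m1\<bar>)"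
  proof -
    have "\<bar>atom\<bar> = c * \<bar>m1\<bar> / (1 - c * measure \<nu> B)" using c p_half by (simp add: atom_def abs_mult)
    also have "\<dots> \<le> c * \<bar>m1\<bar> / (1/2)" using c p_half by (intro divide_left_mono) auto
    finally show ?thesis by simp
  qed
  ultimately have "\<bar>atom\<bar> \<le> 2 * (c * sv) / \<delta>" by simp
  then have "\<bar>atom\<bar>\<^sup>2 \<le> (2 * (c * sv) / \<delta>)\<^sup>2" by (rule power_mono) simp
  then show ?thesis by (simp add: power_divide power_mult_distrib)
qed

lemma kernel_integral:
  fixes f :: "real \<Rightarrow> 'b::{banach, second_countable_topology}"
  assumes "f \<in> borel_measurable borel"
  shows "integral\<^sup>L \<kappa> f = c *\<^sub>R (LINT x:B|\<nu>. f x)"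
  by (rule integral_scaled_restr) (use assms c in auto)

lemma kernel_bound:
  assumes [measurable]: "F \<in> borel_measurable borel" and F: "\<And>y. y \<in> B \<Longrightarrow> \<bar>F y\<bar> \<le> K * y\<^sup>2"
  shows "\<bar>integral\<^sup>L \<kappa> F\<bar> \<le> K * (c * (LINT x:B|\<nu>. x\<^sup>2))"
proof -
  have i: "set_integrable \<nu> B F"
    by (rule integrable_sq[where K=K]) (use F \<delta> B_bounds in \<open>auto intro: order_trans\<close>)
  have iK: "set_integrable \<nu> B (\<lambda>x. K * x\<^sup>2)" using B_sq_integrable by simp
  have "\<bar>LINT x:B|\<nu>. F x\<bar> \<le> (LINT x:B|\<nu>. \<bar>F x\<bar>)" using set_integral_norm_bound[OF i] by simp
  also have "\<dots> \<le> (LINT x:B|\<nu>. K * x\<^sup>2)"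
    by (rule set_integral_mono[OF set_integrable_abs[OF i] iK F])
  finally have "c * \<bar>LINT x:B|\<nu>. F x\<bar> \<le> c * (K * (LINT x:B|\<nu>. x\<^sup>2))"
    using c by (intro mult_left_mono) auto
  then show ?thesis using c by (simp add: kernel_integral abs_mult mult.left_commute)
qed

context
  fixes g :: "real \<Rightarrow> real" and x a b K2 K3 :: real
  assumes g: "test_fun g"
    and e2: "\<And>u. \<bar>g (x + u) - g x - u * a\<bar> \<le> K2 * u\<^sup>2"
    and e3: "\<And>u. \<bar>g (x + u) - g x - u * a - u\<^sup>2 / 2 * b\<bar> \<le> K3 * \<bar>u\<bar> ^ 3"
    and b: "\<bar>b\<bar> \<le> 2 * K2" and K: "0 \<le> K2" "0 \<le> K3"
begin

text \<open>Subtracting the linear term at the atom and under the kernel changes nothing, because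
  the step has mean 0 (\<open>centred\<close>). The kernel part is then controlled by the variance
  alone, whatever \<delta> is.\<close>

lemma small_step_expand:
  "avg (small_step \<nu> c \<delta> \<epsilon>) g x - g x
   = (1 - c * measure \<nu> B) * (g (x + atom) - g x - atom * a) + (LINT y|\<kappa>. g (x + y) - g x - y * a)"
proof -
  have [measurable]: "g \<in> borel_measurable borel" by (rule test_funD[OF g])
  interpret jump_kernel \<kappa> by (rule jump_kernel_small)
  have i: "set_integrable \<nu> B (\<lambda>y. g (x + y))" "set_integrable \<nu> B (\<lambda>y. g x)" "set_integrable \<nu> B (\<lambda>y. y * a)"
    by (rule set_integrable_B[of _ 1], simp, simp add: test_funD[OF g],
        rule set_integrable_B[of _ 1], simp, simp add: test_funD[OF g],
        rule set_integrable_B[of _ "\<epsilon> * \<bar>a\<bar>"], simp, auto simp: abs_mult intro!: mult_right_mono B_bounds)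
  have "(LINT y:B|\<nu>. g (x + y) - g x - y * a) = (LINT y:B|\<nu>. g (x + y)) - (LINT y:B|\<nu>. g x) - (LINT y:B|\<nu>. y * a)"
    using i by (simp add: set_integral_diff)
  also have "(LINT y:B|\<nu>. g x) = measure \<nu> B * g x"
    unfolding set_lebesgue_integral_def using B_fin by simp
  also have "(LINT y:B|\<nu>. y * a) = m1 * a" by (simp add: m1_def)
  finally have "(LINT y|\<kappa>. g (x + y) - g x - y * a) = (LINT y|\<kappa>. g (x + y)) - c * measure \<nu> B * g x - c * m1 * a"
    by (simp add: kernel_integral right_diff_distrib)
  moreover have "avg (small_step \<nu> c \<delta> \<epsilon>) g x = (1 - c * measure \<nu> B) * g (x + atom) + (LINT y|\<kappa>. g (x + y))"
    unfolding small_step_atom using avg_jump_step[OF g] by (simp add: mass_small)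
  moreover have "(1 - c * measure \<nu> B) * (atom * a) + c * m1 * a = 0"
    using arg_cong[OF centred, of "\<lambda>z. z * a"] by (simp add: algebra_simps)
  ultimately show ?thesis by (simp add: algebra_simps)
qed

lemma atom_term:
  "\<bar>(1 - c * measure \<nu> B) * (g (x + atom) - g x - atom * a)\<bar> \<le> K2 * (4 * (c * sv)\<^sup>2 / \<delta>\<^sup>2)"
proof -
  have p: "0 \<le> 1 - c * measure \<nu> B" "1 - c * measure \<nu> B \<le> 1" using p_half c by auto
  have "\<bar>(1 - c * measure \<nu> B) * (g (x + atom) - g x - atom * a)\<bar> \<le> 1 * (K2 * atom\<^sup>2)"
    unfolding abs_mult using p e2 by (intro mult_mono) auto
  also have "\<dots> \<le> K2 * (4 * (c * sv)\<^sup>2 / \<delta>\<^sup>2)" using mult_left_mono[OF atom_sq K(1)] by simp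
  finally show ?thesis .
qed

text \<open>No quadratic term is matched here: the step is compared with not moving at all, at a
  cost proportional to the variance.\<close>

lemma small_step_2:
  "\<bar>avg (small_step \<nu> c \<delta> \<epsilon>) g x - g x\<bar> \<le> K2 * (4 * (c * sv)\<^sup>2 / \<delta>\<^sup>2) + K2 * (c * sv)"
proof -
  have [measurable]: "g \<in> borel_measurable borel" by (rule test_funD[OF g])
  have "\<bar>LINT y|\<kappa>. g (x + y) - g x - y * a\<bar> \<le> K2 * (c * (LINT x:B|\<nu>. x\<^sup>2))"
    by (rule kernel_bound) (use e2 in auto)
  also have "\<dots> \<le> K2 * (c * sv)" using B_sq_le c K by (intro mult_left_mono) auto
  finally show ?thesis using small_step_expand atom_term by linarith
qed

text \<open>The quadratic term is compared with the full variance sv although jumps up to \<delta>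
  are missing; the last summand pays for them. In the cubic remainder one factor |y| is bounded by
  \<epsilon>, and the other two again form the variance.\<close>

lemma small_step_3:
  "\<bar>avg (small_step \<nu> c \<delta> \<epsilon>) g x - g x - c * sv / 2 * b\<bar>
   \<le> K2 * (4 * (c * sv)\<^sup>2 / \<delta>\<^sup>2) + K3 * \<epsilon> * (c * sv) + K2 * (c * small_jump_var \<nu> \<delta>)"
proof -
  have [measurable]: "g \<in> borel_measurable borel" by (rule test_funD[OF g])
  have "\<bar>LINT y|\<kappa>. g (x + y) - g x - y * a - y\<^sup>2 / 2 * b\<bar> \<le> (K3 * \<epsilon>) * (c * (LINT x:B|\<nu>. x\<^sup>2))"
  proof (rule kernel_bound)
    fix y assume "y \<in> B"
    then have "\<bar>y\<bar> * y\<^sup>2 \<le> \<epsilon> * y\<^sup>2" using B_bounds by (intro mult_right_mono) auto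
    moreover have "\<bar>y\<bar> ^ 3 = \<bar>y\<bar> * y\<^sup>2" using power_Suc[of "\<bar>y\<bar>" 2] by simp
    ultimately have "K3 * \<bar>y\<bar> ^ 3 \<le> K3 * (\<epsilon> * y\<^sup>2)" using K by (intro mult_left_mono) auto
    then show "\<bar>g (x + y) - g x - y * a - y\<^sup>2 / 2 * b\<bar> \<le> K3 * \<epsilon> * y\<^sup>2" using e3[of y] by (simp add: mult.assoc)
  qed simp
  also have "\<dots> \<le> K3 * \<epsilon> * (c * sv)" using B_sq_le c K \<delta> by (intro mult_left_mono) auto
  finally have 1: "\<bar>LINT y|\<kappa>. g (x + y) - g x - y * a - y\<^sup>2 / 2 * b\<bar> \<le> K3 * \<epsilon> * (c * sv)" .
  have i: "set_integrable \<nu> B (\<lambda>y. g (x + y) - g x - y * a)"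
    by (rule integrable_sq[where K=K2]) (use e2 \<delta> B_bounds in \<open>auto intro: order_trans\<close>)
  have i': "set_integrable \<nu> B (\<lambda>y. y\<^sup>2 / 2 * b)" using B_sq_integrable by simp
  have "(LINT y|\<kappa>. g (x + y) - g x - y * a - y\<^sup>2 / 2 * b)
      = (LINT y|\<kappa>. g (x + y) - g x - y * a) - c * ((LINT y:B|\<nu>. y\<^sup>2) / 2 * b)"
    using i i' by (simp add: kernel_integral set_integral_diff right_diff_distrib)
  also have "c * ((LINT y:B|\<nu>. y\<^sup>2) / 2 * b) = c * sv / 2 * b - c * small_jump_var \<nu> \<delta> / 2 * b"
    unfolding B_sq by (simp add: algebra_simps diff_divide_distrib)
  finally have 2: "(LINT y|\<kappa>. g (x + y) - g x - y * a) = (LINT y|\<kappa>. g (x + y) - g x - y * a - y\<^sup>2 / 2 * b)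
      + c * sv / 2 * b - c * small_jump_var \<nu> \<delta> / 2 * b" by simp
  have "\<bar>c * small_jump_var \<nu> \<delta> / 2 * b\<bar> \<le> c * small_jump_var \<nu> \<delta> / 2 * (2 * K2)"
    unfolding abs_mult using c b small_jump_var_nonneg[of \<delta>] by (intro mult_mono) auto
  also have "\<dots> = K2 * (c * small_jump_var \<nu> \<delta>)" by simp
  finally have 3: "\<bar>c * small_jump_var \<nu> \<delta> / 2 * b\<bar> \<le> K2 * (c * small_jump_var \<nu> \<delta>)" .
  have *: "\<bar>X - T\<bar> \<le> A1 + A2 + A3"
    if "X = P + I" "I = J + T - R" "\<bar>P\<bar> \<le> A1" "\<bar>J\<bar> \<le> A2" "\<bar>R\<bar> \<le> A3" for X T P I J R A1 A2 A3 :: real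
    using that by linarith
  show ?thesis by (rule *[OF small_step_expand 2 atom_term 1 3])
qed

end
end
end

section \<open>One Gaussian step\<close>

context
  fixes g :: "real \<Rightarrow> real" and x a b K2 K3 :: real
  assumes g: "test_fun g"
    and e2: "\<And>u. \<bar>g (x + u) - g x - u * a\<bar> \<le> K2 * u\<^sup>2"
    and e3: "\<And>u. \<bar>g (x + u) - g x - u * a - u\<^sup>2 / 2 * b\<bar> \<le> K3 * \<bar>u\<bar> ^ 3"
    and K: "0 \<le> K2" "0 \<le> K3"
begin

lemma gauss_integrable: "integrable lborel (\<lambda>z. std_normal_density z * g (x + s * z))"
proof -
  have [measurable]: "g \<in> borel_measurable borel" by (rule test_funD[OF g])
  show ?thesis
    by (rule Bochner_Integration.integrable_bound[of _ std_normal_density])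
       (auto simp: abs_mult intro!: mult_left_le test_funD[OF g])
qed

text \<open>The analogue of \<open>small_step_expand\<close>; here the linear term drops out because
  the first moment of the normal law vanishes.\<close>

lemma gauss_expand:
  "avg (gauss 0 s) g x - g x = (LINT z|lborel. std_normal_density z * (g (x + s * z) - g x - s * z * a))"
  "integrable lborel (\<lambda>z. std_normal_density z * (g (x + s * z) - g x - s * z * a))"
proof -
  let ?p = "std_normal_density"
  have i: "integrable lborel (\<lambda>z. ?p z * g x)" "integrable lborel (\<lambda>z. s * a * (?p z * z))"
    using integrable_std_normal_moment[of 1] by simp_all
  have eq: "?p z * (g (x + s * z) - g x - s * z * a) = ?p z * g (x + s * z) - ?p z * g x - s * a * (?p z * z)" for z
    by (simp add: algebra_simps)
  show "integrable lborel (\<lambda>z. ?p z * (g (x + s * z) - g x - s * z * a))"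
    unfolding eq using gauss_integrable i by simp
  show "avg (gauss 0 s) g x - g x = (LINT z|lborel. ?p z * (g (x + s * z) - g x - s * z * a))"
    unfolding eq avg_gauss[OF g] using gauss_integrable i integral_std_normal_moment_odd[of 0] by simp
qed

lemma gauss_step_2: "\<bar>avg (gauss 0 s) g x - g x\<bar> \<le> K2 * s\<^sup>2"
proof -
  let ?p = "std_normal_density"
  have i2: "integrable lborel (\<lambda>z. K2 * s\<^sup>2 * (?p z * z\<^sup>2))"
    using integrable_std_normal_moment[of 2] by simp
  have "\<bar>avg (gauss 0 s) g x - g x\<bar> \<le> (LINT z|lborel. \<bar>?p z * (g (x + s * z) - g x - s * z * a)\<bar>)"
    unfolding gauss_expand by (rule integral_abs_bound)
  also have "\<dots> \<le> (LINT z|lborel. K2 * s\<^sup>2 * (?p z * z\<^sup>2))"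
  proof (rule Bochner_Integration.integral_mono[OF integrable_abs[OF gauss_expand(2)[of s]] i2])
    fix z
    have "?p z * \<bar>g (x + s * z) - g x - s * z * a\<bar> \<le> ?p z * (K2 * (s * z)\<^sup>2)"
      by (intro mult_left_mono e2) simp
    then show "\<bar>?p z * (g (x + s * z) - g x - s * z * a)\<bar> \<le> K2 * s\<^sup>2 * (?p z * z\<^sup>2)"
      by (simp add: abs_mult power_mult_distrib mult_ac)
  qed
  also have "\<dots> = K2 * s\<^sup>2" using integral_std_normal_moment_even[of 1] by simp
  finally show ?thesis .
qed

text \<open>For s = sqrt \<tau> the error is of order \<tau>^(3/2). It vanishes in the limit even
  when multiplied by n, so the crude constant 2 does no harm.\<close>

lemma gauss_step_3:
  assumes "0 \<le> s"
  shows "\<bar>avg (gauss 0 s) g x - g x - s\<^sup>2 / 2 * b\<bar> \<le> K3 * (2 * s ^ 3)"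
proof -
  let ?p = "std_normal_density"
  have i2: "integrable lborel (\<lambda>z. s\<^sup>2 / 2 * b * (?p z * z\<^sup>2))"
    using integrable_std_normal_moment[of 2] by simp
  have i3: "integrable lborel (\<lambda>z. K3 * s ^ 3 * (?p z * \<bar>z\<bar> ^ 3))"
    using integrable_std_normal_moment_abs[of 3] by simp
  have eq: "?p z * (g (x + s * z) - g x - s * z * a - (s * z)\<^sup>2 / 2 * b)
      = ?p z * (g (x + s * z) - g x - s * z * a) - s\<^sup>2 / 2 * b * (?p z * z\<^sup>2)" for z
    by (simp add: algebra_simps power_mult_distrib)
  have i: "integrable lborel (\<lambda>z. ?p z * (g (x + s * z) - g x - s * z * a - (s * z)\<^sup>2 / 2 * b))"
    unfolding eq by (rule Bochner_Integration.integrable_diff[OF gauss_expand(2)[of s] i2])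
  have E: "avg (gauss 0 s) g x - g x - s\<^sup>2 / 2 * b
      = (LINT z|lborel. ?p z * (g (x + s * z) - g x - s * z * a - (s * z)\<^sup>2 / 2 * b))"
    unfolding eq Bochner_Integration.integral_diff[OF gauss_expand(2)[of s] i2] gauss_expand(1)[of s]
    using integral_std_normal_moment_even[of 1] by simp
  have "\<bar>avg (gauss 0 s) g x - g x - s\<^sup>2 / 2 * b\<bar>
      \<le> (LINT z|lborel. \<bar>?p z * (g (x + s * z) - g x - s * z * a - (s * z)\<^sup>2 / 2 * b)\<bar>)"
    unfolding E by (rule integral_abs_bound)
  also have "\<dots> \<le> (LINT z|lborel. K3 * s ^ 3 * (?p z * \<bar>z\<bar> ^ 3))"
  proof (rule Bochner_Integration.integral_mono)
    show "integrable lborel (\<lambda>z. \<bar>?p z * (g (x + s * z) - g x - s * z * a - (s * z)\<^sup>2 / 2 * b)\<bar>)"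
      using i by (rule integrable_abs)
    show "integrable lborel (\<lambda>z. K3 * s ^ 3 * (?p z * \<bar>z\<bar> ^ 3))" by (rule i3)
    fix z
    have "?p z * \<bar>g (x + s * z) - g x - s * z * a - (s * z)\<^sup>2 / 2 * b\<bar> \<le> ?p z * (K3 * \<bar>s * z\<bar> ^ 3)"
      by (intro mult_left_mono e3) simp
    then show "\<bar>?p z * (g (x + s * z) - g x - s * z * a - (s * z)\<^sup>2 / 2 * b)\<bar> \<le> K3 * s ^ 3 * (?p z * \<bar>z\<bar> ^ 3)"
      using assms by (simp add: abs_mult power_mult_distrib mult_ac)
  qed
  also have "\<dots> = K3 * s ^ 3 * (2 * sqrt (2 / pi))"
    using integral_std_normal_moment_abs_odd[of 1] by simp
  also have "\<dots> \<le> K3 * s ^ 3 * (2 * 1)"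
  proof -
    have "sqrt (2 / pi) \<le> sqrt 1" using pi_gt3 by (intro real_sqrt_le_mono) simp
    then show ?thesis using K assms by (intro mult_left_mono) auto
  qed
  also have "\<dots> = K3 * (2 * s ^ 3)" by simp
  finally show ?thesis .
qed

end

text \<open>Apart from the term for k = 0, this is a right-endpoint Riemann sum for the integral of
  d(s^2) / s^3 = 2 ds / s^2, which is at most 2 / s 0. The bound involves neither n nor the total
  variance n \<tau>.\<close>

lemma inverse_cube_sum:
  fixes s :: "nat \<Rightarrow> real"
  assumes pos: "\<And>k. 0 < s k" and sq: "\<And>k. (s (Suc k))\<^sup>2 = (s k)\<^sup>2 + \<tau>" and \<tau>: "0 \<le> \<tau>"
  shows "(\<Sum>k<n. \<tau> / s k ^ 3) \<le> \<tau> / s 0 ^ 3 + 2 / s 0"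
proof -
  have step: "\<tau> / s (Suc k) ^ 3 \<le> 2 / s k - 2 / s (Suc k)" for k
  proof -
    let ?a = "s k" and ?b = "s (Suc k)"
    have "?a\<^sup>2 \<le> ?b\<^sup>2" unfolding sq using \<tau> by simp
    then have ab: "?a \<le> ?b" by (rule power2_le_imp_le[OF _ less_imp_le[OF pos]])
    \<comment> \<open>Here \<tau> = (b - a) (b + a) and (b + a) a <= 2 b^2; dividing by a b^3 gives
      the telescoping bound.\<close>
    have "(?b - ?a) * ((?b + ?a) * ?a) \<le> (?b - ?a) * (2 * ?b\<^sup>2)"
    proof (rule mult_left_mono)
      have "(?b + ?a) * ?a \<le> (?b + ?b) * ?b" using ab pos[of k] by (intro mult_mono) auto
      then show "(?b + ?a) * ?a \<le> 2 * ?b\<^sup>2" by (simp add: power2_eq_square)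
    qed (use ab in simp)
    moreover have "(?b - ?a) * ((?b + ?a) * ?a) = \<tau> * ?a"
    proof -
      have "(?b - ?a) * (?b + ?a) = ?b\<^sup>2 - ?a\<^sup>2" by (simp add: power2_eq_square algebra_simps)
      also have "\<dots> = \<tau>" using sq[of k] by simp
      finally show ?thesis by (simp only: mult.assoc[symmetric])
    qed
    ultimately have "\<tau> * ?a / (?a * ?b ^ 3) \<le> (?b - ?a) * (2 * ?b\<^sup>2) / (?a * ?b ^ 3)"
      using pos[of k] pos[of "Suc k"] by (intro divide_right_mono) auto
    moreover have "\<tau> * ?a / (?a * ?b ^ 3) = \<tau> / ?b ^ 3" using pos[of k] by simp
    moreover have "(?b - ?a) * (2 * ?b\<^sup>2) / (?a * ?b ^ 3) = 2 / ?a - 2 / ?b"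
    proof -
      have "(b - a) * (2 * b\<^sup>2) / (a * b ^ 3) = 2 / a - 2 / b" if "0 < a" "0 < b" for a b :: real
        using that by (simp add: field_simps power2_eq_square power3_eq_cube)
      then show ?thesis using pos by blast
    qed
    ultimately show ?thesis by simp
  qed
  \<comment> \<open>\<open>step\<close> does not reach the term for k = 0, which therefore stands
    apart; the subtracted 2 / s n is what makes the induction telescope.\<close>
  have "(\<Sum>k<Suc n. \<tau> / s k ^ 3) \<le> \<tau> / s 0 ^ 3 + 2 / s 0 - 2 / s n" for n
  proof (induction n)
    case (Suc n)
    then show ?case using step[of n] by simp
  qed simp
  note * = this
  show ?thesis
  proof (cases n)
    case 0
    then show ?thesis using pos[of 0] \<tau> by simp
  next
    case (Suc m)
    have "0 \<le> 2 / s m" using pos[of m] by simp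
    with *[of m] show ?thesis unfolding Suc by linarith
  qed
qed

section \<open>Lindeberg replacement over n steps\<close>

context levy
begin

context
  fixes c \<delta> \<epsilon> \<sigma> m :: real and f :: "real \<Rightarrow> real"
  assumes \<delta>: "0 < \<delta>" "\<delta> \<le> \<epsilon>" "\<epsilon> \<le> 1" and c: "0 \<le> c"
    and small: "c * small_jump_var \<nu> \<epsilon> \<le> \<delta>\<^sup>2 / 2"
    and \<sigma>: "0 < \<sigma>" and f: "test_fun f"
begin

abbreviation (input) "\<tau> \<equiv> c * small_jump_var \<nu> \<epsilon>"
abbreviation (input) "\<eta> \<equiv> 4 * (c * small_jump_var \<nu> \<epsilon>)\<^sup>2 / \<delta>\<^sup>2"

text \<open>In the first bound the small step and the Gaussian of variance \<tau> are each compared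
  with not moving, which gives 2 \<tau>. In the second they are compared with the same quadratic
  expansion, whose terms \<tau> / 2 * b cancel.\<close>

lemma lindeberg_step:
  assumes s: "0 < s"
  shows "\<bar>avg (small_step \<nu> c \<delta> \<epsilon>) (avg (gauss m s) f) x - avg (gauss m (sqrt (s\<^sup>2 + \<tau>))) f x\<bar>
      \<le> (2 * \<tau> + \<eta>) / (2 * s\<^sup>2)" (is "?D \<le> _")
    and "\<bar>avg (small_step \<nu> c \<delta> \<epsilon>) (avg (gauss m s) f) x - avg (gauss m (sqrt (s\<^sup>2 + \<tau>))) f x\<bar>
      \<le> (\<eta> + c * small_jump_var \<nu> \<delta>) / (2 * s\<^sup>2) + (\<epsilon> * \<tau> + 2 * sqrt \<tau> ^ 3) / (2 * sqrt (2 * pi) * s ^ 3)"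
proof -
  let ?g = "avg (gauss m s) f"
  let ?K2 = "1 / (2 * s\<^sup>2)" and ?K3 = "1 / (2 * sqrt (2 * pi) * s ^ 3)"
  have g: "test_fun ?g" by (rule avg_test_fun[OF f real_distribution_gauss])
  have \<tau>: "0 \<le> \<tau>" using c small_jump_var_nonneg by simp
  obtain a b where ab: "\<And>u. \<bar>?g (x + u) - ?g x - u * a\<bar> \<le> u\<^sup>2 / (2 * s\<^sup>2)"
    "\<And>u. \<bar>?g (x + u) - ?g x - u * a - u\<^sup>2 / 2 * b\<bar> \<le> \<bar>u\<bar> ^ 3 / (2 * sqrt (2 * pi) * s ^ 3)"
    "\<bar>b\<bar> \<le> 1 / s\<^sup>2"
    using gauss_taylor_23[OF f s] by metis
  have e: "\<And>u. \<bar>?g (x + u) - ?g x - u * a\<bar> \<le> ?K2 * u\<^sup>2"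
    "\<And>u. \<bar>?g (x + u) - ?g x - u * a - u\<^sup>2 / 2 * b\<bar> \<le> ?K3 * \<bar>u\<bar> ^ 3"
    "\<bar>b\<bar> \<le> 2 * ?K2" "0 \<le> ?K2" "0 \<le> ?K3"
    using ab s by simp_all
  note S2 = small_step_2[OF \<delta> c small g e]
  note S3 = small_step_3[OF \<delta> c small g e]
  note G2 = gauss_step_2[OF g e(1,2,4,5), of "sqrt \<tau>"]
  note G3 = gauss_step_3[OF g e(1,2,4,5) real_sqrt_ge_zero[OF \<tau>]]
  \<comment> \<open>Enlarging the smoothing scale amounts to one more Gaussian step of variance
    \<tau>.\<close>
  have G: "avg (gauss m (sqrt (s\<^sup>2 + \<tau>))) f x = avg (gauss 0 (sqrt \<tau>)) ?g x"
    using \<tau> by (simp add: avg_gauss_gauss[OF f] add.commute)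
  have "?D \<le> ?K2 * \<eta> + ?K2 * \<tau> + ?K2 * \<tau>"
    unfolding G using S2 G2 \<tau> by (simp only: real_sqrt_pow2, linarith?)
  also have "\<dots> = (2 * \<tau> + \<eta>) / (2 * s\<^sup>2)" by (simp add: add_divide_distrib)
  finally show "?D \<le> (2 * \<tau> + \<eta>) / (2 * s\<^sup>2)" .
  have "?D \<le> ?K2 * \<eta> + ?K3 * \<epsilon> * \<tau> + ?K2 * (c * small_jump_var \<nu> \<delta>) + ?K3 * (2 * sqrt \<tau> ^ 3)"
    unfolding G using S3 G3 \<tau> by (simp only: real_sqrt_pow2, linarith?)
  also have "\<dots> = (\<eta> + c * small_jump_var \<nu> \<delta>) / (2 * s\<^sup>2) + (\<epsilon> * \<tau> + 2 * sqrt \<tau> ^ 3) / (2 * sqrt (2 * pi) * s ^ 3)"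
    by (simp add: add_divide_distrib)
  finally show "?D \<le> (\<eta> + c * small_jump_var \<nu> \<delta>) / (2 * s\<^sup>2) + (\<epsilon> * \<tau> + 2 * sqrt \<tau> ^ 3) / (2 * sqrt (2 * pi) * s ^ 3)" .
qed

text \<open>In the third bound the main term is \<epsilon> / (2 sqrt (2 pi)) times the 2 / \<sigma>
  of \<open>inverse_cube_sum\<close>; the bracket collects the remainders that vanish along the
  walks.\<close>

lemma lindeberg:
  fixes n :: nat
  defines "D x \<equiv> \<bar>(avg (small_step \<nu> c \<delta> \<epsilon>) ^^ n) (avg (gauss m \<sigma>) f) x - avg (gauss m (sqrt (\<sigma>\<^sup>2 + n * \<tau>))) f x\<bar>"
  shows "D x \<le> 1"
    and "D x \<le> n * (2 * \<tau> + \<eta>) / (2 * \<sigma>\<^sup>2)"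
    and "D x \<le> \<epsilon> / (sqrt (2 * pi) * \<sigma>) + (n * (\<eta> + c * small_jump_var \<nu> \<delta>) / (2 * \<sigma>\<^sup>2)
        + (\<epsilon> * \<tau> + 2 * n * sqrt \<tau> ^ 3) / (2 * sqrt (2 * pi) * \<sigma> ^ 3))"
proof -
  define s where "s k = sqrt (\<sigma>\<^sup>2 + real k * \<tau>)" for k :: nat
  have \<tau>: "0 \<le> \<tau>" using c small_jump_var_nonneg by simp
  have s0: "s 0 = \<sigma>" using \<sigma> by (simp add: s_def)
  have s_ge: "\<sigma> \<le> s k" for k
    unfolding s_def using \<sigma> \<tau> by (intro real_le_rsqrt) auto
  have s_pos: "0 < s k" for k using s_ge[of k] \<sigma> by linarith
  have s_sq: "(s k)\<^sup>2 = \<sigma>\<^sup>2 + real k * \<tau>" for k unfolding s_def using \<tau> by simp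
  have s_Suc: "s (Suc k) = sqrt ((s k)\<^sup>2 + \<tau>)" for k
    unfolding s_sq by (simp add: s_def algebra_simps)
  define g where "g k = avg (gauss m (s k)) f" for k
  have g: "test_fun (g k)" for k unfolding g_def by (rule avg_test_fun[OF f real_distribution_gauss])
  have S: "real_distribution (small_step \<nu> c \<delta> \<epsilon>)"
    by (rule real_distribution_small_step[OF \<delta> c small])
  have D: "D x = \<bar>(avg (small_step \<nu> c \<delta> \<epsilon>) ^^ n) (g 0) x - g n x\<bar>"
    unfolding D_def g_def s0 by (simp add: s_def)
  have "0 \<le> (avg (small_step \<nu> c \<delta> \<epsilon>) ^^ n) (g 0) x" "(avg (small_step \<nu> c \<delta> \<epsilon>) ^^ n) (g 0) x \<le> 1"
    by (intro test_funD avg_pow_test_fun[OF g S])+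
  then show "D x \<le> 1" unfolding D using test_funD(2,3)[OF g[of n], of x] by linarith
  have sq_le: "\<sigma>\<^sup>2 \<le> (s k)\<^sup>2" "\<sigma> ^ 3 \<le> s k ^ 3" for k
    using s_ge[of k] \<sigma> by (intro power_mono; simp)+
  have \<eta>: "0 \<le> \<eta>" by simp
  have sv\<delta>: "0 \<le> c * small_jump_var \<nu> \<delta>" using c small_jump_var_nonneg by simp
  have "D x \<le> (\<Sum>k<n. (2 * \<tau> + \<eta>) / (2 * \<sigma>\<^sup>2))"
    unfolding D
  proof (rule avg_telescope[OF S g])
    fix k y
    have "\<bar>avg (small_step \<nu> c \<delta> \<epsilon>) (g k) y - g (Suc k) y\<bar> \<le> (2 * \<tau> + \<eta>) / (2 * (s k)\<^sup>2)"
      unfolding g_def s_Suc by (rule lindeberg_step(1)[OF s_pos])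
    also have "\<dots> \<le> (2 * \<tau> + \<eta>) / (2 * \<sigma>\<^sup>2)"
      using sq_le(1)[of k] \<tau> \<eta> \<sigma> s_pos[of k] by (intro divide_left_mono) auto
    finally show "\<bar>avg (small_step \<nu> c \<delta> \<epsilon>) (g k) y - g (Suc k) y\<bar> \<le> (2 * \<tau> + \<eta>) / (2 * \<sigma>\<^sup>2)" .
  qed
  then show "D x \<le> n * (2 * \<tau> + \<eta>) / (2 * \<sigma>\<^sup>2)" by simp
  let ?P = "2 * sqrt (2 * pi)"
  \<comment> \<open>Only the last summand keeps the growing scale \<open>s k\<close>; the others are
    negligible already at scale \<sigma>.\<close>
  let ?e = "\<lambda>k. (\<eta> + c * small_jump_var \<nu> \<delta>) / (2 * \<sigma>\<^sup>2) + 2 * sqrt \<tau> ^ 3 / (?P * \<sigma> ^ 3) + \<epsilon> / ?P * (\<tau> / s k ^ 3)"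
  have "D x \<le> (\<Sum>k<n. ?e k)"
    unfolding D
  proof (rule avg_telescope[OF S g])
    fix k y
    have "\<bar>avg (small_step \<nu> c \<delta> \<epsilon>) (g k) y - g (Suc k) y\<bar>
        \<le> (\<eta> + c * small_jump_var \<nu> \<delta>) / (2 * (s k)\<^sup>2) + (\<epsilon> * \<tau> + 2 * sqrt \<tau> ^ 3) / (?P * s k ^ 3)"
      unfolding g_def s_Suc by (rule lindeberg_step(2)[OF s_pos])
    also have "(\<epsilon> * \<tau> + 2 * sqrt \<tau> ^ 3) / (?P * s k ^ 3) = 2 * sqrt \<tau> ^ 3 / (?P * s k ^ 3) + \<epsilon> / ?P * (\<tau> / s k ^ 3)"
      by (simp add: add_divide_distrib)
    also have "(\<eta> + c * small_jump_var \<nu> \<delta>) / (2 * (s k)\<^sup>2) + (2 * sqrt \<tau> ^ 3 / (?P * s k ^ 3) + \<epsilon> / ?P * (\<tau> / s k ^ 3)) \<le> ?e k"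
    proof -
      have "(\<eta> + c * small_jump_var \<nu> \<delta>) / (2 * (s k)\<^sup>2) \<le> (\<eta> + c * small_jump_var \<nu> \<delta>) / (2 * \<sigma>\<^sup>2)"
        using sq_le(1)[of k] \<eta> sv\<delta> \<sigma> s_pos[of k] by (intro divide_left_mono) auto
      moreover have "2 * sqrt \<tau> ^ 3 / (?P * s k ^ 3) \<le> 2 * sqrt \<tau> ^ 3 / (?P * \<sigma> ^ 3)"
        using sq_le(2)[of k] \<tau> \<sigma> s_pos[of k] by (intro divide_left_mono mult_left_mono mult_pos_pos) auto
      ultimately show ?thesis by linarith
    qed
    finally show "\<bar>avg (small_step \<nu> c \<delta> \<epsilon>) (g k) y - g (Suc k) y\<bar> \<le> ?e k" .
  qed
  also have "\<dots> = n * ((\<eta> + c * small_jump_var \<nu> \<delta>) / (2 * \<sigma>\<^sup>2)) + n * (2 * sqrt \<tau> ^ 3 / (?P * \<sigma> ^ 3))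
      + \<epsilon> / ?P * (\<Sum>k<n. \<tau> / s k ^ 3)"
    by (simp only: sum.distrib sum_constant card_lessThan sum_distrib_left)
  also have "\<dots> \<le> n * ((\<eta> + c * small_jump_var \<nu> \<delta>) / (2 * \<sigma>\<^sup>2)) + n * (2 * sqrt \<tau> ^ 3 / (?P * \<sigma> ^ 3))
      + \<epsilon> / ?P * (\<tau> / \<sigma> ^ 3 + 2 / \<sigma>)"
  proof -
    have "(\<Sum>k<n. \<tau> / s k ^ 3) \<le> \<tau> / \<sigma> ^ 3 + 2 / \<sigma>"
      using inverse_cube_sum[of s \<tau> n] s_pos \<tau> s0 by (simp add: s_sq algebra_simps)
    then have "\<epsilon> / ?P * (\<Sum>k<n. \<tau> / s k ^ 3) \<le> \<epsilon> / ?P * (\<tau> / \<sigma> ^ 3 + 2 / \<sigma>)"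
      using \<delta> by (intro mult_left_mono) auto
    then show ?thesis by simp
  qed
  also have "\<dots> = \<epsilon> / (sqrt (2 * pi) * \<sigma>) + (n * (\<eta> + c * small_jump_var \<nu> \<delta>) / (2 * \<sigma>\<^sup>2)
        + (\<epsilon> * \<tau> + 2 * n * sqrt \<tau> ^ 3) / (?P * \<sigma> ^ 3))"
    by (simp add: add_divide_distrib distrib_left)
  finally show "D x \<le> \<epsilon> / (sqrt (2 * pi) * \<sigma>) + (n * (\<eta> + c * small_jump_var \<nu> \<delta>) / (2 * \<sigma>\<^sup>2)
        + (\<epsilon> * \<tau> + 2 * n * sqrt \<tau> ^ 3) / (?P * \<sigma> ^ 3))" .
qed

end
end

subsection \<open>Convergence of the random walks\<close>

text \<open>No complex logarithm is involved: c k is compared with w = exp (z / n), and n-th powers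
  of two numbers in the unit disc differ by at most n times their distance. That w lies in the disc
  follows from Re z <= 0, which is inherited from |c k| <= 1 in the limit.\<close>

lemma power_tendsto_exp:
  fixes c :: "nat \<Rightarrow> complex" and n :: "nat \<Rightarrow> nat"
  assumes n: "filterlim n at_top sequentially" and c: "eventually (\<lambda>k. norm (c k) \<le> 1) sequentially"
    and lim: "(\<lambda>k. of_nat (n k) * (c k - 1)) \<longlonglongrightarrow> z"
  shows "(\<lambda>k. c k ^ n k) \<longlonglongrightarrow> exp z"
proof -
  have npos: "eventually (\<lambda>k. 0 < n k) sequentially"
    using eventually_compose_filterlim[OF eventually_gt_at_top[of 0] n] .
  have inv: "(\<lambda>k. 1 / real (n k)) \<longlonglongrightarrow> 0"
    using tendsto_inverse_0_at_top[OF filterlim_compose[OF filterlim_real_sequentially n]]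
    by (simp add: inverse_eq_divide)
  have Rez: "Re z \<le> 0"
  proof (rule tendsto_upperbound)
    show "(\<lambda>k. Re (of_nat (n k) * (c k - 1))) \<longlonglongrightarrow> Re z" by (intro tendsto_Re lim)
    show "eventually (\<lambda>k. Re (of_nat (n k) * (c k - 1)) \<le> 0) sequentially"
      using c
    proof eventually_elim
      case (elim k)
      then have "Re (c k) \<le> 1" using complex_Re_le_cmod[of "c k"] by linarith
      then show ?case by (simp add: mult_nonneg_nonpos)
    qed
  qed simp
  define w where "w k = exp (z / of_nat (n k))" for k
  have w1: "norm (w k) \<le> 1" for k
    using Rez by (simp add: w_def Re_divide_of_nat divide_nonpos_nonneg)
  have wlim: "(\<lambda>k. of_nat (n k) * (w k - 1)) \<longlonglongrightarrow> z"
  proof (rule Lim_transform2)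
    show "(\<lambda>k. z) \<longlonglongrightarrow> z" by simp
    have "(\<lambda>k. exp (norm z) * (norm z)\<^sup>2 * (1 / real (n k))) \<longlonglongrightarrow> exp (norm z) * (norm z)\<^sup>2 * 0"
      by (intro tendsto_intros inv)
    then have 0: "(\<lambda>k. exp (norm z) * (norm z)\<^sup>2 * (1 / real (n k))) \<longlonglongrightarrow> 0" by simp
    show "(\<lambda>k. z - of_nat (n k) * (w k - 1)) \<longlonglongrightarrow> 0"
    proof (rule Lim_null_comparison[OF _ 0])
      show "eventually (\<lambda>k. norm (z - of_nat (n k) * (w k - 1)) \<le> exp (norm z) * (norm z)\<^sup>2 * (1 / real (n k))) sequentially"
        using npos
      proof eventually_elim
        case (elim k)
        let ?n = "of_nat (n k) :: complex" and ?r = "real (n k)"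
        have "norm (w k - 1 - z / ?n) \<le> exp \<bar>Re (z / ?n)\<bar> * (norm (z / ?n))\<^sup>2"
          using Taylor_exp[of "z / ?n" 1] by (simp add: w_def diff_diff_eq power2_eq_square)
        also have "\<dots> \<le> exp (norm z) * (norm (z / ?n))\<^sup>2"
        proof -
          have "\<bar>Re (z / ?n)\<bar> \<le> norm (z / ?n)" by (rule abs_Re_le_cmod)
          also have "\<dots> \<le> norm z / 1" unfolding norm_divide using elim by (intro divide_left_mono) auto
          finally show ?thesis by (intro mult_right_mono) auto
        qed
        finally have "?r * norm (w k - 1 - z / ?n) \<le> ?r * (exp (norm z) * (norm (z / ?n))\<^sup>2)"
          by (intro mult_left_mono) auto
        moreover have "norm (z - ?n * (w k - 1)) = ?r * norm (w k - 1 - z / ?n)"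
        proof -
          have "z - ?n * (w k - 1) = - (?n * (w k - 1 - z / ?n))" using elim by (simp add: algebra_simps)
          then show ?thesis by (simp only: norm_minus_cancel norm_mult norm_of_nat)
        qed
        moreover have "?r * (exp (norm z) * (norm (z / ?n))\<^sup>2) = exp (norm z) * (norm z)\<^sup>2 * (1 / ?r)"
          using elim by (simp add: norm_divide power_divide power2_eq_square)
        ultimately show ?case by simp
      qed
    qed
  qed
  show ?thesis
  proof (rule Lim_transform2)
    have "eventually (\<lambda>k. w k ^ n k = exp z) sequentially"
      using npos by eventually_elim (simp add: w_def exp_of_nat_mult[symmetric])
    then show "(\<lambda>k. w k ^ n k) \<longlonglongrightarrow> exp z" by (rule tendsto_eventually)
    have "(\<lambda>k. of_nat (n k) * (w k - 1) - of_nat (n k) * (c k - 1)) \<longlonglongrightarrow> z - z"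
      by (intro tendsto_diff wlim lim)
    then have 0: "(\<lambda>k. norm (of_nat (n k) * (w k - 1) - of_nat (n k) * (c k - 1))) \<longlonglongrightarrow> 0"
      by (intro tendsto_norm_zero) simp
    show "(\<lambda>k. w k ^ n k - c k ^ n k) \<longlonglongrightarrow> 0"
    proof (rule Lim_null_comparison[OF _ 0])
      show "eventually (\<lambda>k. norm (w k ^ n k - c k ^ n k) \<le> norm (of_nat (n k) * (w k - 1) - of_nat (n k) * (c k - 1))) sequentially"
        using c
      proof eventually_elim
        case (elim k)
        have "norm (w k ^ n k - c k ^ n k) \<le> real (n k) * norm (w k - c k)"
          by (rule norm_power_diff[OF w1 elim])
        also have "\<dots> = norm (of_nat (n k) * (w k - 1) - of_nat (n k) * (c k - 1))"
        proof -
          have "of_nat (n k) * (w k - 1) - of_nat (n k) * (c k - 1) = of_nat (n k) * (w k - c k)"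
            by (simp add: algebra_simps)
          then show ?thesis by (simp only: norm_mult norm_of_nat)
        qed
        finally show ?case .
      qed
    qed
  qed
qed

lemma iexp_1_bound: "norm (iexp x - 1) \<le> 2"
  using norm_triangle_ineq4[of "iexp x" 1] by simp

lemma iexp_2_bound: "norm (iexp x - 1 - \<i> * of_real x) \<le> x\<^sup>2 / 2"
  using iexp_approx1[of x 1] by (simp add: diff_diff_eq power2_eq_square numeral_2_eq_2)

text \<open>With \<open>n = K\<^sup>3\<close> steps and jumps below \<open>1 / K\<close> discarded, both the probability of a jump in one step
  and \<open>n\<close> times the squared position of the atom vanish as \<open>K \<rightarrow> \<infinity>\<close>, although
  \<open>\<nu>\<close> may be infinite near \<open>0\<close>.\<close>

definition nsteps :: "nat \<Rightarrow> nat" where "nsteps k = Suc k ^ 3"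
definition rate :: "real \<Rightarrow> nat \<Rightarrow> real" where "rate t k = t / real (nsteps k)"
definition cutoff :: "nat \<Rightarrow> real" where "cutoff k = 1 / real (Suc k)"

lemma cutoff_pos: "0 < cutoff k" by (simp add: cutoff_def)

lemma cutoff_tendsto: "cutoff \<longlonglongrightarrow> 0"
  unfolding cutoff_def[abs_def] using LIMSEQ_inverse_real_of_nat by (simp add: inverse_eq_divide)

lemma rate_nsteps: "real (nsteps k) * rate t k = t"
  by (simp add: rate_def nsteps_def)

lemma rate_eq: "rate t k = t * cutoff k ^ 3"
  by (simp add: rate_def nsteps_def cutoff_def power_divide)

lemma nsteps_cutoff: "real (nsteps k) = 1 / cutoff k ^ 3"
  by (simp add: nsteps_def cutoff_def power_divide)

lemma nsteps_at_top: "filterlim nsteps at_top sequentially"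
proof (rule filterlim_at_top_mono[OF filterlim_Suc])
  show "eventually (\<lambda>k. Suc k \<le> nsteps k) sequentially"
    by (intro always_eventually allI) (simp add: nsteps_def self_le_power)
qed

context levy
begin

lemma small_jump_var_cutoff: "(\<lambda>k. small_jump_var \<nu> (cutoff k)) \<longlonglongrightarrow> 0"
proof -
  have "(\<lambda>k. LINT x|\<nu>. indicator {x. \<bar>x\<bar> \<le> cutoff k} x *\<^sub>R x\<^sup>2) \<longlonglongrightarrow> (LINT x|\<nu>. 0)"
  proof (rule integral_dominated_convergence[where w="\<lambda>x. indicator {x. \<bar>x\<bar> \<le> 1} x *\<^sub>R x\<^sup>2"])
    show "integrable \<nu> (\<lambda>x. indicator {x. \<bar>x\<bar> \<le> 1} x *\<^sub>R x\<^sup>2)"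
      using sq_integrable[of 1] by (simp add: set_integrable_def)
    show "AE x in \<nu>. (\<lambda>k. indicator {x. \<bar>x\<bar> \<le> cutoff k} x *\<^sub>R x\<^sup>2) \<longlonglongrightarrow> 0"
    proof (intro AE_I2 tendsto_eventually)
      fix x :: real
      show "eventually (\<lambda>k. indicator {x. \<bar>x\<bar> \<le> cutoff k} x *\<^sub>R x\<^sup>2 = 0) sequentially"
      \<comment> \<open>The point 0 belongs to all these sets, but contributes x^2 = 0.\<close>
      proof (cases "x = 0")
        case False
        then have "eventually (\<lambda>k. cutoff k < \<bar>x\<bar>) sequentially"
          using order_tendstoD(2)[OF cutoff_tendsto] by simp
        then show ?thesis by eventually_elim simp
      qed simp
    qed
    have "cutoff k \<le> 1" for k by (simp add: cutoff_def)
    then show "AE x in \<nu>. norm (indicator {x. \<bar>x\<bar> \<le> cutoff k} x *\<^sub>R x\<^sup>2) \<le> indicator {x. \<bar>x\<bar> \<le> 1} x *\<^sub>R x\<^sup>2" for k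
      by (intro AE_I2) (auto split: split_indicator intro: order_trans)
  qed (measurable, measurable)
  then show ?thesis by (simp add: small_jump_var_def set_lebesgue_integral_def)
qed

context
  fixes t \<epsilon> :: real
  assumes t: "0 < t" and \<epsilon>: "0 < \<epsilon>" "\<epsilon> \<le> 1"
begin

text \<open>The conditions under which the steps are known to be probability measures and the
  one-step estimates apply. They hold only from some k on, so later claims are made for admissible
  or for large k.\<close>

definition admissible :: "nat \<Rightarrow> bool" where
  "admissible k \<longleftrightarrow> cutoff k \<le> \<epsilon> \<and> rate t k * small_jump_var \<nu> \<epsilon> \<le> (cutoff k)\<^sup>2 / 2 \<and> rate t k * jump_intensity \<nu> \<epsilon> \<le> 1"

lemma eventually_admissible: "eventually admissible sequentially"
proof -
  have "(\<lambda>k. cutoff k * (t * small_jump_var \<nu> \<epsilon>)) \<longlonglongrightarrow> 0 * (t * small_jump_var \<nu> \<epsilon>)"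
    by (intro tendsto_intros cutoff_tendsto)
  then have 1: "eventually (\<lambda>k. cutoff k * (t * small_jump_var \<nu> \<epsilon>) < 1 / 2) sequentially"
    by (intro order_tendstoD) auto
  have "(\<lambda>k. t * cutoff k ^ 3 * jump_intensity \<nu> \<epsilon>) \<longlonglongrightarrow> t * 0 ^ 3 * jump_intensity \<nu> \<epsilon>"
    by (intro tendsto_intros cutoff_tendsto)
  then have 2: "eventually (\<lambda>k. t * cutoff k ^ 3 * jump_intensity \<nu> \<epsilon> < 1) sequentially"
    by (intro order_tendstoD) auto
  have 3: "eventually (\<lambda>k. cutoff k < \<epsilon>) sequentially"
    by (rule order_tendstoD(2)[OF cutoff_tendsto \<epsilon>(1)])
  show ?thesis using 1 2 3
  proof eventually_elim
    case (elim k)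
    \<comment> \<open>The rate is t times the cube of the cut-off: two factors match the required
      square, the third makes the rest small.\<close>
    have "(cutoff k)\<^sup>2 * (cutoff k * (t * small_jump_var \<nu> \<epsilon>)) \<le> (cutoff k)\<^sup>2 * (1 / 2)"
      using elim(1) by (intro mult_left_mono) auto
    moreover have "(cutoff k)\<^sup>2 * (cutoff k * (t * small_jump_var \<nu> \<epsilon>)) = rate t k * small_jump_var \<nu> \<epsilon>"
      by (simp add: rate_eq power2_eq_square power3_eq_cube)
    ultimately show ?case using elim by (simp add: admissible_def rate_eq)
  qed
qed

abbreviation (input) "Sk k \<equiv> small_step \<nu> (rate t k) (cutoff k) \<epsilon>"
abbreviation (input) "Qk k \<equiv> jump_step (scaled_restr (rate t k) {x. \<epsilon> < \<bar>x\<bar>} \<nu>) 0"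

lemma rate_nonneg: "0 \<le> rate t k" using t by (simp add: rate_def)

lemma admissibleD:
  assumes "admissible k"
  shows "0 < cutoff k" "cutoff k \<le> \<epsilon>" "\<epsilon> \<le> 1" "0 \<le> rate t k"
    "rate t k * small_jump_var \<nu> \<epsilon> \<le> (cutoff k)\<^sup>2 / 2" "rate t k * jump_intensity \<nu> \<epsilon> \<le> 1"
  using assms cutoff_pos \<epsilon> rate_nonneg by (auto simp: admissible_def)

lemma real_distribution_Sk: "admissible k \<Longrightarrow> real_distribution (Sk k)"
  by (rule real_distribution_small_step[OF admissibleD(1-5)])

lemma real_distribution_Qk: "admissible k \<Longrightarrow> real_distribution (Qk k)"
  by (rule jump_kernel.real_distribution_jump_step[OF jump_kernel_big[OF \<epsilon> admissibleD(4,6)]])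

text \<open>Exponent of the compound Poisson part, without compensator; \<open>zS\<close> is that of
  the compensated small jumps.\<close>

definition zB :: "real \<Rightarrow> complex" where
  "zB u = (CLINT x:{x. \<epsilon> < \<bar>x\<bar>}|\<nu>. iexp (u * x) - 1)"

definition zS :: "real \<Rightarrow> complex" where
  "zS u = (CLINT x:{x. \<bar>x\<bar> \<le> \<epsilon>}|\<nu>. iexp (u * x) - 1 - \<i> * of_real (u * x))"

text \<open>The atom of this step sits at 0, so n (char - 1) equals t times \<open>zB u\<close>
  exactly as soon as k is admissible.\<close>

lemma char_Qk_limit: "(\<lambda>k. char (Qk k) u ^ nsteps k) \<longlonglongrightarrow> exp (of_real t * zB u)"
proof (rule power_tendsto_exp[OF nsteps_at_top])
  show "eventually (\<lambda>k. norm (char (Qk k) u) \<le> 1) sequentially"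
    using eventually_admissible
    by eventually_elim (rule real_distribution.cmod_char_le_1[OF real_distribution_Qk])
  have "eventually (\<lambda>k. of_nat (nsteps k) * (char (Qk k) u - 1) = of_real t * zB u) sequentially"
    using eventually_admissible
  proof eventually_elim
    case (elim k)
    interpret jump_kernel "scaled_restr (rate t k) {x. \<epsilon> < \<bar>x\<bar>} \<nu>"
      by (rule jump_kernel_big[OF \<epsilon> admissibleD(4,6)[OF elim]])
    have "char (Qk k) u - 1 = of_real (rate t k) * zB u"
      using char_jump_step[of 0 u] rate_nonneg
      by (simp add: integral_scaled_restr zB_def scaleR_conv_of_real)
    moreover have "of_nat (nsteps k) * (of_real (rate t k) * zB u) = of_real (real (nsteps k) * rate t k) * zB u"
      by simp
    ultimately show ?case by (simp only: rate_nsteps)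
  qed
  then show "(\<lambda>k. of_nat (nsteps k) * (char (Qk k) u - 1)) \<longlonglongrightarrow> of_real t * zB u"
    by (rule tendsto_eventually)
qed

lemma zS_limit:
  "(\<lambda>k. CLINT x:mid_jumps (cutoff k) \<epsilon>|\<nu>. iexp (u * x) - 1 - \<i> * of_real (u * x)) \<longlonglongrightarrow> zS u"
  unfolding zS_def set_lebesgue_integral_def
proof (rule integral_dominated_convergence[where w="\<lambda>x. indicator {x. \<bar>x\<bar> \<le> \<epsilon>} x *\<^sub>R (u\<^sup>2 / 2 * x\<^sup>2)"])
  have b: "norm (iexp (u * x) - 1 - \<i> * of_real (u * x)) \<le> u\<^sup>2 / 2 * x\<^sup>2" for x
    using iexp_2_bound[of "u * x"] by (simp add: power_mult_distrib)
  show "integrable \<nu> (\<lambda>x. indicator {x. \<bar>x\<bar> \<le> \<epsilon>} x *\<^sub>R (u\<^sup>2 / 2 * x\<^sup>2))"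
    using integrable_mult_right[OF sq_integrable[OF \<epsilon>(2), unfolded set_integrable_def], of "u\<^sup>2 / 2"]
    by (simp add: mult.left_commute)
  show "AE x in \<nu>. norm (indicat_real (mid_jumps (cutoff k) \<epsilon>) x *\<^sub>R (iexp (u * x) - 1 - \<i> * of_real (u * x)))
      \<le> indicator {x. \<bar>x\<bar> \<le> \<epsilon>} x *\<^sub>R (u\<^sup>2 / 2 * x\<^sup>2)" for k
    using b by (intro AE_I2) (auto simp: mid_jumps_def split: split_indicator)
  show "AE x in \<nu>. (\<lambda>k. indicat_real (mid_jumps (cutoff k) \<epsilon>) x *\<^sub>R (iexp (u * x) - 1 - \<i> * of_real (u * x)))
      \<longlonglongrightarrow> indicat_real {x. \<bar>x\<bar> \<le> \<epsilon>} x *\<^sub>R (iexp (u * x) - 1 - \<i> * of_real (u * x))"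
  proof (intro AE_I2 tendsto_eventually)
    fix x :: real
    show "eventually (\<lambda>k. indicat_real (mid_jumps (cutoff k) \<epsilon>) x *\<^sub>R (iexp (u * x) - 1 - \<i> * of_real (u * x))
        = indicat_real {x. \<bar>x\<bar> \<le> \<epsilon>} x *\<^sub>R (iexp (u * x) - 1 - \<i> * of_real (u * x))) sequentially"
    \<comment> \<open>No set \<open>mid_jumps\<close> contains 0, but the integrand vanishes
      there.\<close>
    proof (cases "x = 0")
      case False
      then have "eventually (\<lambda>k. cutoff k < \<bar>x\<bar>) sequentially"
        using order_tendstoD(2)[OF cutoff_tendsto] by simp
      then show ?thesis by eventually_elim (simp add: mid_jumps_def indicator_def)
    qed simp
  qed
qed (measurable, measurable)

text \<open>As the step is centred, the compensator \<i> u x may be inserted both under the kernel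
  and at the atom a. The kernel part tends to the exponent; the atom part is at most n (u a)^2 / 2,
  which vanishes by \<open>atom_sq\<close>.\<close>

lemma char_Sk_limit: "(\<lambda>k. char (Sk k) u ^ nsteps k) \<longlonglongrightarrow> exp (of_real t * zS u)"
proof (rule power_tendsto_exp[OF nsteps_at_top])
  show "eventually (\<lambda>k. norm (char (Sk k) u) \<le> 1) sequentially"
    using eventually_admissible
    by eventually_elim (rule real_distribution.cmod_char_le_1[OF real_distribution_Sk])
  let ?I = "\<lambda>k. CLINT x:mid_jumps (cutoff k) \<epsilon>|\<nu>. iexp (u * x) - 1 - \<i> * of_real (u * x)"
  \<comment> \<open>With d = \<open>cutoff k\<close>, n = 1 / d^3 and rate t d^3, the product of n
    u^2 / 2 and the bound of \<open>atom_sq\<close> leaves a single factor d.\<close>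
  let ?C = "2 * u\<^sup>2 * t\<^sup>2 * (small_jump_var \<nu> \<epsilon>)\<^sup>2"
  have lim: "(\<lambda>k. of_real t * ?I k) \<longlonglongrightarrow> of_real t * zS u"
    by (intro tendsto_intros zS_limit)
  have "(\<lambda>k. ?C * cutoff k) \<longlonglongrightarrow> ?C * 0" by (intro tendsto_intros cutoff_tendsto)
  then have 0: "(\<lambda>k. ?C * cutoff k) \<longlonglongrightarrow> 0" by simp
  show "(\<lambda>k. of_nat (nsteps k) * (char (Sk k) u - 1)) \<longlonglongrightarrow> of_real t * zS u"
  proof (rule Lim_transform2[OF lim], rule Lim_null_comparison[OF _ 0])
    show "eventually (\<lambda>k. norm (of_real t * ?I k - of_nat (nsteps k) * (char (Sk k) u - 1)) \<le> ?C * cutoff k) sequentially"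
      using eventually_admissible
    proof eventually_elim
      case (elim k)
      note F = admissibleD[OF elim]
      let ?B = "mid_jumps (cutoff k) \<epsilon>" and ?c = "rate t k"
      let ?q = "1 - ?c * measure \<nu> ?B" and ?a = "atom (rate t k) (cutoff k) \<epsilon>"
      interpret jump_kernel "scaled_restr ?c ?B \<nu>" by (rule jump_kernel_small[OF F(1-5)])
      have i1: "set_integrable \<nu> ?B (\<lambda>x. iexp (u * x) - 1)"
        by (rule set_integrable_B[OF F(1-5), of _ 2], measurable, rule iexp_1_bound)
      have i2: "set_integrable \<nu> ?B (\<lambda>x. x)"
        by (rule set_integrable_B[OF F(1-5), of _ \<epsilon>]) (auto simp: mid_jumps_def)
      have i3: "set_integrable \<nu> ?B (\<lambda>x. \<i> * complex_of_real (u * x))"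
        by (rule set_integrable_B[OF F(1-5), of _ "\<bar>u\<bar> * \<epsilon>"])
           (auto simp: mid_jumps_def norm_mult intro!: mult_left_mono)
      have "(CLINT x:?B|\<nu>. \<i> * complex_of_real (u * x)) = \<i> * of_real u * of_real (m1 (cutoff k) \<epsilon>)"
        unfolding m1_def[OF F(1-5)] set_integral_complex_of_real[symmetric] by (simp add: mult.assoc)
      then have I: "?I k = (CLINT x:?B|\<nu>. iexp (u * x) - 1) - \<i> * of_real u * of_real (m1 (cutoff k) \<epsilon>)"
        using set_integral_diff(2)[OF i1 i3] by simp
      have "char (Sk k) u - 1 = of_real ?q * (iexp (u * ?a) - 1) + of_real ?c * (CLINT x:?B|\<nu>. iexp (u * x) - 1)"
        using char_jump_step[of ?a u] rate_nonneg small_step_atom[OF F(1-5)] mass_small[OF F(1-5)]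
        by (simp add: integral_scaled_restr scaleR_conv_of_real)
      moreover have 0: "of_real ?q * of_real ?a + of_real ?c * of_real (m1 (cutoff k) \<epsilon>) = (0::complex)"
        using arg_cong[OF centred[OF F(1-5)], of complex_of_real] by simp
      moreover have "of_real ?q * (iexp (u * ?a) - 1 - \<i> * of_real (u * ?a)) + of_real ?c * ?I k
          = of_real ?q * (iexp (u * ?a) - 1) + of_real ?c * (CLINT x:?B|\<nu>. iexp (u * x) - 1)
            - \<i> * of_real u * (of_real ?q * of_real ?a + of_real ?c * of_real (m1 (cutoff k) \<epsilon>))"
      proof -
        have alg: "q * (e - 1 - \<i> * (v * a)) + c * (J - \<i> * v * m) = q * (e - 1) + c * J - \<i> * v * (q * a + c * m)"
          for q e v a c J m :: complex by (simp add: algebra_simps)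
        show ?thesis unfolding I of_real_mult[of u ?a] by (rule alg)
      qed
      ultimately have "char (Sk k) u - 1 = of_real ?q * (iexp (u * ?a) - 1 - \<i> * of_real (u * ?a)) + of_real ?c * ?I k"
        by (simp only: mult_zero_right diff_zero)
      then have "of_nat (nsteps k) * (char (Sk k) u - 1)
        = of_real (nsteps k * ?q) * (iexp (u * ?a) - 1 - \<i> * of_real (u * ?a)) + of_real (real (nsteps k) * ?c) * ?I k"
        by (simp only: distrib_left mult.assoc of_real_mult of_real_of_nat_eq)
      then have "of_real t * ?I k - of_nat (nsteps k) * (char (Sk k) u - 1)
        = - (of_real (nsteps k * ?q) * (iexp (u * ?a) - 1 - \<i> * of_real (u * ?a)))"
        by (simp only: rate_nsteps) simp
      then have "norm (of_real t * ?I k - of_nat (nsteps k) * (char (Sk k) u - 1))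
          = nsteps k * \<bar>?q\<bar> * norm (iexp (u * ?a) - 1 - \<i> * of_real (u * ?a))"
        by (simp only: norm_minus_cancel norm_mult norm_of_real abs_mult abs_of_nat)
      also have "\<dots> \<le> real (nsteps k) * 1 * ((u * ?a)\<^sup>2 / 2)"
      proof (intro mult_mono order_refl iexp_2_bound)
        have "0 \<le> ?c * measure \<nu> ?B" using F(4) by simp
        then show "\<bar>?q\<bar> \<le> 1" using p_half[OF F(1-5)] by linarith
      qed simp_all
      also have "\<dots> = real (nsteps k) * (u\<^sup>2 / 2) * ?a\<^sup>2" by (simp only: power_mult_distrib, simp?)
      also have "\<dots> \<le> nsteps k * (u\<^sup>2 / 2) * (4 * (?c * small_jump_var \<nu> \<epsilon>)\<^sup>2 / (cutoff k)\<^sup>2)"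
        by (intro mult_left_mono atom_sq[OF F(1-5)]) auto
      also have "\<dots> = ?C * cutoff k"
        using cutoff_pos[of k]
        by (simp add: nsteps_cutoff rate_eq field_simps power2_eq_square power3_eq_cube)
      finally show "norm (of_real t * ?I k - of_nat (nsteps k) * (char (Sk k) u - 1)) \<le> ?C * cutoff k" .
    qed
  qed
qed

text \<open>For \<epsilon> < |x| <= 1 the compensator leaves the integral and joins the drift; this
  is the origin of \<open>trunc_drift\<close>.\<close>

lemma levy_exponent_split:
  "of_real t * levy_exponent b (\<sigma>\<^sup>2) \<nu> u
   = of_real t * zS u
     + ((\<i> * of_real (u * (t * trunc_drift b \<nu> \<epsilon>)) - of_real (u\<^sup>2 * (sqrt t * \<sigma>)\<^sup>2 / 2)) + of_real t * zB u)"
proof -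
  let ?M = "{x. \<epsilon> < \<bar>x\<bar> \<and> \<bar>x\<bar> \<le> 1}"
  let ?F = "\<lambda>x. iexp (u * x) - 1 - \<i> * of_real (u * x * indicator {x. \<bar>x\<bar> \<le> 1} x)"
  let ?S = "\<lambda>x. indicat_real {x. \<bar>x\<bar> \<le> \<epsilon>} x *\<^sub>R (iexp (u * x) - 1 - \<i> * of_real (u * x))"
  let ?B = "\<lambda>x. indicat_real {x. \<epsilon> < \<bar>x\<bar>} x *\<^sub>R (iexp (u * x) - 1)"
  let ?L = "\<lambda>x. indicat_real ?M x *\<^sub>R x"
  have b: "norm (iexp (u * x) - 1 - \<i> * of_real (u * x)) \<le> u\<^sup>2 / 2 * x\<^sup>2" for x
    using iexp_2_bound[of "u * x"] by (simp add: power_mult_distrib)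
  have iS: "integrable \<nu> ?S"
    unfolding set_integrable_def[symmetric]
    by (rule integrable_sq[where K="u\<^sup>2 / 2"], measurable, measurable, use \<epsilon> in force, rule b)
  have iB: "integrable \<nu> ?B"
    unfolding set_integrable_def[symmetric]
    by (rule integrable_indicator_away[where \<delta>=\<epsilon> and K=2], measurable, measurable, rule \<epsilon>, rule \<epsilon>, simp, rule iexp_1_bound)
  have iL: "integrable \<nu> ?L"
    unfolding set_integrable_def[symmetric] using \<epsilon>
    by (intro integrable_indicator_away[of _ _ \<epsilon> 1]) auto
  have iL': "integrable \<nu> (\<lambda>x. \<i> * of_real u * of_real (?L x))"
    by (rule Bochner_Integration.integrable_mult_right[OF integrable_of_real[OF iL]])
  have "?F x = ?S x + ?B x - \<i> * of_real u * of_real (?L x)" for x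
    using \<epsilon> by (auto simp: indicator_def)
  then have "(CLINT x|\<nu>. ?F x) = (CLINT x|\<nu>. ?S x + ?B x - \<i> * of_real u * of_real (?L x))" by simp
  also have "\<dots> = (CLINT x|\<nu>. ?S x) + (CLINT x|\<nu>. ?B x) - (CLINT x|\<nu>. \<i> * of_real u * of_real (?L x))"
    using iS iB iL' by simp
  also have "(CLINT x|\<nu>. \<i> * of_real u * of_real (?L x)) = \<i> * of_real u * of_real (LINT x:?M|\<nu>. x)"
    unfolding set_lebesgue_integral_def by (simp only: integral_mult_right_zero integral_complex_of_real)
  finally have "(CLINT x|\<nu>. ?F x) = zS u + zB u - \<i> * of_real u * of_real (LINT x:?M|\<nu>. x)"
    by (simp only: zS_def zB_def set_lebesgue_integral_def)
  then have "levy_exponent b (\<sigma>\<^sup>2) \<nu> u = \<i> * of_real (u * b) - of_real (u\<^sup>2 * \<sigma>\<^sup>2 / 2)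
      + (zS u + zB u - \<i> * of_real u * of_real (LINT x:?M|\<nu>. x))"
    by (simp only: levy_exponent_def)
  moreover have "(sqrt t * \<sigma>)\<^sup>2 = t * \<sigma>\<^sup>2" using t by (simp add: power_mult_distrib)
  ultimately show ?thesis
    unfolding trunc_drift_def by (simp only: of_real_mult of_real_diff of_real_divide) (simp add: algebra_simps)
qed

text \<open>The Gaussian part enters in one piece. The nesting fixes the order of the operators:
  large jumps act on the test function first, the Gaussian smooths the result, and the small jumps
  meet a smooth function.\<close>

definition walk :: "real \<Rightarrow> real \<Rightarrow> nat \<Rightarrow> real measure" where
  "walk b \<sigma> k = conv_pow (Sk k) (nsteps k)
     (gauss (t * trunc_drift b \<nu> \<epsilon>) (sqrt t * \<sigma>) \<star> conv_pow (Qk k) (nsteps k) (return borel 0))"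

lemma real_distribution_walk: "admissible k \<Longrightarrow> real_distribution (walk b \<sigma> k)"
  unfolding walk_def
  by (intro real_distribution_conv_pow real_distribution_convolution real_distribution_Sk real_distribution_Qk
      real_distribution_gauss real_distribution_return)

lemma char_walk_limit: "(\<lambda>k. char (walk b \<sigma> k) u) \<longlonglongrightarrow> exp (of_real t * levy_exponent b (\<sigma>\<^sup>2) \<nu> u)"
proof (rule Lim_transform_eventually)
  let ?G = "char (gauss (t * trunc_drift b \<nu> \<epsilon>) (sqrt t * \<sigma>)) u"
  have "(\<lambda>k. char (Sk k) u ^ nsteps k * (?G * char (Qk k) u ^ nsteps k))
      \<longlonglongrightarrow> exp (of_real t * zS u) * (?G * exp (of_real t * zB u))"
    by (intro tendsto_mult tendsto_const char_Sk_limit char_Qk_limit)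
  also have "exp (of_real t * zS u) * (?G * exp (of_real t * zB u)) = exp (of_real t * levy_exponent b (\<sigma>\<^sup>2) \<nu> u)"
    unfolding levy_exponent_split exp_add char_gauss ..
  finally show "(\<lambda>k. char (Sk k) u ^ nsteps k * (?G * char (Qk k) u ^ nsteps k))
      \<longlonglongrightarrow> exp (of_real t * levy_exponent b (\<sigma>\<^sup>2) \<nu> u)" .
  show "eventually (\<lambda>k. char (Sk k) u ^ nsteps k * (?G * char (Qk k) u ^ nsteps k) = char (walk b \<sigma> k) u) sequentially"
    using eventually_admissible
  proof eventually_elim
    case (elim k)
    note S = real_distribution_Sk[OF elim] and Q = real_distribution_Qk[OF elim]
    note QR = real_distribution_conv_pow[OF Q real_distribution_return]
    note G = real_distribution_gauss
    have "iexp (u * 0) = 1" by simp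
    then show ?case
      unfolding walk_def char_conv_pow[OF S real_distribution_convolution[OF G QR]] char_convolution[OF G QR]
        char_conv_pow[OF Q real_distribution_return] char_return
      by (simp only: mult_1_right)
  qed
qed

lemma integral_walk:
  assumes "admissible k" "test_fun h"
  shows "integral\<^sup>L (walk b \<sigma> k) h
    = (avg (Sk k) ^^ nsteps k) (avg (gauss (t * trunc_drift b \<nu> \<epsilon>) (sqrt t * \<sigma>)) ((avg (Qk k) ^^ nsteps k) h)) 0"
proof -
  note S = real_distribution_Sk[OF assms(1)] and Q = real_distribution_Qk[OF assms(1)]
  note QR = real_distribution_conv_pow[OF Q real_distribution_return]
  note G = real_distribution_gauss
  have "integral\<^sup>L (walk b \<sigma> k) h = avg (walk b \<sigma> k) h 0" by (simp add: avg_def)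
  moreover have "avg (return borel 0) h = h" using assms(2) by (auto simp: avg_return)
  ultimately show ?thesis
    unfolding walk_def avg_conv_pow[OF S real_distribution_convolution[OF G QR] assms(2)]
      avg_convolution[OF G QR assms(2)] avg_conv_pow[OF Q real_distribution_return assms(2)]
    by (simp only:)
qed

lemma integral_walk_limit:
  assumes P: "real_distribution P" and ch: "\<And>u. char P u = exp (of_real t * levy_exponent b (\<sigma>\<^sup>2) \<nu> u)"
    and h: "test_fun h" "continuous_on UNIV h"
  shows "(\<lambda>k. integral\<^sup>L (walk b \<sigma> k) h) \<longlonglongrightarrow> integral\<^sup>L P h"
proof -
  \<comment> \<open>\<open>levy_continuity\<close> asks for a distribution at every index, so the
    first N walks are skipped.\<close>
  obtain N where N: "\<And>k. N \<le> k \<Longrightarrow> admissible k"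
    using eventually_admissible by (auto simp: eventually_sequentially)
  let ?W = "\<lambda>k. walk b \<sigma> (k + N)"
  have R: "real_distribution (?W k)" for k by (rule real_distribution_walk[OF N]) simp
  have "weak_conv_m ?W P"
  proof (rule levy_continuity[OF R P])
    fix u
    show "(\<lambda>k. char (?W k) u) \<longlonglongrightarrow> char P u"
      unfolding ch by (rule LIMSEQ_ignore_initial_segment[OF char_walk_limit])
  qed
  then have "(\<lambda>k. integral\<^sup>L (?W k) h) \<longlonglongrightarrow> integral\<^sup>L P h"
    using h by (intro weak_conv_imp_integral_bdd_continuous_conv[OF R P, where B=1])
      (auto simp: test_funD continuous_on_eq_continuous_at)
  then show ?thesis by (rule LIMSEQ_offset)
qed

text \<open>The bracket in the third bound of \<open>lindeberg\<close>, at the Gaussian scale sqrt t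
  * \<sigma>.\<close>

definition lind_err :: "real \<Rightarrow> nat \<Rightarrow> real" where
  "lind_err \<sigma> k = nsteps k * (4 * (rate t k * small_jump_var \<nu> \<epsilon>)\<^sup>2 / (cutoff k)\<^sup>2 + rate t k * small_jump_var \<nu> (cutoff k)) / (2 * (sqrt t * \<sigma>)\<^sup>2)
     + (\<epsilon> * (rate t k * small_jump_var \<nu> \<epsilon>) + 2 * nsteps k * sqrt (rate t k * small_jump_var \<nu> \<epsilon>) ^ 3)
        / (2 * sqrt (2 * pi) * (sqrt t * \<sigma>) ^ 3)"

lemma lind_err_tendsto: "lind_err \<sigma> \<longlonglongrightarrow> 0"
proof -
  let ?v = "small_jump_var \<nu> \<epsilon>"
  have v: "0 \<le> ?v" by (rule small_jump_var_nonneg)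
  have 1: "nsteps k * (4 * (rate t k * ?v)\<^sup>2 / (cutoff k)\<^sup>2 + rate t k * small_jump_var \<nu> (cutoff k))
      = 4 * t\<^sup>2 * ?v\<^sup>2 * cutoff k + t * small_jump_var \<nu> (cutoff k)" for k
    using cutoff_pos[of k] by (simp add: nsteps_cutoff rate_eq field_simps power2_eq_square power3_eq_cube)
  \<comment> \<open>With \<tau> the variance per step, n \<tau>^(3/2) = (n \<tau>) sqrt \<tau>, and
    n \<tau> does not depend on n.\<close>
  have 2: "2 * nsteps k * sqrt (rate t k * ?v) ^ 3 = 2 * (t * ?v) * sqrt (t * cutoff k ^ 3 * ?v)" for k
  proof -
    have "sqrt (rate t k * ?v) ^ 3 = (rate t k * ?v) * sqrt (rate t k * ?v)"
      using v rate_nonneg[of k] by (simp add: power3_eq_cube)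
    then show ?thesis using rate_nsteps[of k t] by (simp add: rate_eq mult.assoc[symmetric])
  qed
  have e: "lind_err \<sigma> = (\<lambda>k. (4 * t\<^sup>2 * ?v\<^sup>2 * cutoff k + t * small_jump_var \<nu> (cutoff k)) / (2 * (sqrt t * \<sigma>)\<^sup>2)
     + (\<epsilon> * (t * cutoff k ^ 3 * ?v) + 2 * (t * ?v) * sqrt (t * cutoff k ^ 3 * ?v)) / (2 * sqrt (2 * pi) * (sqrt t * \<sigma>) ^ 3))"
    by (rule ext) (simp only: lind_err_def 1 2, simp only: rate_eq)
  have "(\<lambda>k. (4 * t\<^sup>2 * ?v\<^sup>2 * cutoff k + t * small_jump_var \<nu> (cutoff k)) / (2 * (sqrt t * \<sigma>)\<^sup>2)
     + (\<epsilon> * (t * cutoff k ^ 3 * ?v) + 2 * (t * ?v) * sqrt (t * cutoff k ^ 3 * ?v)) / (2 * sqrt (2 * pi) * (sqrt t * \<sigma>) ^ 3))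
    \<longlonglongrightarrow> (4 * t\<^sup>2 * ?v\<^sup>2 * 0 + t * 0) / (2 * (sqrt t * \<sigma>)\<^sup>2)
     + (\<epsilon> * (t * 0 ^ 3 * ?v) + 2 * (t * ?v) * sqrt (t * 0 ^ 3 * ?v)) / (2 * sqrt (2 * pi) * (sqrt t * \<sigma>) ^ 3)"
    unfolding divide_inverse by (intro tendsto_intros cutoff_tendsto small_jump_var_cutoff)
  then show ?thesis unfolding e by simp
qed

text \<open>The alternative with \<epsilon> / 2 is the main term of the third-order bound. The other
  one interpolates between the trivial bound 1 and the second-order bound r^2 by way of min(1, r^2)
  <= r.\<close>

lemma walk_small_jumps:
  assumes \<sigma>: "0 < \<sigma>" and f: "test_fun f" and k: "admissible k"
  shows "\<bar>(avg (Sk k) ^^ nsteps k) (avg (gauss m (sqrt t * \<sigma>)) f) x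
      - avg (gauss m (sqrt t * sqrt (\<sigma>\<^sup>2 + small_jump_var \<nu> \<epsilon>))) f x\<bar>
    \<le> sqrt (2 / (pi * t * \<sigma>\<^sup>2)) * min (2 * sqrt (t * small_jump_var \<nu> \<epsilon>)) (\<epsilon> / 2) + lind_err \<sigma> k" (is "?D \<le> _")
proof -
  let ?v = "small_jump_var \<nu> \<epsilon>" and ?s = "sqrt t * \<sigma>"
  let ?e = "4 * (rate t k * ?v)\<^sup>2 / (cutoff k)\<^sup>2"
  note F = admissibleD[OF k]
  have s: "0 < ?s" using t \<sigma> by simp
  have v: "0 \<le> ?v" "0 \<le> small_jump_var \<nu> (cutoff k)" by (rule small_jump_var_nonneg)+
  have ss: "sqrt (?s\<^sup>2 + nsteps k * (rate t k * ?v)) = sqrt t * sqrt (\<sigma>\<^sup>2 + ?v)"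
  proof -
    have "real (nsteps k) * (rate t k * ?v) = t * ?v" using rate_nsteps[of k t] by (simp add: mult.assoc[symmetric])
    then have "?s\<^sup>2 + nsteps k * (rate t k * ?v) = t * (\<sigma>\<^sup>2 + ?v)" using t by (simp add: power_mult_distrib distrib_left)
    then show ?thesis by (simp only: real_sqrt_mult)
  qed
  note L = lindeberg[OF F(1-5) s f, where m=m and n="nsteps k" and x=x, unfolded ss]
  define E1 where "E1 = nsteps k * (?e + rate t k * small_jump_var \<nu> (cutoff k)) / (2 * ?s\<^sup>2)"
  define E2 where "E2 = (\<epsilon> * (rate t k * ?v) + 2 * nsteps k * sqrt (rate t k * ?v) ^ 3) / (2 * sqrt (2 * pi) * ?s ^ 3)"
  have E: "lind_err \<sigma> k = E1 + E2" by (simp add: lind_err_def E1_def E2_def)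
  have E2: "0 \<le> E2" unfolding E2_def using \<epsilon> v F(4) s by (intro divide_nonneg_pos add_nonneg_nonneg) auto
  have c: "sqrt (2 / (pi * t * \<sigma>\<^sup>2)) = sqrt (2 / pi) / ?s"
    using \<sigma> by (simp add: real_sqrt_divide real_sqrt_mult)
  have "?D \<le> \<epsilon> / (sqrt (2 * pi) * ?s) + (E1 + E2)"
    using L(3) by (simp add: E1_def E2_def)
  also have "\<epsilon> / (sqrt (2 * pi) * ?s) = sqrt (2 / (pi * t * \<sigma>\<^sup>2)) * (\<epsilon> / 2)"
  proof -
    have "sqrt (2 / (pi * t * \<sigma>\<^sup>2)) * (\<epsilon> / 2) = (sqrt (2 / pi) / 2) * \<epsilon> / ?s" unfolding c by simp
    then show ?thesis unfolding sqrt_2_pi by simp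
  qed
  finally have B: "?D \<le> sqrt (2 / (pi * t * \<sigma>\<^sup>2)) * (\<epsilon> / 2) + (E1 + E2)" .
  \<comment> \<open>Ratio of the standard deviations of the small jumps and of the Gaussian
    part.\<close>
  define r where "r = sqrt (t * ?v) / ?s"
  have r0: "0 \<le> r" using s t v by (simp add: r_def)
  have r2: "r\<^sup>2 = t * ?v / ?s\<^sup>2" using t v by (simp add: r_def power_divide)
  have "?D \<le> nsteps k * (2 * (rate t k * ?v) + ?e) / (2 * ?s\<^sup>2)" by (rule L(2))
  also have "\<dots> \<le> nsteps k * (2 * (rate t k * ?v)) / (2 * ?s\<^sup>2) + E1"
    unfolding E1_def add_divide_distrib[symmetric] distrib_left[symmetric] using v F(4)
    by (intro divide_right_mono mult_left_mono) auto
  also have "nsteps k * (2 * (rate t k * ?v)) / (2 * ?s\<^sup>2) = r\<^sup>2"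
    unfolding r2 using rate_nsteps[of k t] by (simp add: mult.assoc[symmetric] mult.left_commute[of "real (nsteps k)"])
  finally have A: "?D \<le> r\<^sup>2 + E1" .
  have E1: "0 \<le> E1" unfolding E1_def using v F(4) by (intro divide_nonneg_nonneg mult_nonneg_nonneg add_nonneg_nonneg) auto
  have "?D \<le> r + E1"
  proof (cases "r \<le> 1")
    case True
    then have "r\<^sup>2 \<le> r" using r0 by (simp add: power2_eq_square mult_left_le)
    with A show ?thesis by linarith
  next
    case False
    with L(1) E1 show ?thesis by linarith
  qed
  also have "r \<le> sqrt (2 / (pi * t * \<sigma>\<^sup>2)) * (2 * sqrt (t * ?v))"
  proof -
    have "sqrt (1 / 4) \<le> sqrt (2 / pi)" using pi_less_4 by (intro real_sqrt_le_mono) (simp add: field_simps)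
    then have "1 \<le> 2 * sqrt (2 / pi)" by (simp add: real_sqrt_divide)
    then have "1 * r \<le> 2 * sqrt (2 / pi) * r" using r0 by (intro mult_right_mono)
    then show ?thesis unfolding c r_def by (simp add: mult.left_commute)
  qed
  finally have A': "?D \<le> sqrt (2 / (pi * t * \<sigma>\<^sup>2)) * (2 * sqrt (t * ?v)) + (E1 + E2)" using E2 by simp
  show ?thesis
    unfolding E using A' B by (cases "2 * sqrt (t * ?v) \<le> \<epsilon> / 2") (simp_all add: min_absorb1 min_absorb2)
qed

end
end

subsection \<open>The bound\<close>

theorem theorem14:
  fixes M1 :: "'a measure" and X1 :: "real \<Rightarrow> 'a \<Rightarrow> real"
    and M2 :: "'b measure" and X2 :: "real \<Rightarrow> 'b \<Rightarrow> real"
    and b1 b2 \<sigma>1 \<sigma>2 t \<epsilon> :: real and \<nu>1 \<nu>2 :: "real measure"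
  assumes "\<sigma>1 > 0" and "\<sigma>2 > 0"
    and "levy_measure \<nu>1" and "levy_measure \<nu>2"
    and "levy_process M1 X1" and "has_characteristics M1 X1 b1 (\<sigma>1\<^sup>2) \<nu>1"
    and "levy_process M2 X2" and "has_characteristics M2 X2 b2 (\<sigma>2\<^sup>2) \<nu>2"
    and "t > 0" and "0 < \<epsilon>" and "\<epsilon> \<le> 1"
  shows "tv_dist (distr M1 borel (X1 t)) (distr M2 borel (X2 t))
    \<le> (sqrt (t / (2 * pi)) * \<bar>trunc_drift b1 \<nu>1 \<epsilon> - trunc_drift b2 \<nu>2 \<epsilon>\<bar>
         + sqrt 2 * \<bar>sqrt (\<sigma>1\<^sup>2 + small_jump_var \<nu>1 \<epsilon>) - sqrt (\<sigma>2\<^sup>2 + small_jump_var \<nu>2 \<epsilon>)\<bar>)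
        / max (sqrt (\<sigma>1\<^sup>2 + small_jump_var \<nu>1 \<epsilon>)) (sqrt (\<sigma>2\<^sup>2 + small_jump_var \<nu>2 \<epsilon>))
      + (sqrt (2 / (pi * t * \<sigma>1\<^sup>2)) * min (2 * sqrt (t * small_jump_var \<nu>1 \<epsilon>)) (\<epsilon> / 2)
         + sqrt (2 / (pi * t * \<sigma>2\<^sup>2)) * min (2 * sqrt (t * small_jump_var \<nu>2 \<epsilon>)) (\<epsilon> / 2))
      + t * \<bar>jump_intensity \<nu>1 \<epsilon> - jump_intensity \<nu>2 \<epsilon>\<bar>
      + (if min (jump_intensity \<nu>1 \<epsilon>) (jump_intensity \<nu>2 \<epsilon>) = 0 then 0
         else t * min (jump_intensity \<nu>1 \<epsilon>) (jump_intensity \<nu>2 \<epsilon>)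
                * tv_dist (jump_law \<nu>1 \<epsilon>) (jump_law \<nu>2 \<epsilon>))"
proof -
  let ?G = "(sqrt (t / (2 * pi)) * \<bar>trunc_drift b1 \<nu>1 \<epsilon> - trunc_drift b2 \<nu>2 \<epsilon>\<bar>
         + sqrt 2 * \<bar>sqrt (\<sigma>1\<^sup>2 + small_jump_var \<nu>1 \<epsilon>) - sqrt (\<sigma>2\<^sup>2 + small_jump_var \<nu>2 \<epsilon>)\<bar>)
        / max (sqrt (\<sigma>1\<^sup>2 + small_jump_var \<nu>1 \<epsilon>)) (sqrt (\<sigma>2\<^sup>2 + small_jump_var \<nu>2 \<epsilon>))"
  let ?B1 = "sqrt (2 / (pi * t * \<sigma>1\<^sup>2)) * min (2 * sqrt (t * small_jump_var \<nu>1 \<epsilon>)) (\<epsilon> / 2)"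
  let ?B2 = "sqrt (2 / (pi * t * \<sigma>2\<^sup>2)) * min (2 * sqrt (t * small_jump_var \<nu>2 \<epsilon>)) (\<epsilon> / 2)"
  let ?J1 = "t * \<bar>jump_intensity \<nu>1 \<epsilon> - jump_intensity \<nu>2 \<epsilon>\<bar>"
  let ?J2 = "if min (jump_intensity \<nu>1 \<epsilon>) (jump_intensity \<nu>2 \<epsilon>) = 0 then 0
         else t * min (jump_intensity \<nu>1 \<epsilon>) (jump_intensity \<nu>2 \<epsilon>)
                * tv_dist (jump_law \<nu>1 \<epsilon>) (jump_law \<nu>2 \<epsilon>)"
  note t = \<open>t > 0\<close> and \<epsilon> = \<open>0 < \<epsilon>\<close> \<open>\<epsilon> \<le> 1\<close> and \<sigma> = \<open>\<sigma>1 > 0\<close> \<open>\<sigma>2 > 0\<close>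
  interpret n1: levy \<nu>1 by unfold_locales fact
  interpret n2: levy \<nu>2 by unfold_locales fact
  interpret X1: levy_process M1 X1 by fact
  interpret X2: levy_process M2 X2 by fact
  let ?P1 = "distr M1 borel (X1 t)" and ?P2 = "distr M2 borel (X2 t)"
  have P1: "real_distribution ?P1"
    using X1.random_variable_X[of t] t by (intro X1.real_distribution_distr) simp
  have P2: "real_distribution ?P2"
    using X2.random_variable_X[of t] t by (intro X2.real_distribution_distr) simp
  have ch1: "char ?P1 u = exp (of_real t * levy_exponent b1 (\<sigma>1\<^sup>2) \<nu>1 u)" for u
    using assms(6) t by (simp add: has_characteristics_def)
  have ch2: "char ?P2 u = exp (of_real t * levy_exponent b2 (\<sigma>2\<^sup>2) \<nu>2 u)" for u
    using assms(8) t by (simp add: has_characteristics_def)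
  let ?v1 = "small_jump_var \<nu>1 \<epsilon>" and ?v2 = "small_jump_var \<nu>2 \<epsilon>"
  let ?s1 = "sqrt (\<sigma>1\<^sup>2 + ?v1)" and ?s2 = "sqrt (\<sigma>2\<^sup>2 + ?v2)"
  let ?m1 = "t * trunc_drift b1 \<nu>1 \<epsilon>" and ?m2 = "t * trunc_drift b2 \<nu>2 \<epsilon>"
  have s: "0 < ?s1" "0 < ?s2"
    using \<sigma> n1.small_jump_var_nonneg n2.small_jump_var_nonneg by (simp_all add: add_pos_nonneg)
  have G: "\<bar>avg (gauss ?m1 (sqrt t * ?s1)) f x - avg (gauss ?m2 (sqrt t * ?s2)) f x\<bar> \<le> ?G"
    if f: "test_fun f" for f x
  proof -
    have st: "0 < sqrt t" using t by simp
    have "\<bar>avg (gauss ?m1 (sqrt t * ?s1)) f x - avg (gauss ?m2 (sqrt t * ?s2)) f x\<bar>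
        \<le> (\<bar>?m1 - ?m2\<bar> / sqrt (2 * pi) + \<bar>sqrt t * ?s1 - sqrt t * ?s2\<bar>) / max (sqrt t * ?s1) (sqrt t * ?s2)"
      by (rule gauss_dist[OF f mult_pos_pos[OF st s(1)] mult_pos_pos[OF st s(2)]])
    also have "\<dots> = (sqrt t * (sqrt (t / (2 * pi)) * \<bar>trunc_drift b1 \<nu>1 \<epsilon> - trunc_drift b2 \<nu>2 \<epsilon>\<bar> + \<bar>?s1 - ?s2\<bar>))
        / (sqrt t * max ?s1 ?s2)"
    proof -
      \<comment> \<open>One factor sqrt t cancels against the scale in the denominator, the other
        forms sqrt (t / (2 pi)).\<close>
      have tt: "t = sqrt t * sqrt t" using t by simp
      have "\<bar>?m1 - ?m2\<bar> = t * \<bar>trunc_drift b1 \<nu>1 \<epsilon> - trunc_drift b2 \<nu>2 \<epsilon>\<bar>"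
        using t by (simp add: right_diff_distrib[symmetric] abs_mult)
      also have "\<dots> / sqrt (2 * pi) = sqrt t * (sqrt (t / (2 * pi)) * \<bar>trunc_drift b1 \<nu>1 \<epsilon> - trunc_drift b2 \<nu>2 \<epsilon>\<bar>)"
        by (subst tt) (simp add: real_sqrt_divide)
      finally have 1: "\<bar>?m1 - ?m2\<bar> / sqrt (2 * pi) = sqrt t * (sqrt (t / (2 * pi)) * \<bar>trunc_drift b1 \<nu>1 \<epsilon> - trunc_drift b2 \<nu>2 \<epsilon>\<bar>)" .
      have 2: "\<bar>sqrt t * ?s1 - sqrt t * ?s2\<bar> = sqrt t * \<bar>?s1 - ?s2\<bar>"
        using st by (simp only: right_diff_distrib[symmetric] abs_mult abs_of_pos)
      have 3: "max (sqrt t * ?s1) (sqrt t * ?s2) = sqrt t * max ?s1 ?s2"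
        using st by (simp add: max_def)
      show ?thesis unfolding 1 2 3 distrib_left ..
    qed
    also have "\<dots> = (sqrt (t / (2 * pi)) * \<bar>trunc_drift b1 \<nu>1 \<epsilon> - trunc_drift b2 \<nu>2 \<epsilon>\<bar> + 1 * \<bar>?s1 - ?s2\<bar>) / max ?s1 ?s2"
      using st by simp
    \<comment> \<open>The scales are compared with constant 1, which is enlarged to sqrt 2
      here.\<close>
    also have "\<dots> \<le> ?G"
      using s by (intro divide_right_mono add_left_mono mult_right_mono) (auto simp: le_max_iff_disj)
    finally show ?thesis .
  qed
  have "tv_dist ?P1 ?P2 \<le> ?G + (?B1 + ?B2) + t * jump_dist \<nu>1 \<nu>2 \<epsilon>"
  proof (rule tv_dist_le[OF P1 P2])
    fix h assume h: "test_fun h" "continuous_on UNIV h"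
    let ?W1 = "\<lambda>k. integral\<^sup>L (n1.walk t \<epsilon> b1 \<sigma>1 k) h" and ?W2 = "\<lambda>k. integral\<^sup>L (n2.walk t \<epsilon> b2 \<sigma>2 k) h"
    let ?e1 = "n1.lind_err t \<epsilon> \<sigma>1" and ?e2 = "n2.lind_err t \<epsilon> \<sigma>2"
    have lim: "(\<lambda>k. \<bar>?W1 k - ?W2 k\<bar>) \<longlonglongrightarrow> \<bar>integral\<^sup>L ?P1 h - integral\<^sup>L ?P2 h\<bar>"
      by (intro tendsto_rabs tendsto_diff n1.integral_walk_limit[OF t \<epsilon> P1 ch1 h] n2.integral_walk_limit[OF t \<epsilon> P2 ch2 h])
    have "(\<lambda>k. ?G + (?B1 + ?B2) + t * jump_dist \<nu>1 \<nu>2 \<epsilon> + (?e1 k + ?e2 k))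
        \<longlonglongrightarrow> ?G + (?B1 + ?B2) + t * jump_dist \<nu>1 \<nu>2 \<epsilon> + (0 + 0)"
      by (intro tendsto_add tendsto_const n1.lind_err_tendsto[OF t \<epsilon>] n2.lind_err_tendsto[OF t \<epsilon>])
    then have lim': "(\<lambda>k. ?G + (?B1 + ?B2) + t * jump_dist \<nu>1 \<nu>2 \<epsilon> + (?e1 k + ?e2 k))
        \<longlonglongrightarrow> ?G + (?B1 + ?B2) + t * jump_dist \<nu>1 \<nu>2 \<epsilon>" by simp
    show "\<bar>integral\<^sup>L ?P1 h - integral\<^sup>L ?P2 h\<bar> \<le> ?G + (?B1 + ?B2) + t * jump_dist \<nu>1 \<nu>2 \<epsilon>"
    proof (rule tendsto_le[OF _ lim' lim])
      show "eventually (\<lambda>k. \<bar>?W1 k - ?W2 k\<bar> \<le> ?G + (?B1 + ?B2) + t * jump_dist \<nu>1 \<nu>2 \<epsilon> + (?e1 k + ?e2 k)) sequentially"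
        using n1.eventually_admissible[OF t \<epsilon>] n2.eventually_admissible[OF t \<epsilon>]
      proof eventually_elim
        case (elim k)
        note F1 = n1.admissibleD[OF t \<epsilon> elim(1)] and F2 = n2.admissibleD[OF t \<epsilon> elim(2)]
        let ?Q1 = "jump_step (scaled_restr (rate t k) {x. \<epsilon> < \<bar>x\<bar>} \<nu>1) 0"
        let ?Q2 = "jump_step (scaled_restr (rate t k) {x. \<epsilon> < \<bar>x\<bar>} \<nu>2) 0"
        let ?S1 = "avg (small_step \<nu>1 (rate t k) (cutoff k) \<epsilon>) ^^ nsteps k"
        let ?S2 = "avg (small_step \<nu>2 (rate t k) (cutoff k) \<epsilon>) ^^ nsteps k"
        let ?N1 = "avg (gauss ?m1 (sqrt t * \<sigma>1))" and ?N2 = "avg (gauss ?m2 (sqrt t * \<sigma>2))"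
        let ?L1 = "avg (gauss ?m1 (sqrt t * ?s1))" and ?L2 = "avg (gauss ?m2 (sqrt t * ?s2))"
        define H1 where "H1 = (avg ?Q1 ^^ nsteps k) h"
        define H2 where "H2 = (avg ?Q2 ^^ nsteps k) h"
        note Q1 = n1.real_distribution_Qk[OF t \<epsilon> elim(1)] and Q2 = n2.real_distribution_Qk[OF t \<epsilon> elim(2)]
        have H: "test_fun H1" "test_fun H2"
          unfolding H1_def H2_def by (intro avg_pow_test_fun h Q1 Q2)+
        have Hdiff: "\<bar>H1 x - H2 x\<bar> \<le> t * jump_dist \<nu>1 \<nu>2 \<epsilon>" for x
        proof -
          have "\<bar>H1 x - H2 x\<bar> \<le> real (nsteps k) * (rate t k * jump_dist \<nu>1 \<nu>2 \<epsilon>)"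
            unfolding H1_def H2_def
            by (rule avg_pow_diff[OF Q1 Q2 h(1) avg_big_jump_diff[OF assms(3,4) \<epsilon> F1(4,6) F2(6)]])
          then show ?thesis by (simp only: mult.assoc[symmetric] rate_nsteps)
        qed
        have W: "?W1 k = ?S1 (?N1 H1) 0" "?W2 k = ?S2 (?N2 H2) 0"
          unfolding H1_def H2_def
          by (rule n1.integral_walk[OF t \<epsilon> elim(1) h(1)], rule n2.integral_walk[OF t \<epsilon> elim(2) h(1)])
        \<comment> \<open>All comparisons are made with the single test function H1. Only the last
          one exchanges H1 for H2, and the contractions outside carry the difference through
          unchanged.\<close>
        have 1: "\<bar>?S1 (?N1 H1) 0 - ?L1 H1 0\<bar> \<le> ?B1 + ?e1 k"
          by (rule n1.walk_small_jumps[OF t \<epsilon> \<sigma>(1) H(1) elim(1)])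
        have 2: "\<bar>?L1 H1 0 - ?L2 H1 0\<bar> \<le> ?G" by (rule G[OF H(1)])
        have 3: "\<bar>?S2 (?N2 H1) 0 - ?L2 H1 0\<bar> \<le> ?B2 + ?e2 k"
          by (rule n2.walk_small_jumps[OF t \<epsilon> \<sigma>(2) H(1) elim(2)])
        have 4: "\<bar>?S2 (?N2 H1) 0 - ?S2 (?N2 H2) 0\<bar> \<le> t * jump_dist \<nu>1 \<nu>2 \<epsilon>"
          by (rule avg_pow_contraction[OF avg_test_fun[OF H(1) real_distribution_gauss]
                avg_test_fun[OF H(2) real_distribution_gauss] n2.real_distribution_Sk[OF t \<epsilon> elim(2)]
                avg_contraction[OF H real_distribution_gauss Hdiff]])
        have tri: "\<bar>a - e\<bar> \<le> g + (p + q) + j + (x + y)"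
          if "\<bar>a - b\<bar> \<le> p + x" "\<bar>b - c\<bar> \<le> g" "\<bar>d - c\<bar> \<le> q + y" "\<bar>d - e\<bar> \<le> j" for a b c d e g p q j x y :: real
          using that by linarith
        show ?case unfolding W by (rule tri[OF 1 2 3 4])
      qed
    qed simp
  qed
  also have "t * jump_dist \<nu>1 \<nu>2 \<epsilon> = ?J1 + ?J2"
    by (simp add: jump_dist_def distrib_left)
  finally show ?thesis by (simp only: add.assoc)
qed

end
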